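(* Let $G\colon[0,1]\to[0,1]$ be the Gauss map, $G(x)=\frac1x \bmod 1$ for $x\neq0$ and $G(0)=0$, and let $\mu$ be its ergodic absolutely continuous invariant probability measure, with density $\frac{1}{(\log 2)(1+x)}$. For $\tilde{x}\in[0,1]$ consider the observable $\phi(x)=\psi(|x-\tilde{x}|)$ with $\psi(y)\to\infty$ as $y\to0$. Let $(r_n)$ be a non-increasing sequence of positive numbers such that $r_n=O(n^{-\sigma})$ for some $\sigma>\frac45$ and such that for any $t>0$ $$\limsup_{k\to\infty}\frac{r_{k^t}}{r_{(k+1)^t}}<\infty .$$ Then for $\mu$-a.e. $\tilde{x}$ for which $n\mapsto n\mu(B(\tilde{x},r_n))$ is non-decreasing, the following dichotomy holds. (1) If $$\sum_{n=1}^\infty \mu(B(\tilde{x},r_n))\,e^{-n\mu(B(\tilde{x},r_n))}<\infty \quad\text{and}\quad \sum_{n=1}^\infty\mu(B(\tilde{x},r_n))=\infty,$$ then $\mu(\mathcal{H}_{\mathrm{ea}})=\mu(\psi(r_n)\le M_n \text{ ev.})=1$. (2) If $$\sum_{n=1}^\infty \mu(B(\tilde{x},r_n))\,e^{-n\mu(B(\tilde{x},r_n))}=\infty,$$ then $\mu(\mathcal{H}_{\mathrm{ea}})=\mu(\psi(r_n)\le M_n\text{ ev.})=0$.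
   Context: $B(x,r)=\{y\in[0,1]:|x-y|<r\}$. The function $\psi\colon[0,\infty)\to\mathbb{R}\cup\{+\infty\}$ is (strictly) decreasing and continuous. Put $X_i=\phi\circ G^{i-1}$, $i\ge1$, and $M_n=\max(X_1,\dots,X_n)$. An event $(E_n\text{ ev.})$ is the set of points belonging to $E_n$ for all sufficiently large $n$. With $B_m=B(\tilde{x},r_m)$, $$\mathcal{H}_{\mathrm{ea}}=\bigcup_{n=1}^\infty\bigcap_{m=n}^\infty\bigcup_{k=0}^{m-1}G^{-k}(B_m).$$ Non-integer indices such as $k^t$ in $r_{k^t}$ are understood as integer parts. *)

theory Defs
  imports "HOL-Analysis.Analysis" "HOL-Library.Landau_Symbols"
begin

definition gauss_map :: "real \<Rightarrow> real" where
  "gauss_map x = (if x = 0 then 0 else frac (1 / x))"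

definition gauss_measure :: "real measure" where
  "gauss_measure =
     density (restrict_space lborel {0..1}) (\<lambda>x. ennreal (1 / (ln 2 * (1 + x))))"

definition unit_ball :: "real \<Rightarrow> real \<Rightarrow> real set" where
  "unit_ball x r = {y \<in> {0..1}. \<bar>x - y\<bar> < r}"

definition observable :: "(real \<Rightarrow> ereal) \<Rightarrow> real \<Rightarrow> real \<Rightarrow> ereal" where
  "observable \<psi> z x = \<psi> \<bar>x - z\<bar>"

text \<open>The process is indexed from 1.\<close>

definition obs_process :: "(real \<Rightarrow> ereal) \<Rightarrow> real \<Rightarrow> nat \<Rightarrow> real \<Rightarrow> ereal" where
  "obs_process \<psi> z i x = observable \<psi> z ((gauss_map ^^ (i - 1)) x)"

definition obs_max :: "(real \<Rightarrow> ereal) \<Rightarrow> real \<Rightarrow> nat \<Rightarrow> real \<Rightarrow> ereal" where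
  "obs_max \<psi> z n x = Max ((\<lambda>i. obs_process \<psi> z i x) ` {1..n})"

definition ev_always_hit :: "(nat \<Rightarrow> real) \<Rightarrow> real \<Rightarrow> real set" where
  "ev_always_hit r z =
     (\<Union>n\<in>{1..}. \<Inter>m\<in>{n..}. \<Union>k\<in>{..<m}.
        {x \<in> {0..1}. (gauss_map ^^ k) x \<in> unit_ball z (r m)})"

definition max_event :: "(real \<Rightarrow> ereal) \<Rightarrow> (nat \<Rightarrow> real) \<Rightarrow> real \<Rightarrow> real set" where
  "max_event \<psi> r z =
     {x \<in> {0..1}. \<forall>\<^sub>F n in sequentially. \<psi> (r n) \<le> obs_max \<psi> z n x}"

lemma space_gauss_measure [simp]: "space gauss_measure = {0..1}"
  by (simp add: gauss_measure_def space_restrict_space)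

lemma sets_gauss_measure [measurable_cong]:
  "sets gauss_measure = sets (restrict_space borel {0..1})"
  by (simp add: gauss_measure_def sets_restrict_space)

lemma measurable_gauss_map [measurable]: "gauss_map \<in> borel_measurable borel"
  unfolding gauss_map_def frac_def by measurable

lemma measurable_gauss_map_funpow [measurable]:
  "(gauss_map ^^ k) \<in> borel_measurable borel"
  by (induction k) (auto intro: measurable_comp simp: comp_def)

lemma sets_unit_ball [measurable]: "unit_ball z s \<in> sets borel"
  unfolding unit_ball_def by measurable

text \<open>Both events are measurable, so their \<^const>\<open>measure\<close> is not a default value.\<close>

lemma sets_ev_always_hit: "ev_always_hit r z \<in> sets gauss_measure"
proof -
  have "ev_always_hit r z \<in> sets borel"
    unfolding ev_always_hit_def by measurable
  moreover have "ev_always_hit r z \<subseteq> {0..1}"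
    unfolding ev_always_hit_def by fastforce
  ultimately show ?thesis
    by (auto simp: sets_gauss_measure sets_restrict_space_iff)
qed

lemma sets_max_event:
  assumes "continuous_on {0..} \<psi>"
  shows "max_event \<psi> r z \<in> sets gauss_measure"
proof -
  define \<psi>' where "\<psi>' x = \<psi> (max 0 x)" for x
  have "continuous_on UNIV \<psi>'"
    unfolding \<psi>'_def
    by (rule continuous_on_compose2[OF assms]) (auto intro!: continuous_intros)
  then have [measurable]: "\<psi>' \<in> borel_measurable borel"
    by (rule borel_measurable_continuous_onI)
  have obs: "observable \<psi> z = (\<lambda>x. \<psi>' \<bar>x - z\<bar>)"
    by (auto simp: observable_def \<psi>'_def fun_eq_iff)
  have [measurable]: "obs_process \<psi> z i \<in> borel_measurable borel" for i
    unfolding obs_process_def obs by measurable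
  have eq: "max_event \<psi> r z =
      {x \<in> {0..1}. \<forall>\<^sub>F n in sequentially. \<exists>i\<in>{1..n}. \<psi> (r n) \<le> obs_process \<psi> z i x}"
    unfolding max_event_def obs_max_def
    by (intro Collect_cong conj_cong refl eventually_subst eventually_mono[OF eventually_ge_at_top[of 1]])
       (subst Max_ge_iff, auto)
  have "max_event \<psi> r z \<in> sets borel"
    unfolding eq eventually_sequentially by measurable
  moreover have "max_event \<psi> r z \<subseteq> {0..1}"
    unfolding max_event_def by auto
  ultimately show ?thesis
    by (auto simp: sets_gauss_measure sets_restrict_space_iff)
qed

end

theory Submission
  imports "HOL-Probability.Probability" "HOL-Real_Asymp.Real_Asymp" Defs
begin

text \<open>
  Let \<open>U\<close> be the transfer operator of the Gauss map with respect to its invariant measure. It at least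
  halves the total variation of every function (Iosifescu), so correlations of functions of bounded
  variation decay like \<open>2 ^ (- n)\<close>. Killing the orbit when it enters a ball \<open>B\<close> means alternating \<open>U\<close> with
  multiplication by the indicator of the complement of \<open>B\<close>. The halving keeps the variation of the
  killed density comparable to its mass, so that every step loses the fraction \<open>\<mu>(B) (1 + O(\<eta>))\<close> of
  the mass, where \<open>\<eta>\<close> collects \<open>2 ^ (- g)\<close>, \<open>g \<mu>(B)\<close> and the proportion of \<open>B\<close> returning to \<open>B\<close> within
  \<open>g\<close> steps. Hence the probability of missing \<open>B\<close> up to time \<open>n\<close> is \<open>exp (- n \<mu>(B))\<close> up to constant
  factors as long as \<open>n \<mu>(B) \<eta>\<close> stays bounded.

  Only \<open>n \<mu>(B)\<close> of order \<open>ln ln n\<close> matters for the dichotomy: larger values contribute a convergent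
  series, smaller ones a divergent one. So \<open>g\<close> of order \<open>ln ln ln n\<close> suffices, and for almost every
  centre the returns within \<open>g\<close> steps are negligible by a first moment bound. With times
  subdivided as in the independent case (each block \<open>[2 ^ k, 2 ^ (k + 1))\<close> into about \<open>ln k\<close> pieces)
  the convergent case is a Borel-Cantelli argument, and the divergent case is a second moment
  bound together with ergodicity.
\<close>

section \<open>The transfer operator and its duality\<close>

text \<open>Both halves of the dichotomy tolerate constant factors in the probabilities, and this
  fixes the scales. In the block \<open>[2 ^ k, 2 ^ (k + 1))\<close> a value \<open>2 * ln k\<close>
  of \<open>n * \<mu>(B)\<close> has survival probability of order \<open>1 / k\<^sup>2\<close>,
  summable even after multiplication by the number of pieces. Up to that order the exponent must be
  known within O(1), so the relative error \<eta> of the hazard may be a constant over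
  \<open>ln k\<close>, which \<open>2 ^ g \<ge> ln k\<close> achieves. Over one of about
  \<open>ln k\<close> pieces the exponent for a fixed ball changes by O(1), so one event per piece
  is enough.

  The two survival estimates are not mirror images. The density is understood through the mass
  \<open>g\<close> steps earlier, which exceeds the present mass. This favours the upper bound on
  survival, whose difficulty is the short returns; for the lower bound the excess itself has to be
  estimated.

  Return masses increase with the radius, so one radius per block serves all balls used there, and
  the exceptional null set of centres depends neither on the sequence of radii nor on
  \<psi>.\<close>

definition branch :: "nat \<Rightarrow> real \<Rightarrow> real" where
  "branch i x = 1 / (x + 1 + real i)"

text \<open>The Jacobian of the branch times the invariant density at \<open>branch i x\<close>
  divided by that at \<open>x\<close>; the normalisation \<open>ln 2\<close> cancels. The index
  \<open>i\<close> stands for the continued fraction digit \<open>i + 1\<close>.\<close>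

definition weight :: "nat \<Rightarrow> real \<Rightarrow> real" where
  "weight i x = (1 + x) / ((x + 1 + real i) * (x + 2 + real i))"

abbreviation gauss_space :: "real measure" (\<open>\<M>\<close>) where
  "\<M> \<equiv> gauss_measure"

lemma branch_measurable [measurable]: "branch i \<in> borel_measurable borel"
  unfolding branch_def by measurable

lemma weight_measurable [measurable]: "weight i \<in> borel_measurable borel"
  unfolding weight_def by measurable

lemma branch_in: "x \<in> {0..1} \<Longrightarrow> branch i x \<in> {0..1}"
  by (auto simp: branch_def field_simps)

lemma weight_nonneg: "x \<in> {0..1} \<Longrightarrow> 0 \<le> weight i x"
  by (auto simp: weight_def)

lemma gauss_map_in: "gauss_map x \<in> {0..1}"
  by (auto simp: gauss_map_def frac_lt_1 less_imp_le)

text \<open>At \<open>y = 1\<close> the left side would be 0, so later uses first discard that point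
  as a null set.\<close>

lemma gauss_map_branch:
  assumes "y \<in> {0..<1}" shows "gauss_map (branch i y) = y"
proof -
  have "1 / branch i y = y + 1 + real i" "branch i y \<noteq> 0"
    using assms by (auto simp: branch_def)
  moreover have "frac (y + 1 + real i) = y"
    using assms by (subst frac_unique_iff) (auto simp: add.assoc)
  ultimately show ?thesis by (simp add: gauss_map_def)
qed

lemma nn_integral_gauss:
  assumes "f \<in> borel_measurable \<M>"
  shows "(\<integral>\<^sup>+x. f x \<partial>\<M>) =
    (\<integral>\<^sup>+x. ennreal (1 / (ln 2 * (1 + x))) * f x * indicator {0..1} x \<partial>lborel)"
proof -
  have [measurable]: "f \<in> borel_measurable (restrict_space lborel {0..1})"
    using assms by (simp add: gauss_measure_def)
  have [measurable]: "(\<lambda>x. 1 / (ln 2 * (1 + x))) \<in> borel_measurable (restrict_space lborel {0..1::real})"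
    by (rule measurable_restrict_space1) measurable
  show ?thesis unfolding gauss_measure_def
    by (subst nn_integral_density) (auto simp: nn_integral_restrict_space)
qed

lemma borel_imp_gauss_measurable:
  "f \<in> measurable borel N \<Longrightarrow> f \<in> measurable \<M> N"
  by (subst measurable_cong_sets[OF sets_gauss_measure refl]) (rule measurable_restrict_space1)

lemma gauss_map_measurable_gauss [measurable]:
  "gauss_map \<in> measurable \<M> \<M>"
  by (subst measurable_cong_sets[OF refl sets_gauss_measure])
     (auto intro!: measurable_restrict_space2 borel_imp_gauss_measurable gauss_map_in)

lemma branch_measurable_gauss [measurable]:
  "branch i \<in> measurable \<M> \<M>"
  by (subst measurable_cong_sets[OF sets_gauss_measure sets_gauss_measure])
     (use branch_in in \<open>auto intro!: measurable_restrict_space3\<close>)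

lemma weight_measurable_gauss [measurable]:
  "weight i \<in> borel_measurable \<M>"
  by (intro borel_imp_gauss_measurable) measurable

lemma nn_integral_branch:
  fixes F :: "real \<Rightarrow> ennreal"
  assumes [measurable]: "F \<in> borel_measurable borel"
  shows "(\<integral>\<^sup>+x. F x * indicator {1 / (real i + 2)<..1 / (real i + 1)} x \<partial>lborel) =
    (\<integral>\<^sup>+y. F (branch i y) * ennreal (1 / (y + 1 + real i)\<^sup>2) * indicator {0..1} y \<partial>lborel)"
proof -
  \<comment> \<open>\<open>g y\<close> is \<open>branch i (1 - y)\<close>: the substitution rule
    needs an increasing map, and the reflection is undone afterwards.\<close>
  define g where "g y = 1 / (real i + 2 - y)" for y
  define g' where "g' y = 1 / (real i + 2 - y)\<^sup>2" for y
  have [measurable]: "g \<in> borel_measurable borel" "g' \<in> borel_measurable borel"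
    unfolding g_def g'_def by measurable
  have "(\<integral>\<^sup>+x. F x * indicator {1 / (real i + 2)<..1 / (real i + 1)} x \<partial>lborel)
      = (\<integral>\<^sup>+x. F x * indicator {g 0..g 1} x \<partial>lborel)"
    by (rule nn_integral_cong_AE, rule AE_mp[OF AE_lborel_singleton[of "g 0"]])
       (auto simp: indicator_def g_def algebra_simps)
  also have "\<dots> = (\<integral>\<^sup>+x. F (g x) * ennreal (g' x) * indicator {0..1} x \<partial>lborel)"
  proof (rule nn_integral_substitution_aux)
    fix x :: real assume x: "x \<in> {0..1}"
    show "(g has_real_derivative g' x) (at x)"
      unfolding g_def g'_def using x
      by (auto intro!: derivative_eq_intros simp: power2_eq_square divide_simps)
    show "0 \<le> g' x" by (simp add: g'_def)
  next
    show "continuous_on {0..1} g'" unfolding g'_def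
      by (intro continuous_intros) auto
  qed auto
  also have "\<dots> = (\<integral>\<^sup>+x. F (g (1 + (-1) * x)) * ennreal (g' (1 + (-1) * x)) * indicator {0..1} (1 + (-1) * x) \<partial>lborel)"
    by (subst nn_integral_real_affine[where t=1 and c="-1"]) auto
  also have "\<dots> = (\<integral>\<^sup>+y. F (branch i y) * ennreal (1 / (y + 1 + real i)\<^sup>2) * indicator {0..1} y \<partial>lborel)"
    by (intro nn_integral_cong) (auto simp: g_def g'_def branch_def indicator_def algebra_simps)
  finally show ?thesis .
qed

lemma suminf_indicator_branch:
  fixes x :: real
  assumes "x \<in> {0<..1}"
  shows "(\<Sum>i. indicator {1 / (real i + 2)<..1 / (real i + 1)} x :: ennreal) = 1"
proof -
  define n where "n = nat (\<lfloor>1/x\<rfloor> - 1)"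
  have "1 / x \<ge> 1" using assms by auto
  then have fl: "\<lfloor>1/x\<rfloor> \<ge> 1" by linarith
  have *: "x \<in> {1 / (real i + 2)<..1 / (real i + 1)} \<longleftrightarrow> i = n" for i
  proof -
    have "x \<in> {1 / (real i + 2)<..1 / (real i + 1)} \<longleftrightarrow> real i + 1 \<le> 1/x \<and> 1/x < real i + 2"
      using assms by (auto simp: field_simps)
    also have "\<dots> \<longleftrightarrow> \<lfloor>1/x\<rfloor> = int i + 1" by (simp add: floor_eq_iff add.assoc)
    also have "\<dots> \<longleftrightarrow> i = n" using fl unfolding n_def by linarith
    finally show ?thesis .
  qed
  have "(\<Sum>i. indicator {1 / (real i + 2)<..1 / (real i + 1)} x :: ennreal)
      = (\<Sum>i\<in>{n}. indicator {1 / (real i + 2)<..1 / (real i + 1)} x)"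
    by (rule suminf_finite) (use * in \<open>auto simp: indicator_def\<close>)
  then show ?thesis using * by (simp add: indicator_def)
qed

text \<open>Split the integral along the first digit and substitute along each branch; once the
  density at \<open>y\<close> is factored out, \<open>weight\<close> remains.\<close>

lemma transfer_duality_aux:
  fixes f g :: "real \<Rightarrow> ennreal"
  assumes [measurable]: "f \<in> borel_measurable borel" "g \<in> borel_measurable borel"
  shows "(\<integral>\<^sup>+x. f x * g (gauss_map x) \<partial>\<M>) =
    (\<integral>\<^sup>+y. (\<Sum>i. ennreal (weight i y) * f (branch i y)) * g y \<partial>\<M>)"
proof -
  let ?d = "\<lambda>x::real. ennreal (1 / (ln 2 * (1 + x)))"
  define F where "F x = ?d x * (f x * g (gauss_map x))" for x
  have [measurable]: "F \<in> borel_measurable borel" unfolding F_def by measurable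
  have "(\<integral>\<^sup>+x. f x * g (gauss_map x) \<partial>\<M>) = (\<integral>\<^sup>+x. F x * indicator {0..1} x \<partial>lborel)"
    by (subst nn_integral_gauss) (auto simp: F_def intro!: borel_imp_gauss_measurable)
  also have "\<dots> = (\<integral>\<^sup>+x. (\<Sum>i. F x * indicator {1 / (real i + 2)<..1 / (real i + 1)} x) \<partial>lborel)"
  proof (rule nn_integral_cong_AE, rule AE_mp[OF AE_lborel_singleton[of 0]], intro AE_I2 impI)
    fix x :: real assume "x \<noteq> 0"
    show "F x * indicator {0..1} x = (\<Sum>i. F x * indicator {1 / (real i + 2)<..1 / (real i + 1)} x)"
    proof (cases "x \<in> {0<..1}")
      case True then show ?thesis by (simp add: suminf_indicator_branch)
    next
      case False
      have "x \<notin> {1 / (real i + 2)<..1 / (real i + 1)}" for i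
      proof
        assume a: "x \<in> {1 / (real i + 2)<..1 / (real i + 1)}"
        have "1 / (real i + 2) > 0" "1 / (real i + 1) \<le> 1" by auto
        then have "x \<in> {0<..1}" using a
          by (meson greaterThanAtMost_iff le_less_trans less_imp_le order_trans less_trans)
        then show False using False by blast
      qed
      moreover have "x \<notin> {0..1}" using False \<open>x \<noteq> 0\<close> by auto
      ultimately show ?thesis by (simp del: atLeastAtMost_iff greaterThanAtMost_iff)
    qed
  qed
  also have "\<dots> = (\<Sum>i. \<integral>\<^sup>+x. F x * indicator {1 / (real i + 2)<..1 / (real i + 1)} x \<partial>lborel)"
    by (rule nn_integral_suminf) measurable
  also have "\<dots> = (\<Sum>i. \<integral>\<^sup>+y. F (branch i y) * ennreal (1 / (y + 1 + real i)\<^sup>2) * indicator {0..1} y \<partial>lborel)"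
    by (subst nn_integral_branch) auto
  also have "\<dots> = (\<Sum>i. \<integral>\<^sup>+y. ?d y * (ennreal (weight i y) * f (branch i y) * g y) * indicator {0..1} y \<partial>lborel)"
  proof (rule suminf_cong, rule nn_integral_cong_AE, rule AE_mp[OF AE_lborel_singleton[of 1]], intro AE_I2 impI)
    fix i and y :: real assume "y \<noteq> 1"
    show "F (branch i y) * ennreal (1 / (y + 1 + real i)\<^sup>2) * indicator {0..1} y =
       ?d y * (ennreal (weight i y) * f (branch i y) * g y) * indicator {0..1} y"
    proof (cases "y \<in> {0..1}")
      case True
      then have y: "y \<in> {0..<1}" using \<open>y \<noteq> 1\<close> by auto
      have p: "0 \<le> weight i y" "0 \<le> branch i y" using weight_nonneg[OF True] branch_in[OF True] by auto
      have "1 / (ln 2 * (1 + branch i y)) * (1 / (y + 1 + real i)\<^sup>2) = 1 / (ln 2 * (1 + y)) * weight i y"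
      proof -
        define s where "s = y + 1 + real i"
        have s: "s > 0" using y by (simp add: s_def)
        have "1 / (ln 2 * (1 + 1 / s)) * (1 / s\<^sup>2) = 1 / (ln 2 * (s * (s + 1)))"
          using s by (simp add: field_simps power2_eq_square)
        also have "\<dots> = 1 / (ln 2 * (1 + y)) * ((1 + y) / (s * (s + 1)))"
          using y by (simp add: divide_simps)
        finally show ?thesis by (simp add: branch_def weight_def s_def algebra_simps)
      qed
      then have "?d (branch i y) * ennreal (1 / (y + 1 + real i)\<^sup>2) = ?d y * ennreal (weight i y)"
        using p y by (simp flip: ennreal_mult)
      then have "?d (branch i y) * ennreal (1 / (y + 1 + real i)\<^sup>2) * (f (branch i y) * g y)
          = ?d y * ennreal (weight i y) * (f (branch i y) * g y)" by simp
      then show ?thesis by (simp add: F_def gauss_map_branch[OF y] ac_simps)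
    qed auto
  qed
  also have "\<dots> = (\<integral>\<^sup>+y. (\<Sum>i. ?d y * (ennreal (weight i y) * f (branch i y) * g y) * indicator {0..1} y) \<partial>lborel)"
    by (rule nn_integral_suminf[symmetric]) measurable
  also have "\<dots> = (\<integral>\<^sup>+y. ?d y * ((\<Sum>i. ennreal (weight i y) * f (branch i y)) * g y) * indicator {0..1} y \<partial>lborel)"
    by (intro nn_integral_cong) (simp flip: ennreal_suminf_multc ennreal_suminf_cmult)
  also have "\<dots> = (\<integral>\<^sup>+y. (\<Sum>i. ennreal (weight i y) * f (branch i y)) * g y \<partial>\<M>)"
    by (subst nn_integral_gauss) (auto intro!: borel_imp_gauss_measurable)
  finally show ?thesis .
qed

lemma transfer_duality_nn:
  fixes f g :: "real \<Rightarrow> ennreal"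
  assumes f: "f \<in> borel_measurable \<M>" and g: "g \<in> borel_measurable \<M>"
  shows "(\<integral>\<^sup>+x. f x * g (gauss_map x) \<partial>\<M>) =
    (\<integral>\<^sup>+y. (\<Sum>i. ennreal (weight i y) * f (branch i y)) * g y \<partial>\<M>)"
proof -
  have b: "(\<lambda>x. h x * indicator {0..1} x) \<in> borel_measurable borel"
    if "h \<in> borel_measurable \<M>" for h :: "real \<Rightarrow> ennreal"
  proof -
    have "h \<in> borel_measurable (restrict_space borel {0..1})"
      using that by (simp cong: measurable_cong_sets add: sets_gauss_measure)
    then show ?thesis by (subst (asm) borel_measurable_restrict_space_iff_ennreal) auto
  qed
  have "(\<integral>\<^sup>+x. f x * g (gauss_map x) \<partial>\<M>) =
    (\<integral>\<^sup>+x. (f x * indicator {0..1} x) * (g (gauss_map x) * indicator {0..1} (gauss_map x)) \<partial>\<M>)"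
    by (intro nn_integral_cong) (use gauss_map_in in \<open>auto simp: indicator_def\<close>)
  also have "\<dots> = (\<integral>\<^sup>+y. (\<Sum>i. ennreal (weight i y) * (f (branch i y) * indicator {0..1} (branch i y))) * (g y * indicator {0..1} y) \<partial>\<M>)"
    by (rule transfer_duality_aux[OF b[OF f] b[OF g]])
  also have "\<dots> = (\<integral>\<^sup>+y. (\<Sum>i. ennreal (weight i y) * f (branch i y)) * g y \<partial>\<M>)"
    by (intro nn_integral_cong) (use branch_in in \<open>auto simp: indicator_def\<close>)
  finally show ?thesis .
qed

lemma emeasure_gauss_space: "emeasure \<M> {0..1} = 1"
proof -
  have "emeasure \<M> {0..1} = (\<integral>\<^sup>+x. 1 \<partial>\<M>)" by simp
  also have "\<dots> = (\<integral>\<^sup>+x. ennreal (1 / (ln 2 * (1 + x))) * indicator {0..1} x \<partial>lborel)"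
    by (subst nn_integral_gauss) auto
  also have "\<dots> = ennreal (ln (1 + 1) / ln 2 - ln (1 + 0) / ln 2)"
    by (rule nn_integral_FTC_Icc[where F="\<lambda>x. ln (1 + x) / ln 2"])
       (auto intro!: derivative_eq_intros simp: divide_simps)
  finally show ?thesis by simp
qed

interpretation gauss: prob_space \<M>
  by standard (simp add: emeasure_gauss_space)

section \<open>Contraction in bounded variation\<close>

definition transfer :: "(real \<Rightarrow> real) \<Rightarrow> real \<Rightarrow> real" where
  "transfer f x = (\<Sum>i. weight i x * f (branch i x))"

text \<open>Total variation at most \<open>V\<close> on the unit interval, expressed by a Jordan decomposition.\<close>

definition bvar :: "(real \<Rightarrow> real) \<Rightarrow> real \<Rightarrow> bool" where
  "bvar f V \<longleftrightarrow> (\<exists>a b. mono_on {0..1} a \<and> mono_on {0..1} b \<and>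
     (\<forall>x\<in>{0..1}. f x = a x - b x) \<and> (a 1 - a 0) + (b 1 - b 0) \<le> V)"

text \<open>Each weight is the difference of \<open>(1 + x) / (x + 1 + i)\<close> at consecutive
  \<open>i\<close>, so the sum telescopes.\<close>

lemma weight_sum: "x \<ge> 0 \<Longrightarrow> (\<Sum>i<n. weight i x) = 1 - (1 + x) / (x + 1 + real n)"
proof (induction n)
  case (Suc n)
  define s where "s = x + 1 + real n"
  have "s > 0" using Suc.prems by (simp add: s_def)
  then have "(1 + x) / (s * (s + 1)) = (1 + x) / s - (1 + x) / (s + 1)"
    by (simp add: divide_simps) (simp add: algebra_simps)
  then have "weight n x = (1 + x) / s - (1 + x) / (s + 1)"
    by (simp add: weight_def s_def add.assoc)
  then show ?case using Suc by (simp add: s_def add.assoc)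
qed auto

lemma weight_sums: assumes "x \<ge> 0" shows "(\<lambda>i. weight i x) sums 1"
proof -
  have "(\<lambda>n. 1 - (1 + x) / (x + 1 + real n)) \<longlonglongrightarrow> 1 - 0"
    by (intro tendsto_intros filterlim_compose[OF tendsto_divide_0[OF tendsto_const]] 
        tendsto_divide_0[OF tendsto_const] filterlim_at_top_imp_at_infinity
        filterlim_tendsto_add_at_top[OF tendsto_const] filterlim_real_sequentially)
  then show ?thesis using assms by (simp add: sums_def weight_sum)
qed

lemma weight_summable_bounded:
  assumes "x \<in> {0..1}" "\<And>i. \<bar>c i\<bar> \<le> C"
  shows "summable (\<lambda>i. weight i x * c i)"
proof (rule summable_comparison_test')
  show "summable (\<lambda>i. weight i x * C)"
    using weight_sums[of x] assms(1) by (intro summable_mult2) (auto simp: sums_iff)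
  show "norm (weight n x * c n) \<le> weight n x * C" for n
    using assms(2)[of n] weight_nonneg[OF assms(1)] by (auto simp: abs_mult intro!: mult_left_mono)
qed

lemma weight_summable:
  assumes "x \<in> {0..1}" "\<And>x. x \<in> {0..1} \<Longrightarrow> \<bar>f x\<bar> \<le> C"
  shows "summable (\<lambda>i. weight i x * f (branch i x))"
  by (rule weight_summable_bounded[OF assms(1) assms(2)[OF branch_in[OF assms(1)]]])

lemma transfer_const: "x \<in> {0..1} \<Longrightarrow> transfer (\<lambda>_. c) x = c"
  using weight_sums[of x] by (simp add: transfer_def sums_iff flip: suminf_mult2)

lemma transfer_mono:
  assumes "x \<in> {0..1}" "\<And>x. x \<in> {0..1} \<Longrightarrow> \<bar>f x\<bar> \<le> C" "\<And>x. x \<in> {0..1} \<Longrightarrow> \<bar>g x\<bar> \<le> D"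
    and "\<And>x. x \<in> {0..1} \<Longrightarrow> f x \<le> g x"
  shows "transfer f x \<le> transfer g x"
  unfolding transfer_def
  using assms(4)[OF branch_in[OF assms(1)]] weight_nonneg[OF assms(1)]
  by (intro suminf_le weight_summable[OF assms(1,2)] weight_summable[OF assms(1,3)] mult_left_mono) auto

lemma transfer_diff:
  assumes "x \<in> {0..1}" "\<And>x. x \<in> {0..1} \<Longrightarrow> \<bar>f x\<bar> \<le> C" "\<And>x. x \<in> {0..1} \<Longrightarrow> \<bar>g x\<bar> \<le> D"
  shows "transfer (\<lambda>x. f x - g x) x = transfer f x - transfer g x"
  unfolding transfer_def
  by (subst suminf_diff[OF weight_summable[OF assms(1,2)] weight_summable[OF assms(1,3)]])
     (auto simp: right_diff_distrib)

lemma transfer_cong: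
  assumes "x \<in> {0..1}" "\<And>x. x \<in> {0..1} \<Longrightarrow> f x = g x"
  shows "transfer f x = transfer g x"
  unfolding transfer_def using assms(2)[OF branch_in[OF assms(1)]] by simp

lemma transfer_nonneg:
  assumes "x \<in> {0..1}" "\<And>x. x \<in> {0..1} \<Longrightarrow> 0 \<le> f x" "\<And>x. x \<in> {0..1} \<Longrightarrow> \<bar>f x\<bar> \<le> C"
  shows "0 \<le> transfer f x"
  using transfer_mono[OF assms(1), of "\<lambda>_. 0" 0 f C] assms transfer_const[OF assms(1), of 0] by auto

lemma mono_on_bounded:
  fixes a :: "real \<Rightarrow> real"
  assumes "mono_on {0..1} a" "x \<in> {0..1}"
  shows "a 0 \<le> a x" "a x \<le> a 1" "\<bar>a x\<bar> \<le> \<bar>a 0\<bar> + \<bar>a 1\<bar>"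
proof -
  show 1: "a 0 \<le> a x" and 2: "a x \<le> a 1"
    using assms by (auto intro!: mono_onD[OF assms(1)])
  then show "\<bar>a x\<bar> \<le> \<bar>a 0\<bar> + \<bar>a 1\<bar>" by linarith
qed

text \<open>The weights of the branches with index at least \<open>n\<close> add up to \<open>(1 + x) / (x + 1 + n)\<close>, which
  increases with \<open>x\<close>: the random branch is stochastically monotone.\<close>

lemma transfer_antimono:
  assumes f: "mono_on {0..1} f"
  shows "antimono_on {0..1} (transfer f)"
proof (rule monotone_onI)
  fix x y :: real assume xy: "x \<in> {0..1}" "y \<in> {0..1}" "x \<le> y"
  note bd = mono_on_bounded[OF f]
  \<comment> \<open>The passage from \<open>transfer f y\<close> up to \<open>transfer f x\<close>
    has two moves: the points \<open>branch i y\<close> are replaced by the larger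
    \<open>branch i x\<close>, then the weights at \<open>y\<close> by those at \<open>x\<close>.
    Subtracting \<open>f 0\<close> makes \<open>c\<close> nonnegative and decreasing, as summation
    by parts requires in the second move.\<close>
  define c where "c i = f (branch i x) - f 0" for i
  have c0: "c i \<ge> 0" for i using bd(1)[OF branch_in[OF xy(1)]] by (simp add: c_def)
  have cdec: "c (Suc i) \<le> c i" for i
    unfolding c_def using xy(1)
    by (intro diff_right_mono mono_onD[OF f] branch_in) (auto simp: branch_def frac_le)
  define W where "W n = (\<Sum>i<n. weight i x - weight i y)" for n
  have W0: "W n \<ge> 0" for n
  proof -
    have "(1 + x) / (x + 1 + real n) \<le> (1 + y) / (y + 1 + real n)"
      using xy by (simp add: divide_simps) (simp add: algebra_simps mult_right_mono)
    then show ?thesis using xy by (simp add: W_def sum_subtractf weight_sum)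
  qed
  have part: "W n * c n \<le> (\<Sum>i<n. (weight i x - weight i y) * c i)" for n
  proof (induction n)
    case (Suc n)
    have "W (Suc n) * c (Suc n) \<le> W (Suc n) * c n" using W0 cdec by (intro mult_left_mono)
    also have "\<dots> = W n * c n + (weight n x - weight n y) * c n"
      by (simp add: W_def algebra_simps)
    finally show ?case using Suc by simp
  qed (simp add: W_def)
  have bf: "\<And>x. x \<in> {0..1} \<Longrightarrow> \<bar>f x - f 0\<bar> \<le> \<bar>f 0\<bar> + \<bar>f 1\<bar> + \<bar>f 0\<bar>"
    using bd(3) by fastforce
  have "\<bar>c i\<bar> \<le> \<bar>f 0\<bar> + \<bar>f 1\<bar> + \<bar>f 0\<bar>" for i
    unfolding c_def by (rule bf[OF branch_in[OF xy(1)]])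
  then have sx: "summable (\<lambda>i. weight i x * c i)" and sy: "summable (\<lambda>i. weight i y * c i)"
    using xy by (blast intro: weight_summable_bounded)+
  have "0 \<le> (\<Sum>i. (weight i x - weight i y) * c i)"
  proof (rule LIMSEQ_le_const)
    show "(\<lambda>n. \<Sum>i<n. (weight i x - weight i y) * c i) \<longlonglongrightarrow> (\<Sum>i. (weight i x - weight i y) * c i)"
      using summable_diff[OF sx sy] by (intro summable_LIMSEQ) (simp add: left_diff_distrib)
    show "\<exists>N. \<forall>n\<ge>N. 0 \<le> (\<Sum>i<n. (weight i x - weight i y) * c i)"
      using part W0 c0 by (meson mult_nonneg_nonneg order_trans)
  qed
  also have "\<dots> = (\<Sum>i. weight i x * c i) - (\<Sum>i. weight i y * c i)"
    using suminf_diff[OF sx sy] by (simp add: left_diff_distrib)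
  also have "(\<Sum>i. weight i x * c i) = transfer (\<lambda>x. f x - f 0) x"
    by (simp add: transfer_def c_def)
  also have "\<dots> = transfer f x - f 0"
    using transfer_diff[where f=f and g="\<lambda>_. f 0" and D="\<bar>f 0\<bar>", OF xy(1) bd(3)] transfer_const[OF xy(1)] by auto
  finally have 1: "(\<Sum>i. weight i y * c i) \<le> transfer f x - f 0" by simp
  have "transfer f y - f 0 = transfer (\<lambda>x. f x - f 0) y"
    using transfer_diff[where f=f and g="\<lambda>_. f 0" and D="\<bar>f 0\<bar>", OF xy(2) bd(3)] transfer_const[OF xy(2)] by auto
  also have "\<dots> = (\<Sum>i. weight i y * (f (branch i y) - f 0))" by (simp add: transfer_def)
  also have "\<dots> \<le> (\<Sum>i. weight i y * c i)"
  proof (intro suminf_le sy mult_left_mono weight_nonneg xy(2))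
    show "summable (\<lambda>i. weight i y * (f (branch i y) - f 0))"
      using weight_summable[OF xy(2), of "\<lambda>x. f x - f 0", OF bf] by simp
    show "f (branch i y) - f 0 \<le> c i" for i
      unfolding c_def using xy
      by (intro diff_right_mono mono_onD[OF f] branch_in) (auto simp: branch_def frac_le)
  qed
  finally show "transfer f x \<ge> transfer f y" using 1 by simp
qed

text \<open>Since \<open>branch i 1 = branch (Suc i) 0\<close> and
  \<open>weight i 1 = 2 * weight (Suc i) 0\<close>, the series at 1 is twice the series at 0 without
  its first term \<open>f 1 / 2\<close>. Hence the difference of the values at 0 and 1 is
  \<open>(f 1 - transfer f 1) / 2\<close>, and an average of \<open>f\<close> is at least
  \<open>f 0\<close>.\<close>

lemma transfer_halves:
  assumes f: "mono_on {0..1} f"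
  shows "transfer f 0 - transfer f 1 \<le> (f 1 - f 0) / 2"
proof -
  note bd = mono_on_bounded[OF f]
  have s: "summable (\<lambda>i. weight i 0 * f (branch i 0))"
    by (rule weight_summable[OF _ bd(3)]) auto
  have "transfer f 1 = (\<Sum>i. 2 * (weight (Suc i) 0 * f (branch (Suc i) 0)))"
    unfolding transfer_def by (rule suminf_cong) (simp add: weight_def branch_def add.commute)
  also have "\<dots> = 2 * (transfer f 0 - weight 0 0 * f (branch 0 0))"
    using summable_Suc_iff[of "\<lambda>i. weight i 0 * f (branch i 0)"] suminf_split_head[OF s] s
    by (subst suminf_mult) (auto simp: transfer_def)
  finally have 1: "transfer f 1 = 2 * transfer f 0 - f 1"
    by (simp add: weight_def branch_def)
  have "transfer (\<lambda>_. f 0) 1 \<le> transfer f 1"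
    by (rule transfer_mono[OF _ _ bd(3)]) (use bd(1) in auto)
  then show ?thesis using 1 transfer_const[of 1 "f 0"] by auto
qed

lemma bvar_diff_le:
  assumes "bvar f V" "x \<in> {0..1}" "y \<in> {0..1}" shows "\<bar>f x - f y\<bar> \<le> V"
proof -
  obtain a b where ab: "mono_on {0..1} a" "mono_on {0..1} b" "\<forall>x\<in>{0..1}. f x = a x - b x"
    "(a 1 - a 0) + (b 1 - b 0) \<le> V" using assms(1) unfolding bvar_def by blast
  show ?thesis using mono_on_bounded[OF ab(1) assms(2)] mono_on_bounded[OF ab(2) assms(2)]
     mono_on_bounded[OF ab(1) assms(3)] mono_on_bounded[OF ab(2) assms(3)]
     ab(3)[rule_format, OF assms(2)] ab(3)[rule_format, OF assms(3)] ab(4) by linarith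
qed

lemma bvar_bounded:
  assumes "bvar f V" "x \<in> {0..1}" shows "\<bar>f x\<bar> \<le> \<bar>f 0\<bar> + V"
  using bvar_diff_le[OF assms, of 0] by auto

lemma bvar_measurable:
  assumes "bvar f V" shows "f \<in> borel_measurable \<M>"
proof -
  obtain a b where ab: "mono_on {0..1} a" "mono_on {0..1} b" "\<forall>x\<in>{0..1}. f x = a x - b x"
    using assms(1) unfolding bvar_def by blast
  note m = borel_measurable_mono_on_fnc[OF ab(1)] borel_measurable_mono_on_fnc[OF ab(2)]
  have "(\<lambda>x. a x - b x) \<in> borel_measurable \<M>"
    using m by (subst measurable_cong_sets[OF sets_gauss_measure refl]) measurable
  then show ?thesis using ab(3) by (subst measurable_cong) auto
qed

lemma bvar_mono: "bvar f V \<Longrightarrow> V \<le> W \<Longrightarrow> bvar f W"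
  unfolding bvar_def by (meson order_trans)

lemma bvar_const: "bvar (\<lambda>_. c) 0"
  unfolding bvar_def by (rule exI[of _ "\<lambda>_. c"], rule exI[of _ "\<lambda>_. 0"]) (auto simp: mono_on_def)

text \<open>\<open>transfer\<close> reverses monotonicity, so the images of the two Jordan parts
  change sign and exchange roles.\<close>

lemma bvar_transfer:
  assumes "bvar f V" shows "bvar (transfer f) (V / 2)"
proof -
  obtain a b where ab: "mono_on {0..1} a" "mono_on {0..1} b" "\<forall>x\<in>{0..1}. f x = a x - b x"
    "(a 1 - a 0) + (b 1 - b 0) \<le> V" using assms(1) unfolding bvar_def by blast
  have "transfer f x = - transfer b x - (- transfer a x)" if "x \<in> {0..1}" for x
    using transfer_diff[OF that mono_on_bounded(3)[OF ab(1)] mono_on_bounded(3)[OF ab(2)]]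
      transfer_cong[OF that, of f "\<lambda>x. a x - b x"] ab(3) by auto
  moreover have "mono_on {0..1} (\<lambda>x. - transfer b x)" "mono_on {0..1} (\<lambda>x. - transfer a x)"
    using transfer_antimono[OF ab(1)] transfer_antimono[OF ab(2)]
    by (auto simp: monotone_on_def)
  ultimately show ?thesis
    using transfer_halves[OF ab(1)] transfer_halves[OF ab(2)] ab(4)
    unfolding bvar_def by (intro exI[of _ "\<lambda>x. - transfer b x"] exI[of _ "\<lambda>x. - transfer a x"]) auto
qed

definition off_ball :: "real \<Rightarrow> real \<Rightarrow> (real \<Rightarrow> real) \<Rightarrow> real \<Rightarrow> real" where
  "off_ball z r f x = (if \<bar>z - x\<bar> < r then 0 else f x)"

text \<open>The two jumps at the boundary of the ball cost at most \<open>2 * S\<close>; deleting the variation of \<open>f\<close>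
  inside the ball rather than splitting \<open>f\<close> into two pieces keeps the factor of \<open>V\<close> equal to 1.\<close>

lemma bvar_off_ball:
  assumes f: "bvar f V" and nn: "\<And>x. x \<in> {0..1} \<Longrightarrow> 0 \<le> f x" and S: "\<And>x. x \<in> {0..1} \<Longrightarrow> f x \<le> S"
  shows "bvar (off_ball z r f) (V + 2 * S)"
proof -
  obtain a b where ab: "mono_on {0..1} a" "mono_on {0..1} b" "\<forall>x\<in>{0..1}. f x = a x - b x"
    "(a 1 - a 0) + (b 1 - b 0) \<le> V" using assms(1) unfolding bvar_def by blast
  \<comment> \<open>The endpoints of the ball, clamped to the unit interval.\<close>
  define l where "l = max 0 (min 1 (z - r))"
  define q where "q = max 0 (min 1 (z + r))"
  have lq: "l \<in> {0..1}" "q \<in> {0..1}" by (auto simp: l_def q_def)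
  \<comment> \<open>Both parts are frozen at \<open>a l\<close> inside the ball, so their difference
    vanishes there. The downward jump \<open>f l\<close> on the left is an upward jump of
    \<open>B\<close>, the upward jump \<open>f q\<close> on the right one of \<open>A\<close>; both
    have the right sign because \<open>f\<close> is nonnegative.\<close>
  define A where "A x = (if x \<le> z - r then a x else if x < z + r then a l else a l + f q + (a x - a q))" for x
  define B where "B x = (if x \<le> z - r then b x else if x < z + r then a l else a l + (b x - b q))" for x
  have S0: "S \<ge> 0" using nn[of 0] S[of 0] by auto
  show ?thesis
  proof (cases "r > 0")
    case False
    then have "off_ball z r f = f" by (auto simp: off_ball_def)
    then show ?thesis using f S0 bvar_mono[OF f, of "V + 2 * S"] by auto
  next
    case True
    note ma = mono_onD[OF ab(1)] and mb = mono_onD[OF ab(2)]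
    have fl: "b l \<le> a l" "b q \<le> a q" "f q \<ge> 0" "f q \<le> S" "a l - b l \<le> S"
    proof -
      have "f l = a l - b l" "f q = a q - b q" using ab(3) lq by auto
      moreover have "f l \<ge> 0" "f q \<ge> 0" "f l \<le> S" "f q \<le> S" using nn lq S by auto
      ultimately show "b l \<le> a l" "b q \<le> a q" "f q \<ge> 0" "f q \<le> S" "a l - b l \<le> S" by linarith+
    qed
    have monoA: "mono_on {0..1} A"
    proof (rule mono_onI)
      fix x y :: real assume xy: "x \<in> {0..1}" "y \<in> {0..1}" "x \<le> y"
      have 1: "a x \<le> a l" if "x \<le> z - r" using that xy by (intro ma) (auto simp: l_def)
      have 2: "a q \<le> a y" if "z + r \<le> y" using that xy by (intro ma) (auto simp: q_def)
      show "A x \<le> A y" using 1 2 ma[of x y] xy fl True unfolding A_def by auto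
    qed
    have monoB: "mono_on {0..1} B"
    proof (rule mono_onI)
      fix x y :: real assume xy: "x \<in> {0..1}" "y \<in> {0..1}" "x \<le> y"
      have 1: "b x \<le> a l" if "x \<le> z - r" 
      proof -
        have "b x \<le> b l" using that xy by (intro mb) (auto simp: l_def)
        then show ?thesis using fl by simp
      qed
      have 2: "b q \<le> b y" if "z + r \<le> y" using that xy by (intro mb) (auto simp: q_def)
      show "B x \<le> B y" using 1 2 mb[of x y] xy fl True unfolding B_def by auto
    qed
    have eq: "\<forall>x\<in>{0..1}. off_ball z r f x = A x - B x"
    proof
      fix x :: real assume x: "x \<in> {0..1}"
      show "off_ball z r f x = A x - B x"
        using ab(3) x lq True unfolding off_ball_def A_def B_def
        by (cases "x \<le> z - r"; cases "x < z + r") (auto simp: abs_if)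
    qed
    have l0: "z - r \<ge> 0 \<Longrightarrow> z - r \<le> 1 \<Longrightarrow> l = z - r" "z - r \<ge> 1 \<Longrightarrow> l = 1" "z - r \<le> 0 \<Longrightarrow> l = 0"
      and q0: "z + r \<ge> 0 \<Longrightarrow> z + r \<le> 1 \<Longrightarrow> q = z + r" "z + r \<ge> 1 \<Longrightarrow> q = 1" "z + r \<le> 0 \<Longrightarrow> q = 0"
      by (auto simp: l_def q_def)
    have lq2: "l \<le> q" using True by (auto simp: l_def q_def)
    have inc: "a 0 \<le> a l" "a l \<le> a q" "a q \<le> a 1" "b 0 \<le> b l" "b l \<le> b q" "b q \<le> b 1"
      using lq lq2 by (auto intro!: ma mb)
    have "(A 1 - A 0) + (B 1 - B 0) \<le> V + 2 * S"
      using inc fl ab(4) l0 q0 lq True S0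
      unfolding A_def B_def by (auto split: if_splits)
    then show ?thesis unfolding bvar_def using monoA monoB eq by blast
  qed
qed

section \<open>Integral duality and convergence of iterates to the mean\<close>

lemma transfer_measurable:
  assumes [measurable]: "f \<in> borel_measurable \<M>"
  shows "transfer f \<in> borel_measurable \<M>"
  unfolding transfer_def by measurable

lemma bounded_integrable:
  fixes f :: "real \<Rightarrow> real"
  assumes "f \<in> borel_measurable \<M>" "\<And>x. x \<in> {0..1} \<Longrightarrow> \<bar>f x\<bar> \<le> C"
  shows "integrable \<M> f"
  by (rule gauss.integrable_const_bound[where B=C]) (use assms in auto)

lemma transfer_duality:
  fixes f g :: "real \<Rightarrow> real"
  assumes [measurable]: "f \<in> borel_measurable \<M>" "g \<in> borel_measurable \<M>"
    and f: "\<And>x. x \<in> {0..1} \<Longrightarrow> 0 \<le> f x" "\<And>x. x \<in> {0..1} \<Longrightarrow> f x \<le> C"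
    and g: "\<And>x. x \<in> {0..1} \<Longrightarrow> 0 \<le> g x"
  shows "integral\<^sup>L \<M> (\<lambda>x. f x * g (gauss_map x)) =
    integral\<^sup>L \<M> (\<lambda>x. transfer f x * g x)"
proof -
  note [measurable] = transfer_measurable
  have f': "\<bar>f x\<bar> \<le> C" if "x \<in> {0..1}" for x using f[OF that] by auto
  have nn: "0 \<le> transfer f x" if "x \<in> {0..1}" for x using transfer_nonneg[OF that f(1) f'] .
  have "integral\<^sup>L \<M> (\<lambda>x. f x * g (gauss_map x)) =
     enn2real (\<integral>\<^sup>+x. ennreal (f x * g (gauss_map x)) \<partial>\<M>)"
    by (rule integral_eq_nn_integral) (use f g gauss_map_in in \<open>auto intro!: AE_I2\<close>)
  also have "\<dots> = enn2real (\<integral>\<^sup>+x. ennreal (f x) * ennreal (g (gauss_map x)) \<partial>\<M>)"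
    by (intro arg_cong[where f=enn2real] nn_integral_cong) (use f in \<open>simp add: ennreal_mult'\<close>)
  also have "\<dots> = enn2real (\<integral>\<^sup>+y. (\<Sum>i. ennreal (weight i y) * ennreal (f (branch i y))) * ennreal (g y) \<partial>\<M>)"
    by (subst transfer_duality_nn) auto
  also have "\<dots> = enn2real (\<integral>\<^sup>+y. ennreal (transfer f y * g y) \<partial>\<M>)"
  proof (intro arg_cong[where f=enn2real] nn_integral_cong)
    fix y assume "y \<in> space \<M>"
    then have y: "y \<in> {0..1}" by simp
    have "(\<Sum>i. ennreal (weight i y) * ennreal (f (branch i y))) = (\<Sum>i. ennreal (weight i y * f (branch i y)))"
      using weight_nonneg[OF y] by (simp add: ennreal_mult')
    also have "\<dots> = ennreal (transfer f y)" unfolding transfer_def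
      using weight_nonneg[OF y] f(1)[OF branch_in[OF y]]
      by (intro suminf_ennreal2 weight_summable[OF y f']) auto
    finally show "(\<Sum>i. ennreal (weight i y) * ennreal (f (branch i y))) * ennreal (g y) = ennreal (transfer f y * g y)"
      using nn[OF y] by (simp add: ennreal_mult')
  qed
  also have "\<dots> = integral\<^sup>L \<M> (\<lambda>x. transfer f x * g x)"
    by (subst integral_eq_nn_integral) (use nn g in auto)
  finally show ?thesis .
qed

lemma bvar_mean:
  assumes "bvar f V" "x \<in> {0..1}"
  shows "\<bar>f x - integral\<^sup>L \<M> f\<bar> \<le> V"
proof -
  have i: "integrable \<M> f"
    by (rule bounded_integrable[OF bvar_measurable[OF assms(1)] bvar_bounded[OF assms(1)]])
  have 1: "f x - V \<le> f y" "f y \<le> f x + V" if "y \<in> {0..1}" for y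
    using bvar_diff_le[OF assms(1,2) that] by auto
  have "integral\<^sup>L \<M> (\<lambda>_. f x - V) \<le> integral\<^sup>L \<M> f"
    by (rule integral_mono) (use i 1 in auto)
  moreover have "integral\<^sup>L \<M> f \<le> integral\<^sup>L \<M> (\<lambda>_. f x + V)"
    by (rule integral_mono) (use i 1 in auto)
  ultimately show ?thesis by (simp add: gauss.prob_space[simplified])
qed

lemma transfer_pow:
  assumes "bvar f V" "\<And>x. x \<in> {0..1} \<Longrightarrow> 0 \<le> f x"
  shows "bvar ((transfer ^^ n) f) (V / 2 ^ n) \<and> (\<forall>x\<in>{0..1}. 0 \<le> (transfer ^^ n) f x) \<and>
    integral\<^sup>L \<M> ((transfer ^^ n) f) = integral\<^sup>L \<M> f"
proof (induction n)
  case (Suc n)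
  let ?h = "(transfer ^^ n) f"
  note b = bvar_bounded[of ?h "V / 2^n"]
  have "integral\<^sup>L \<M> (\<lambda>x. ?h x * 1) = integral\<^sup>L \<M> (\<lambda>x. transfer ?h x * 1)"
    by (rule transfer_duality[where C="\<bar>?h 0\<bar> + V / 2 ^ n"])
       (use Suc b in \<open>auto intro: bvar_measurable simp: abs_le_iff\<close>)
  moreover have "\<forall>x\<in>{0..1}. 0 \<le> transfer ?h x"
    using Suc b by (intro ballI transfer_nonneg[where C="\<bar>?h 0\<bar> + V / 2 ^ n"]) auto
  moreover have "bvar (transfer ?h) (V / 2 ^ Suc n)"
    using bvar_transfer[of ?h "V / 2^n"] Suc by (simp add: mult.commute)
  ultimately show ?case using Suc by simp
qed (use assms in auto)

text \<open>Iterates keep the integral, and a function differs from its mean by at most its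
  variation.\<close>

lemma transfer_pow_close:
  assumes "bvar f V" "\<And>x. x \<in> {0..1} \<Longrightarrow> 0 \<le> f x" "x \<in> {0..1}"
  shows "\<bar>(transfer ^^ n) f x - integral\<^sup>L \<M> f\<bar> \<le> V / 2 ^ n"
  using transfer_pow[OF assms(1,2), of n] bvar_mean[of "(transfer ^^ n) f" "V / 2 ^ n" x] assms(3) by auto

section \<open>The process killed on hitting a ball\<close>

text \<open>The density, with respect to the invariant measure, of the position at time
  \<open>k\<close> on the event that the orbit avoided the ball of radius \<open>\<rho> t\<close> at
  every time \<open>t < k\<close>. The radius may depend on time so that two different balls can be
  avoided in succession.\<close>

primrec killed :: "real \<Rightarrow> (nat \<Rightarrow> real) \<Rightarrow> nat \<Rightarrow> real \<Rightarrow> real" where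
  "killed z \<rho> 0 = (\<lambda>_. 1)"
| "killed z \<rho> (Suc k) = transfer (off_ball z (\<rho> k) (killed z \<rho> k))"

definition surv :: "real \<Rightarrow> (nat \<Rightarrow> real) \<Rightarrow> nat \<Rightarrow> real" where
  "surv z \<rho> k = integral\<^sup>L \<M> (killed z \<rho> k)"

text \<open>The indicator of avoiding the balls during \<open>g\<close> steps when the clock starts
  at time \<open>m\<close>; as a product it gains one factor per application of duality.\<close>

definition avoid :: "real \<Rightarrow> (nat \<Rightarrow> real) \<Rightarrow> nat \<Rightarrow> nat \<Rightarrow> real \<Rightarrow> real" where
  "avoid z \<rho> m g x = (\<Prod>t<g. 1 - indicator (unit_ball z (\<rho> (m + t))) ((gauss_map ^^ t) x))"

definition return_mass :: "real \<Rightarrow> real \<Rightarrow> nat \<Rightarrow> real" where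
  "return_mass z r t = gauss.prob {x \<in> unit_ball z r. (gauss_map ^^ t) x \<in> unit_ball z r}"

abbreviation ball_mass :: "real \<Rightarrow> real \<Rightarrow> real" where
  "ball_mass z r \<equiv> gauss.prob (unit_ball z r)"

abbreviation ball_integral :: "real \<Rightarrow> real \<Rightarrow> (real \<Rightarrow> real) \<Rightarrow> real" where
  "ball_integral z r f \<equiv> LINT x|\<M>. f x * indicator (unit_ball z r) x"

lemma sets_gauss_iff: "A \<in> sets \<M> \<longleftrightarrow> A \<in> sets borel \<and> A \<subseteq> {0..1}"
  by (auto simp: sets_gauss_measure sets_restrict_space_iff)

lemma unit_ball_sets_gauss [measurable]: "unit_ball z r \<in> sets \<M>"
  by (auto simp: sets_gauss_iff unit_ball_def)

lemma funpow_measurable_gauss [measurable]: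
  "(gauss_map ^^ t) \<in> measurable \<M> \<M>"
proof (induction t)
  case (Suc t) then show ?case
    by (simp only: funpow.simps) (intro measurable_comp[OF _ gauss_map_measurable_gauss])
qed (simp add: measurable_ident[unfolded id_def])

lemma gauss_funpow_in: "x \<in> {0..1} \<Longrightarrow> (gauss_map ^^ t) x \<in> {0..1}"
  by (induction t) (use gauss_map_in in auto)

lemma expectation_indicator:
  assumes "A \<in> sets \<M>"
  shows "(LINT x|\<M>. indicator A x) = gauss.prob A"
proof -
  have "A \<inter> {0..1} = A" using sets.sets_into_space[OF assms] by auto
  then show ?thesis by simp
qed

lemma off_ball_eq: "x \<in> {0..1} \<Longrightarrow> off_ball z r f x = f x * (1 - indicator (unit_ball z r) x)"
  by (auto simp: off_ball_def unit_ball_def indicator_def)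

lemma off_ball_measurable:
  assumes [measurable]: "f \<in> borel_measurable \<M>"
  shows "off_ball z r f \<in> borel_measurable \<M>"
proof -
  have "(\<lambda>x. f x * (1 - indicator (unit_ball z r) x)) \<in> borel_measurable \<M>"
    by measurable
  then show ?thesis by (subst measurable_cong[OF off_ball_eq]) auto
qed

lemma killed_bounds:
  "killed z \<rho> k \<in> borel_measurable \<M> \<and> (\<forall>x\<in>{0..1}. 0 \<le> killed z \<rho> k x \<and> killed z \<rho> k x \<le> 1)"
proof (induction k)
  case (Suc k)
  let ?c = "off_ball z (\<rho> k) (killed z \<rho> k)"
  have c: "0 \<le> ?c x" "?c x \<le> 1" "\<bar>?c x\<bar> \<le> 1" if "x \<in> {0..1}" for x
    using Suc that by (auto simp: off_ball_def)
  have "0 \<le> transfer ?c x" "transfer ?c x \<le> transfer (\<lambda>_. 1) x" if "x \<in> {0..1}" for x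
    by (rule transfer_nonneg[OF that c(1,3)], assumption+)
       (rule transfer_mono[OF that c(3), where D=1], use c in auto)
  then show ?case using Suc transfer_const[of _ 1]
    by (auto intro!: transfer_measurable off_ball_measurable)
qed auto

lemmas killed_measurable [measurable] = killed_bounds[THEN conjunct1]

lemma killed_nonneg: "x \<in> {0..1} \<Longrightarrow> 0 \<le> killed z \<rho> k x"
  and killed_le_1: "x \<in> {0..1} \<Longrightarrow> killed z \<rho> k x \<le> 1"
  using killed_bounds by auto

lemma avoid_bounds: "0 \<le> avoid z \<rho> m g x" "avoid z \<rho> m g x \<le> 1"
  unfolding avoid_def by (auto intro!: prod_nonneg prod_le_1 simp: indicator_def)

lemma avoid_measurable [measurable]: "avoid z \<rho> m g \<in> borel_measurable \<M>"
  unfolding avoid_def by measurable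

text \<open>The Markov property at time \<open>m\<close>. Each use of duality exchanges one
  application of \<open>transfer\<close> for a composition of the test function with the Gauss map,
  and the killing becomes a factor of the test function.\<close>

lemma killed_duality:
  assumes [measurable]: "\<phi> \<in> borel_measurable \<M>"
    and "\<And>x. x \<in> {0..1} \<Longrightarrow> 0 \<le> \<phi> x"
  shows "(LINT x|\<M>. killed z \<rho> (m + g) x * \<phi> x) =
    (LINT x|\<M>. killed z \<rho> m x * (avoid z \<rho> m g x * \<phi> ((gauss_map ^^ g) x)))"
  using assms
proof (induction g arbitrary: \<phi>)
  case (Suc g)
  note [measurable] = Suc.prems(1)
  let ?h = "killed z \<rho> (m + g)" and ?B = "unit_ball z (\<rho> (m + g))"
  have "(LINT x|\<M>. killed z \<rho> (m + Suc g) x * \<phi> x) =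
      (LINT x|\<M>. off_ball z (\<rho> (m + g)) ?h x * \<phi> (gauss_map x))"
    by (subst transfer_duality[where C=1])
       (use Suc.prems killed_nonneg killed_le_1 in \<open>auto intro!: off_ball_measurable simp: off_ball_def\<close>)
  also have "\<dots> = (LINT x|\<M>. ?h x * ((1 - indicator ?B x) * \<phi> (gauss_map x)))"
    by (intro Bochner_Integration.integral_cong) (auto simp: off_ball_eq)
  also have "\<dots> = (LINT x|\<M>. killed z \<rho> m x * (avoid z \<rho> m g x *
      ((1 - indicator ?B ((gauss_map ^^ g) x)) * \<phi> (gauss_map ((gauss_map ^^ g) x)))))"
    by (rule Suc.IH) (use Suc.prems gauss_map_in in \<open>auto simp: indicator_def\<close>)
  finally show ?case by (simp add: avoid_def ac_simps)
qed (simp add: avoid_def)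

lemma avoid_indicator:
  "avoid z \<rho> 0 k x = indicator {x. \<forall>t<k. (gauss_map ^^ t) x \<notin> unit_ball z (\<rho> t)} x"
  unfolding avoid_def by (induction k) (auto simp: indicator_def less_Suc_eq)

lemma survival_set_sets [measurable]:
  "{x \<in> {0..1}. \<forall>t<k. (gauss_map ^^ t) x \<notin> unit_ball z (\<rho> t)} \<in> sets \<M>"
proof -
  have "{x \<in> space \<M>. \<forall>t<k. (gauss_map ^^ t) x \<notin> unit_ball z (\<rho> t)} \<in> sets \<M>"
    by measurable
  then show ?thesis by simp
qed

lemma surv_eq_measure:
  "surv z \<rho> k = gauss.prob {x \<in> {0..1}. \<forall>t<k. (gauss_map ^^ t) x \<notin> unit_ball z (\<rho> t)}"
proof -
  let ?A = "{x \<in> space \<M>. \<forall>t<k. (gauss_map ^^ t) x \<notin> unit_ball z (\<rho> t)}"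
  have "surv z \<rho> k = (LINT x|\<M>. killed z \<rho> (0 + k) x * 1)"
    by (simp add: surv_def)
  also have "\<dots> = (LINT x|\<M>. indicator ?A x)"
    by (subst killed_duality)
       (auto simp: avoid_indicator indicator_def simp del: Bochner_Integration.integral_indicator
         intro!: Bochner_Integration.integral_cong)
  also have "\<dots> = gauss.prob ?A"
    by (rule expectation_indicator) measurable
  finally show ?thesis by simp
qed

lemma killed_integrable:
  assumes [measurable]: "\<phi> \<in> borel_measurable \<M>"
    and "\<And>x. x \<in> {0..1} \<Longrightarrow> 0 \<le> \<phi> x \<and> \<phi> x \<le> 1"
  shows "integrable \<M> (\<lambda>x. killed z \<rho> k x * \<phi> x)"
  by (rule bounded_integrable[where C=1])
     (use assms killed_nonneg killed_le_1 in \<open>auto simp: abs_mult intro!: mult_le_one\<close>)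

lemma killed_integrable': "integrable \<M> (killed z \<rho> k)"
  using killed_integrable[of "\<lambda>_. 1"] by simp

lemma surv_step:
  "surv z \<rho> (Suc k) = surv z \<rho> k - ball_integral z (\<rho> k) (killed z \<rho> k)"
proof -
  have "surv z \<rho> (Suc k) = (LINT x|\<M>. killed z \<rho> (k + 1) x * 1)"
    by (simp add: surv_def)
  also have "\<dots> = (LINT x|\<M>. killed z \<rho> k x - killed z \<rho> k x * indicator (unit_ball z (\<rho> k)) x)"
    by (subst killed_duality) (auto simp: avoid_def algebra_simps)
  also have "\<dots> = surv z \<rho> k - ball_integral z (\<rho> k) (killed z \<rho> k)"
    unfolding surv_def
    by (intro Bochner_Integration.integral_diff killed_integrable killed_integrable') (auto simp: indicator_def)
  finally show ?thesis .
qed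

lemma loss_bounds:
  assumes "\<And>x. x \<in> {0..1} \<Longrightarrow> f x \<le> S" and [measurable]: "f \<in> borel_measurable \<M>"
    and "\<And>x. x \<in> {0..1} \<Longrightarrow> 0 \<le> f x"
  shows "ball_integral z r f \<le> S * ball_mass z r"
    "0 \<le> ball_integral z r f"
proof -
  have "\<bar>f x * indicator (unit_ball z r) x\<bar> \<le> \<bar>S\<bar>" if "x \<in> {0..1}" for x
    using assms(1,3)[OF that] by (cases "x \<in> unit_ball z r") auto
  then have "integrable \<M> (\<lambda>x. f x * indicator (unit_ball z r) x)"
    by (intro bounded_integrable[where C="\<bar>S\<bar>"]) auto
  moreover have "integrable \<M> (\<lambda>x. S * indicator (unit_ball z r) x)"
    by (intro bounded_integrable[where C="\<bar>S\<bar>"]) (auto simp: indicator_def)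
  ultimately have "ball_integral z r f \<le>
    (LINT x|\<M>. S * indicator (unit_ball z r) x)"
    by (rule integral_mono) (use assms(1) in \<open>auto simp: indicator_def\<close>)
  then show "ball_integral z r f \<le> S * ball_mass z r"
    by (simp add: expectation_indicator del: Bochner_Integration.integral_indicator)
  show "0 \<le> ball_integral z r f"
    by (rule integral_nonneg_AE) (use assms in auto)
qed

lemma surv_nonneg: "0 \<le> surv z \<rho> k"
  by (simp add: surv_eq_measure)

lemma surv_0: "surv z \<rho> 0 = 1"
  using gauss.prob_space by (simp add: surv_def)

lemma surv_decreasing: assumes "j \<le> k" shows "surv z \<rho> k \<le> surv z \<rho> j"
proof (rule lift_Suc_antimono_le[OF _ assms])
  fix n show "surv z \<rho> (Suc n) \<le> surv z \<rho> n"
    using surv_step[of z \<rho> n] loss_bounds(2)[OF killed_le_1 killed_measurable killed_nonneg, of z \<rho> n z "\<rho> n"]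
    by simp
qed

text \<open>\<open>transfer\<close> is positive, so omitting the last \<open>g\<close> killings can
  only enlarge the density.\<close>

lemma killed_le_transfer_pow:
  assumes "bvar (killed z \<rho> m) V" "x \<in> {0..1}"
  shows "killed z \<rho> (m + g) x \<le> (transfer ^^ g) (killed z \<rho> m) x"
  using assms(2)
proof (induction g arbitrary: x)
  case (Suc g)
  let ?h = "(transfer ^^ g) (killed z \<rho> m)"
  have b: "bvar ?h (V / 2 ^ g)" and nn: "\<And>x. x \<in> {0..1} \<Longrightarrow> 0 \<le> ?h x"
    using transfer_pow[OF assms(1) killed_nonneg] by auto
  have "transfer (off_ball z (\<rho> (m + g)) (killed z \<rho> (m + g))) x \<le> transfer ?h x"
    by (rule transfer_mono[OF Suc.prems, where C=1 and D="\<bar>?h 0\<bar> + V / 2 ^ g"])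
       (use Suc.IH killed_nonneg killed_le_1 bvar_bounded[OF b] nn in \<open>auto simp: off_ball_def\<close>)
  then show ?case by simp
qed simp

text \<open>Killing may double the supremum, which would exhaust the factor \<open>1 / 2\<close> gained from one step of
  \<open>transfer\<close>; so the supremum is controlled through the density two steps earlier.\<close>

lemma killed_regular:
  assumes small: "\<And>t. ball_mass z (\<rho> t) \<le> 1 / 100"
  shows "bvar (killed z \<rho> k) (8 * surv z \<rho> k) \<and> (\<forall>x\<in>{0..1}. killed z \<rho> k x \<le> 33 / 10 * surv z \<rho> k)"
proof -
  let ?P = "\<lambda>k. bvar (killed z \<rho> k) (8 * surv z \<rho> k)"
  let ?Q = "\<lambda>k. \<forall>x\<in>{0..1}. killed z \<rho> k x \<le> 33 / 10 * surv z \<rho> k"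
  \<comment> \<open>A density at most 3.3 times the mass loses at most the proportion
    \<open>3.3 / 100\<close> in a ball of mass at most \<open>1 / 100\<close>.\<close>
  have step: "967 / 1000 * surv z \<rho> k \<le> surv z \<rho> (Suc k)" if "?Q k" for k
  proof -
    have "ball_integral z (\<rho> k) (killed z \<rho> k) \<le> 33 / 10 * surv z \<rho> k * ball_mass z (\<rho> k)"
      using that by (intro loss_bounds(1) killed_measurable killed_nonneg) auto
    also have "\<dots> \<le> 33 / 10 * surv z \<rho> k * (1 / 100)"
      using small surv_nonneg by (intro mult_left_mono) auto
    finally show ?thesis using surv_step[of z \<rho> k] by simp
  qed
  \<comment> \<open>Two jumps of height at most 3.3 and the halving give
    \<open>(8 + 6.6) / 2 = 7.3\<close>, below \<open>8 * 0.967\<close>.\<close>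
  have P: "?P (Suc k)" if "?P k" "?Q k" for k
  proof -
    have "bvar (killed z \<rho> (Suc k)) ((8 * surv z \<rho> k + 2 * (33 / 10 * surv z \<rho> k)) / 2)"
      unfolding killed.simps using that by (intro bvar_transfer bvar_off_ball killed_nonneg) auto
    then show ?thesis using step[OF that(2)] surv_nonneg[of z \<rho> k] by (elim bvar_mono) simp
  qed
  \<comment> \<open>Two steps without killing leave \<open>1 + 8 / 4 = 3\<close> times the mass at
    time \<open>k\<close>, below \<open>3.3 * 0.967 * 0.967\<close>.\<close>
  have Q2: "?Q (Suc (Suc k))" if "?P k" "?Q k" "?Q (Suc k)" for k
  proof
    fix x :: real assume x: "x \<in> {0..1}"
    have "killed z \<rho> (k + 2) x \<le> (transfer ^^ 2) (killed z \<rho> k) x"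
      by (rule killed_le_transfer_pow[OF that(1) x])
    also have "\<dots> \<le> surv z \<rho> k + 8 * surv z \<rho> k / 2 ^ 2"
      using transfer_pow_close[OF that(1) killed_nonneg x, of 2] by (auto simp: surv_def)
    also have "\<dots> \<le> 33 / 10 * surv z \<rho> (Suc (Suc k))"
      using step[OF that(2)] step[OF that(3)] surv_nonneg[of z \<rho> k] by simp
    finally show "killed z \<rho> (Suc (Suc k)) x \<le> 33 / 10 * surv z \<rho> (Suc (Suc k))" by simp
  qed
  have "?P k \<and> ?Q k \<and> ?Q (Suc k)"
  proof (induction k)
    case 0
    have 0: "?P 0" "?Q 0" using bvar_const[of 1] by (auto simp: surv_0 elim: bvar_mono)
    moreover have "?Q (Suc 0)"
    proof
      fix x :: real assume x: "x \<in> {0..1}"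
      then show "killed z \<rho> (Suc 0) x \<le> 33 / 10 * surv z \<rho> (Suc 0)"
        using killed_le_1[OF x, of z \<rho> "Suc 0"] step[OF 0(2)] by (simp add: surv_0)
    qed
    ultimately show ?case by blast
  next
    case (Suc k)
    then show ?case using P[of k] Q2[of k] by blast
  qed
  then show ?thesis by blast
qed

lemma transfer_pow_duality:
  assumes "bvar f V" "\<And>x. x \<in> {0..1} \<Longrightarrow> 0 \<le> f x" "\<phi> \<in> borel_measurable \<M>"
    "\<And>x. x \<in> {0..1} \<Longrightarrow> 0 \<le> \<phi> x"
  shows "(LINT x|\<M>. f x * \<phi> ((gauss_map ^^ n) x)) =
    (LINT x|\<M>. (transfer ^^ n) f x * \<phi> x)"
  using assms(3,4)
proof (induction n arbitrary: \<phi>)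
  case (Suc n)
  note [measurable] = Suc.prems(1)
  let ?h = "(transfer ^^ n) f"
  have b: "bvar ?h (V / 2 ^ n)" and nn: "\<And>x. x \<in> {0..1} \<Longrightarrow> 0 \<le> ?h x"
    using transfer_pow[OF assms(1,2)] by auto
  have "(LINT x|\<M>. f x * \<phi> (gauss_map ((gauss_map ^^ n) x))) =
      (LINT x|\<M>. ?h x * \<phi> (gauss_map x))"
    by (rule Suc.IH) (use Suc.prems gauss_map_in in auto)
  also have "\<dots> = (LINT x|\<M>. transfer ?h x * \<phi> x)"
    by (rule transfer_duality[where C="\<bar>?h 0\<bar> + V / 2 ^ n"])
       (use Suc.prems bvar_measurable[OF b] bvar_bounded[OF b] nn in \<open>auto simp: abs_le_iff\<close>)
  finally show ?case by simp
qed simp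

text \<open>The constant 1 has variation 0, so all its iterates under \<open>transfer\<close> equal
  its mean 1.\<close>

lemma gauss_invariant:
  fixes \<phi> :: "real \<Rightarrow> real"
  assumes "\<phi> \<in> borel_measurable \<M>" "\<And>x. x \<in> {0..1} \<Longrightarrow> 0 \<le> \<phi> x"
  shows "(LINT x|\<M>. \<phi> ((gauss_map ^^ n) x)) = (LINT x|\<M>. \<phi> x)"
proof -
  have "(LINT x|\<M>. 1 * \<phi> ((gauss_map ^^ n) x)) =
    (LINT x|\<M>. (transfer ^^ n) (\<lambda>_. 1) x * \<phi> x)"
    using assms by (intro transfer_pow_duality[OF bvar_const]) auto
  also have "\<dots> = (LINT x|\<M>. 1 * \<phi> x)"
  proof (rule Bochner_Integration.integral_cong)
    fix x assume "x \<in> space \<M>"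
    then have "\<bar>(transfer ^^ n) (\<lambda>_. 1) x - 1\<bar> \<le> 0"
      using transfer_pow_close[OF bvar_const, of 1 x n] gauss.prob_space by simp
    then show "(transfer ^^ n) (\<lambda>_. 1) x * \<phi> x = 1 * \<phi> x" by simp
  qed simp
  finally show ?thesis by simp
qed

lemma gauss_invariant_set:
  assumes "A \<in> sets \<M>"
  shows "gauss.prob {x \<in> {0..1}. (gauss_map ^^ n) x \<in> A} = gauss.prob A"
proof -
  note [measurable] = assms
  let ?A = "{x \<in> space \<M>. (gauss_map ^^ n) x \<in> A}"
  have "gauss.prob ?A = (LINT x|\<M>. indicator ?A x)"
    by (rule expectation_indicator[symmetric]) measurable
  also have "\<dots> = (LINT x|\<M>. indicator A ((gauss_map ^^ n) x))"
    by (intro Bochner_Integration.integral_cong) (auto simp: indicator_def)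
  also have "\<dots> = gauss.prob A"
    by (subst gauss_invariant) (auto simp: expectation_indicator[OF assms] simp del: Bochner_Integration.integral_indicator)
  finally show ?thesis by simp
qed

text \<open>The union bound, in the form of the Weierstrass product inequality.\<close>

lemma avoid_ge: "1 - (\<Sum>t<g. indicator (unit_ball z (\<rho> (m + t))) ((gauss_map ^^ t) x)) \<le> avoid z \<rho> m g x"
proof (induction g)
  case (Suc g)
  have "avoid z \<rho> m (Suc g) x = avoid z \<rho> m g x * (1 - indicator (unit_ball z (\<rho> (m + g))) ((gauss_map ^^ g) x))"
    by (simp add: avoid_def)
  then show ?case using Suc avoid_bounds[of z \<rho> m g x] by (auto simp: indicator_def)
qed (simp add: avoid_def)

text \<open>Without the last \<open>g\<close> killings the density at time \<open>j + g\<close> is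
  an iterate of \<open>transfer\<close>, hence nearly constant with value
  \<open>surv z \<rho> j\<close>.\<close>

lemma loss_upper:
  assumes small: "\<And>t. ball_mass z (\<rho> t) \<le> 1 / 100"
  shows "ball_integral z r (killed z \<rho> (j + g))
     \<le> ball_mass z r * surv z \<rho> j * (1 + 8 / 2 ^ g)"
proof -
  note reg = killed_regular[of z \<rho> j, OF small, THEN conjunct1]
  have "killed z \<rho> (j + g) x \<le> surv z \<rho> j * (1 + 8 / 2 ^ g)" if x: "x \<in> {0..1}" for x
    using killed_le_transfer_pow[OF reg x, of g] transfer_pow_close[OF reg killed_nonneg x, of g]
    by (auto simp: surv_def algebra_simps)
  from loss_bounds(1)[OF this killed_measurable killed_nonneg, of z r] show ?thesis
    by (simp add: ac_simps)
qed

lemma return_set_sets [measurable]: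
  "{x \<in> unit_ball z r. (gauss_map ^^ t) x \<in> unit_ball z r} \<in> sets \<M>"
proof -
  have "{x \<in> space \<M>. x \<in> unit_ball z r \<and> (gauss_map ^^ t) x \<in> unit_ball z r} \<in> sets \<M>"
    by measurable
  also have "{x \<in> space \<M>. x \<in> unit_ball z r \<and> (gauss_map ^^ t) x \<in> unit_ball z r} =
      {x \<in> unit_ball z r. (gauss_map ^^ t) x \<in> unit_ball z r}"
    by (auto simp: unit_ball_def)
  finally show ?thesis .
qed

lemma pair_return:
  assumes "t \<le> g"
  shows "(LINT x|\<M>. indicator (unit_ball z r) ((gauss_map ^^ t) x) * indicator (unit_ball z r) ((gauss_map ^^ g) x))
    = return_mass z r (g - t)"
proof -
  let ?B = "unit_ball z r"
  let ?A = "{x \<in> ?B. (gauss_map ^^ (g - t)) x \<in> ?B}"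
  have "(gauss_map ^^ g) x = (gauss_map ^^ (g - t)) ((gauss_map ^^ t) x)" for x
    using assms by (metis comp_apply funpow_add le_add_diff_inverse2)
  then have "(LINT x|\<M>. indicator ?B ((gauss_map ^^ t) x) * indicator ?B ((gauss_map ^^ g) x)) =
     (LINT x|\<M>. indicator ?A ((gauss_map ^^ t) x) :: real)"
    by (intro Bochner_Integration.integral_cong) (auto simp: indicator_def)
  also have "\<dots> = (LINT x|\<M>. indicator ?A x)"
    by (rule gauss_invariant) auto
  finally show ?thesis unfolding return_mass_def by (simp only: expectation_indicator[OF return_set_sets])
qed

text \<open>Here the last \<open>g\<close> killings cannot be dropped. By the union bound they
  remove at most the mass that is in the ball at some time \<open>j + t\<close> and again at time
  \<open>j + g\<close>. The supremum bound on the density at time \<open>j\<close> reduces that mass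
  to \<open>return_mass\<close> at lag \<open>g - t\<close>; one radius throughout the window makes
  both visits concern the same ball.\<close>

lemma loss_lower:
  assumes small: "\<And>t. ball_mass z (\<rho> t) \<le> 1 / 100"
    and const: "\<And>t. j \<le> t \<Longrightarrow> t < j + g \<Longrightarrow> \<rho> t = r"
  shows "ball_mass z r * surv z \<rho> j * (1 - 8 / 2 ^ g) - 33 / 10 * surv z \<rho> j * (\<Sum>t=1..g. return_mass z r t)
    \<le> ball_integral z r (killed z \<rho> (j + g))"
proof -
  note reg = killed_regular[of z \<rho> j, OF small]
  note reg1 = reg[THEN conjunct1]
  let ?B = "unit_ball z r" and ?h = "killed z \<rho> j"
  let ?I = "\<lambda>t x. indicator ?B ((gauss_map ^^ t) x) :: real"
  have int1: "integrable \<M> (\<lambda>x. ?h x * ?I g x)"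
    by (rule killed_integrable) (auto simp: indicator_def)
  have int2: "integrable \<M> (\<lambda>x. ?h x * (?I t x * ?I g x))" for t
    by (rule killed_integrable) (auto simp: indicator_def)
  have int3: "integrable \<M> (\<lambda>x. ?h x * (avoid z \<rho> j g x * ?I g x))"
    using avoid_bounds by (intro killed_integrable) (auto simp: indicator_def)
  have 1: "ball_mass z r * surv z \<rho> j * (1 - 8 / 2 ^ g) \<le> (LINT x|\<M>. ?h x * ?I g x)"
  proof -
    let ?f = "(transfer ^^ g) ?h"
    have lb: "surv z \<rho> j * (1 - 8 / 2 ^ g) \<le> ?f x" if "x \<in> {0..1}" for x
      using transfer_pow_close[OF reg1 killed_nonneg that, of g] by (auto simp: surv_def algebra_simps)
    have b: "bvar ?f (8 * surv z \<rho> j / 2 ^ g)" and nn: "\<And>x. x \<in> {0..1} \<Longrightarrow> 0 \<le> ?f x"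
      using transfer_pow[OF reg1 killed_nonneg] by auto
    note [measurable] = bvar_measurable[OF b]
    have "\<bar>?f x * indicator ?B x\<bar> \<le> \<bar>?f 0\<bar> + 8 * surv z \<rho> j / 2 ^ g" if "x \<in> {0..1}" for x
      using bvar_bounded[OF b that] by (cases "x \<in> ?B") auto
    then have i: "integrable \<M> (\<lambda>x. ?f x * indicator ?B x)"
      by (intro bounded_integrable) auto
    have "(LINT x|\<M>. surv z \<rho> j * (1 - 8 / 2 ^ g) * indicator ?B x) \<le> (LINT x|\<M>. ?f x * indicator ?B x)"
      by (intro integral_mono i bounded_integrable[where C="\<bar>surv z \<rho> j * (1 - 8 / 2 ^ g)\<bar>"])
         (use lb in \<open>auto simp: indicator_def\<close>)
    also have "\<dots> = (LINT x|\<M>. ?h x * ?I g x)"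
      by (rule transfer_pow_duality[symmetric, OF reg1 killed_nonneg]) auto
    finally show ?thesis by (simp add: expectation_indicator ac_simps del: Bochner_Integration.integral_indicator)
  qed
  have 2: "(LINT x|\<M>. ?h x * (?I t x * ?I g x)) \<le> 33 / 10 * surv z \<rho> j * return_mass z r (g - t)"
    if "t < g" for t
  proof -
    have "(LINT x|\<M>. ?h x * (?I t x * ?I g x)) \<le>
      (LINT x|\<M>. 33 / 10 * surv z \<rho> j * (?I t x * ?I g x))"
      by (intro integral_mono int2 bounded_integrable[where C="33 / 10 * surv z \<rho> j"])
         (use reg in \<open>auto simp: indicator_def surv_nonneg\<close>)
    then show ?thesis using pair_return[of t g z r] that by simp
  qed
  have "(\<Sum>t<g. return_mass z r (g - t)) = (\<Sum>t=1..g. return_mass z r t)"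
    by (rule sum.reindex_bij_witness[of _ "\<lambda>t. g - t" "\<lambda>t. g - t"]) auto
  then have "ball_mass z r * surv z \<rho> j * (1 - 8 / 2 ^ g) - 33 / 10 * surv z \<rho> j * (\<Sum>t=1..g. return_mass z r t)
     = ball_mass z r * surv z \<rho> j * (1 - 8 / 2 ^ g) - (\<Sum>t<g. 33 / 10 * surv z \<rho> j * return_mass z r (g - t))"
    by (simp only: sum_distrib_left[symmetric])
  also have "\<dots> \<le> (LINT x|\<M>. ?h x * ?I g x) - (\<Sum>t<g. (LINT x|\<M>. ?h x * (?I t x * ?I g x)))"
    by (intro diff_mono 1 sum_mono 2) auto
  also have "\<dots> = (LINT x|\<M>. ?h x * ?I g x - (\<Sum>t<g. ?h x * (?I t x * ?I g x)))"
    using int1 int2 by (subst Bochner_Integration.integral_diff) auto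
  also have "\<dots> \<le> (LINT x|\<M>. ?h x * (avoid z \<rho> j g x * ?I g x))"
  proof (rule integral_mono)
    fix x assume x: "x \<in> space \<M>"
    have "(1 - (\<Sum>t<g. ?I t x)) * ?I g x \<le> avoid z \<rho> j g x * ?I g x"
      using avoid_ge[of z \<rho> j x g] const by (intro mult_right_mono) auto
    then have "?h x * ((1 - (\<Sum>t<g. ?I t x)) * ?I g x) \<le> ?h x * (avoid z \<rho> j g x * ?I g x)"
      using x killed_nonneg by (intro mult_left_mono) auto
    then show "?h x * ?I g x - (\<Sum>t<g. ?h x * (?I t x * ?I g x)) \<le> ?h x * (avoid z \<rho> j g x * ?I g x)"
      by (simp only: sum_distrib_left[symmetric] sum_distrib_right[symmetric] left_diff_distrib right_diff_distrib mult_1)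
  qed (use int1 int2 int3 in auto)
  also have "\<dots> = (LINT x|\<M>. killed z \<rho> (j + g) x * indicator ?B x)"
    by (rule killed_duality[symmetric]) auto
  finally show ?thesis .
qed

text \<open>After \<open>g\<close> steps at radius \<open>r\<close>, each further step loses at
  least the proportion \<open>\<mu> * (1 - \<eta>)\<close> of the mass. The first \<open>g\<close>
  steps give no such information and cost the factor \<open>exp (g * \<mu>)\<close>.\<close>

theorem surv_upper:
  fixes g :: nat
  assumes small: "\<And>t. ball_mass z (\<rho> t) \<le> 1 / 100"
    and const: "\<And>t. m \<le> t \<Longrightarrow> t < n \<Longrightarrow> \<rho> t = r" and mn: "m \<le> n" and mu: "0 < ball_mass z r"
  defines "\<mu> \<equiv> ball_mass z r"
  defines "\<eta> \<equiv> 8 / 2 ^ g + 33 / 10 * (\<Sum>t=1..g. return_mass z r t) / \<mu>"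
  shows "surv z \<rho> n \<le> surv z \<rho> m * exp (real g * \<mu> + real (n - m) * \<mu> * \<eta> - real (n - m) * \<mu>)"
proof -
  have \<mu>0: "\<mu> > 0" using mu by (simp add: \<mu>_def)
  have \<eta>0: "\<eta> \<ge> 0" unfolding \<eta>_def \<mu>_def return_mass_def by (intro add_nonneg_nonneg divide_nonneg_nonneg mult_nonneg_nonneg sum_nonneg) auto
  have step: "surv z \<rho> (Suc k) \<le> surv z \<rho> k * exp (- \<mu> * (1 - \<eta>))" if k: "m + g \<le> k" "k < n" for k
  proof -
    define L where "L = ball_integral z r (killed z \<rho> k)"
    have kr: "\<rho> k = r" using const k by auto
    have L0: "0 \<le> L" unfolding L_def by (rule loss_bounds(2)[OF killed_le_1 killed_measurable killed_nonneg])
    have "\<mu> * (1 - \<eta>) * surv z \<rho> k \<le> L"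
    \<comment> \<open>For \<open>\<eta> > 1\<close> the coefficient is negative and monotonicity of
      \<open>surv\<close> would point the wrong way, but then the claim only needs the loss to be
      nonnegative.\<close>
    proof (cases "\<eta> \<le> 1")
      case True
      have "\<mu> * (1 - \<eta>) * surv z \<rho> k \<le> \<mu> * (1 - \<eta>) * surv z \<rho> (k - g)"
        using True \<mu>0 by (intro mult_left_mono surv_decreasing) auto
      also have "\<dots> = \<mu> * surv z \<rho> (k - g) * (1 - 8 / 2 ^ g) - 33 / 10 * surv z \<rho> (k - g) * (\<Sum>t=1..g. return_mass z r t)"
        using \<mu>0 by (simp add: \<eta>_def field_simps)
      also have "\<dots> \<le> L"
        using loss_lower[of z \<rho> "k - g" g r, OF small] k const
        by (simp add: L_def \<mu>_def)
      finally show ?thesis .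
    next
      case False
      have "\<mu> * (1 - \<eta>) * surv z \<rho> k \<le> 0"
        using False \<mu>0 surv_nonneg by (intro mult_nonpos_nonneg mult_nonneg_nonpos) auto
      then show ?thesis using L0 by simp
    qed
    then have "surv z \<rho> (Suc k) \<le> surv z \<rho> k * (1 - \<mu> * (1 - \<eta>))"
      using surv_step[of z \<rho> k] by (simp add: L_def kr algebra_simps)
    also have "\<dots> \<le> surv z \<rho> k * exp (- \<mu> * (1 - \<eta>))"
      using exp_ge_add_one_self[of "- \<mu> * (1 - \<eta>)"] surv_nonneg by (intro mult_left_mono) auto
    finally show ?thesis .
  qed
  show ?thesis
  proof (cases "m + g \<le> n")
    case False
    have "real (n - m) * \<mu> \<le> real g * \<mu>" using False \<mu>0 by (intro mult_right_mono) auto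
    then have "1 \<le> exp (real g * \<mu> + real (n - m) * \<mu> * \<eta> - real (n - m) * \<mu>)"
      using \<mu>0 \<eta>0 by (subst one_le_exp_iff) (smt (verit) mult_nonneg_nonneg of_nat_0_le_iff)
    from mult_left_mono[OF this surv_nonneg[of z \<rho> m]] show ?thesis
      using surv_decreasing[OF mn, of z \<rho>] by linarith
  next
    case True
    have "surv z \<rho> (m + g + i) \<le> surv z \<rho> m * exp (- (real i * (\<mu> * (1 - \<eta>))))" if "m + g + i \<le> n" for i
      using that
    proof (induction i)
      case 0 then show ?case using surv_decreasing[of m "m + g" z \<rho>] by simp
    next
      case (Suc i)
      have "surv z \<rho> (m + g + Suc i) \<le> surv z \<rho> (m + g + i) * exp (- \<mu> * (1 - \<eta>))"
        using step[of "m + g + i"] Suc.prems by simp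
      also have "\<dots> \<le> surv z \<rho> m * exp (- (real i * (\<mu> * (1 - \<eta>)))) * exp (- \<mu> * (1 - \<eta>))"
        using Suc by (intro mult_right_mono) auto
      finally show ?case by (simp add: mult.assoc algebra_simps flip: exp_add)
    qed
    from this[of "n - m - g"] True
    have "surv z \<rho> n \<le> surv z \<rho> m * exp (- (real (n - m - g) * (\<mu> * (1 - \<eta>))))" by simp
    also have "\<dots> \<le> surv z \<rho> m * exp (real g * \<mu> + real (n - m) * \<mu> * \<eta> - real (n - m) * \<mu>)"
    proof (intro mult_left_mono surv_nonneg, subst exp_le_cancel_iff)
      define N where "N = real (n - m)"
      have N: "real (n - m - g) = N - real g" using True by (simp add: N_def)
      have "0 \<le> real g * \<mu> * \<eta>" using \<mu>0 \<eta>0 by simp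
      then show "- (real (n - m - g) * (\<mu> * (1 - \<eta>))) \<le> real g * \<mu> + real (n - m) * \<mu> * \<eta> - real (n - m) * \<mu>"
        unfolding N N_def[symmetric] by (simp add: algebra_simps)
    qed
    finally show ?thesis .
  qed
qed

text \<open>The loss is bounded by the mass \<open>g\<close> steps earlier, so that mass must first
  be compared with the present one: the crude loss of at most \<open>33 / 10 * \<mu>\<close> per
  step, used \<open>g\<close> times, gives a factor \<open>1 + 2 * y\<close>. The final
  \<open>1 / 2\<close> covers the first \<open>g\<close> steps.\<close>

theorem surv_lower:
  assumes g: "g \<ge> 1" "real g * ball_mass z r \<le> 1 / 100"
  defines "\<mu> \<equiv> ball_mass z r"
  shows "exp (- (real n * \<mu> * (1 + 348 * (real g * \<mu>) + 8 / 2 ^ g))) / 2 \<le> surv z (\<lambda>_. r) n"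
proof -
  let ?s = "surv z (\<lambda>_. r)"
  have \<mu>0: "\<mu> \<ge> 0" by (simp add: \<mu>_def)
  have \<mu>g: "\<mu> \<le> real g * \<mu>" using g(1) \<mu>0 mult_right_mono[of 1 "real g" \<mu>] by simp
  then have \<mu>1: "\<mu> \<le> 1 / 100" using g(2) by (simp add: \<mu>_def)
  then have small: "\<And>t. ball_mass z r \<le> 1 / 100" by (simp add: \<mu>_def)
  have crude: "(1 - 33 / 10 * \<mu>) * ?s k \<le> ?s (Suc k)" for k
  proof -
    have "ball_integral z r (killed z (\<lambda>_. r) k) \<le> 33 / 10 * ?s k * \<mu>"
      using killed_regular[of z "\<lambda>_. r" k, OF small]
      unfolding \<mu>_def by (intro loss_bounds(1) killed_measurable killed_nonneg) auto
    then show ?thesis using surv_step[of z "\<lambda>_. r" k] by (simp add: algebra_simps)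
  qed
  define y where "y = 33 / 10 * (real g * \<mu>)"
  have y: "0 \<le> y" "y \<le> 1 / 30" using \<mu>0 g(2) by (auto simp: y_def \<mu>_def)
  have bern: "1 - y \<le> (1 - 33 / 10 * \<mu>) ^ g"
    using Bernoulli_inequality[of "- (33 / 10 * \<mu>)" g] \<mu>1 by (simp add: y_def algebra_simps)
  have gsteps: "(1 - y) * ?s k \<le> ?s (k + g)" for k
  proof -
    have "(1 - 33 / 10 * \<mu>) ^ i * ?s k \<le> ?s (k + i)" for i
    proof (induction i)
      case (Suc i)
      have "(1 - 33 / 10 * \<mu>) ^ Suc i * ?s k \<le> (1 - 33 / 10 * \<mu>) * ?s (k + i)"
        using mult_left_mono[OF Suc, of "1 - 33 / 10 * \<mu>"] \<mu>1 by (simp add: mult.assoc)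
      also have "\<dots> \<le> ?s (k + Suc i)" using crude[of "k + i"] by simp
      finally show ?case .
    qed simp
    from this[of g] show ?thesis
      using mult_right_mono[OF bern surv_nonneg[of z "\<lambda>_. r" k]] by linarith
  qed
  define e where "e = 8 / (2 ^ g :: real)"
  have e: "0 \<le> e" "e \<le> 8" by (auto simp: e_def field_simps)
  \<comment> \<open>Expanding \<open>(1 + 2 * y) * (1 + e)\<close> with \<open>e \<le> 8\<close>
    gives at most \<open>1 + e + 18 * y\<close>, and \<open>18 * 33 / 10 < 60\<close>.\<close>
  define \<theta> where "\<theta> = 60 * (real g * \<mu>) + e"
  have \<theta>: "0 \<le> \<theta>" "\<theta> \<le> 9" using \<mu>0 g(2) e by (auto simp: \<theta>_def \<mu>_def)
  have step: "?s k * exp (- (\<mu> * (1 + 348 * (real g * \<mu>) + e))) \<le> ?s (Suc k)" if k: "g \<le> k" for k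
  proof -
    have "?s (k - g) \<le> ?s k * (1 + 2 * y)"
    proof -
      have "(1 - y) * ?s (k - g) \<le> ?s k" using gsteps[of "k - g"] k by simp
      then have "(1 + 2 * y) * ((1 - y) * ?s (k - g)) \<le> (1 + 2 * y) * ?s k"
        using y by (intro mult_left_mono) auto
      moreover have "1 * ?s (k - g) \<le> ((1 + 2 * y) * (1 - y)) * ?s (k - g)"
      proof (intro mult_right_mono surv_nonneg)
        have "y * y \<le> y * (1/2)" using y by (intro mult_left_mono) auto
        then show "1 \<le> (1 + 2 * y) * (1 - y)" by (simp add: algebra_simps)
      qed
      ultimately show ?thesis by (simp add: ac_simps)
    qed
    moreover have "ball_integral z r (killed z (\<lambda>_. r) k) \<le> \<mu> * ?s (k - g) * (1 + e)"
      using loss_upper[of z "\<lambda>_. r" "k - g" g r, OF small] k by (simp add: \<mu>_def e_def)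
    ultimately have "ball_integral z r (killed z (\<lambda>_. r) k) \<le> \<mu> * (?s k * (1 + 2 * y)) * (1 + e)"
      using \<mu>0 e by (smt (verit) mult_left_mono mult_right_mono)
    also have "\<dots> = \<mu> * ?s k * ((1 + 2 * y) * (1 + e))" by simp
    also have "\<dots> \<le> \<mu> * ?s k * (1 + \<theta>)"
    proof (intro mult_left_mono mult_nonneg_nonneg \<mu>0 surv_nonneg)
      have "y * e \<le> y * 8" using y e by (intro mult_left_mono) auto
      moreover have "(1 + 2 * y) * (1 + e) = 1 + e + 2 * y + 2 * (y * e)" by (simp add: algebra_simps)
      moreover have "0 \<le> real g * \<mu>" using \<mu>0 by simp
      ultimately show "(1 + 2 * y) * (1 + e) \<le> 1 + \<theta>"
        using y_def \<theta>_def by linarith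
    qed
    finally have 1: "?s k * (1 - \<mu> * (1 + \<theta>)) \<le> ?s (Suc k)"
      using surv_step[of z "\<lambda>_. r" k] by (simp add: algebra_simps)
    define x where "x = \<mu> * (1 + \<theta>)"
    have x: "0 \<le> x" "x \<le> 10 * \<mu>" using \<mu>0 \<theta> mult_left_mono[of "1 + \<theta>" 10 \<mu>] by (auto simp: x_def)
    have x2: "x \<le> 1 / 2" using x \<mu>1 by simp
    \<comment> \<open>This quadratic error of the logarithm accounts for the remaining part of the
      coefficient \<open>348 = 60 + 288\<close>.\<close>
    have "2 * x\<^sup>2 \<le> 288 * (\<mu> * (real g * \<mu>))"
    proof -
      have "x\<^sup>2 \<le> (10 * \<mu>)\<^sup>2" using x by (intro power_mono) auto
      moreover have "\<mu> * \<mu> \<le> \<mu> * (real g * \<mu>)" using \<mu>0 \<mu>g by (intro mult_left_mono) auto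
      moreover have "(10 * \<mu>)\<^sup>2 = 100 * (\<mu> * \<mu>)" by (simp add: power2_eq_square)
      moreover have "0 \<le> \<mu> * \<mu>" by simp
      ultimately show ?thesis by linarith
    qed
    then have "- (\<mu> * (1 + 348 * (real g * \<mu>) + e)) \<le> - x - 2 * x\<^sup>2"
      by (simp add: x_def \<theta>_def algebra_simps)
    also have "\<dots> \<le> ln (1 - x)" by (rule ln_one_minus_pos_lower_bound[OF x(1) x2])
    finally have "exp (- (\<mu> * (1 + 348 * (real g * \<mu>) + e))) \<le> 1 - x"
      using x2 by (simp add: ln_ge_iff)
    then show ?thesis using 1 mult_left_mono[OF _ surv_nonneg[of z "\<lambda>_. r" k]] by (fastforce simp: x_def)
  qed
  have sg: "1 / 2 \<le> ?s g" using gsteps[of 0] y by (simp add: surv_0)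
  define c where "c = \<mu> * (1 + 348 * (real g * \<mu>) + e)"
  have c0: "c \<ge> 0" using \<mu>0 e by (simp add: c_def)
  have ind: "exp (- (real i * c)) / 2 \<le> ?s (g + i)" for i
  proof (induction i)
    case (Suc i)
    have "exp (- (real (Suc i) * c)) / 2 = exp (- (real i * c)) / 2 * exp (- c)"
      by (simp add: algebra_simps flip: exp_add)
    also have "\<dots> \<le> ?s (g + i) * exp (- c)" using Suc by (intro mult_right_mono) auto
    also have "\<dots> \<le> ?s (g + Suc i)" using step[of "g + i"] by (simp add: c_def)
    finally show ?case .
  qed (use sg in simp)
  have "exp (- (real n * c)) / 2 \<le> ?s n"
  proof (cases "g \<le> n")
    case True
    have "exp (- (real n * c)) \<le> exp (- (real (n - g) * c))" using c0 True by (auto intro!: mult_right_mono)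
    moreover have "exp (- (real (n - g) * c)) / 2 \<le> ?s n" using ind[of "n - g"] True by simp
    ultimately show ?thesis by linarith
  next
    case False
    then have "1 / 2 \<le> ?s n" using sg surv_decreasing[of n g z "\<lambda>_. r"] by simp
    moreover have "exp (- (real n * c)) \<le> 1" using c0 by simp
    ultimately show ?thesis by linarith
  qed
  then show ?thesis by (simp add: c_def e_def ac_simps)
qed

section \<open>Balls and short returns\<close>

text \<open>Both bounds are \<open>ln u \<le> u - 1\<close>, applied to
  \<open>(1 + x) / (1 + y)\<close> and to its inverse.\<close>

lemma ln_diff_bounds:
  fixes x y :: real
  assumes "0 \<le> y" "y \<le> x" "x \<le> 1"
  shows "ln (1 + x) - ln (1 + y) \<le> x - y" "x - y \<le> 2 * (ln (1 + x) - ln (1 + y))"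
proof -
  have e: "ln (1 + x) - ln (1 + y) = ln ((1 + x) / (1 + y))"
    "ln (1 + x) - ln (1 + y) = - ln ((1 + y) / (1 + x))"
    using assms by (auto simp: ln_div)
  have "ln ((1 + x) / (1 + y)) \<le> (1 + x) / (1 + y) - 1"
    using assms by (intro ln_le_minus_one) auto
  also have "\<dots> = (x - y) / (1 + y)" using assms by (simp add: field_simps)
  also have "\<dots> \<le> x - y" using assms divide_left_mono[of 1 "1 + y" "x - y"] by simp
  finally show "ln (1 + x) - ln (1 + y) \<le> x - y" using e(1) by simp
  have "ln ((1 + y) / (1 + x)) \<le> (1 + y) / (1 + x) - 1"
    using assms by (intro ln_le_minus_one) auto
  then have "1 - (1 + y) / (1 + x) \<le> ln (1 + x) - ln (1 + y)" using e(2) by linarith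
  moreover have "(x - y) / 2 \<le> (x - y) / (1 + x)" using assms by (intro divide_left_mono) auto
  moreover have "(x - y) / (1 + x) = 1 - (1 + y) / (1 + x)" using assms by (simp add: field_simps)
  ultimately have "(x - y) / 2 \<le> ln (1 + x) - ln (1 + y)" by (metis order_trans)
  then show "x - y \<le> 2 * (ln (1 + x) - ln (1 + y))" by simp
qed

lemma ball_mass_eq:
  assumes z: "z \<in> {0..1}" and r: "0 \<le> r"
  shows "ball_mass z r = (ln (1 + min 1 (z + r)) - ln (1 + max 0 (z - r))) / ln 2"
proof -
  define a where "a = max 0 (z - r)"
  define b where "b = min 1 (z + r)"
  have ab: "0 \<le> a" "a \<le> b" "b \<le> 1" using z r by (auto simp: a_def b_def)
  have "emeasure \<M> (unit_ball z r) = (\<integral>\<^sup>+x. indicator (unit_ball z r) x \<partial>\<M>)"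
    by simp
  also have "\<dots> = (\<integral>\<^sup>+x. ennreal (1 / (ln 2 * (1 + x))) * indicator (unit_ball z r) x * indicator {0..1} x \<partial>lborel)"
    by (subst nn_integral_gauss) auto
  also have "\<dots> = (\<integral>\<^sup>+x. ennreal (1 / (ln 2 * (1 + x))) * indicator {a..b} x \<partial>lborel)"
  proof (rule nn_integral_cong_AE, rule AE_mp[OF AE_lborel_singleton[of a]], rule AE_mp[OF AE_lborel_singleton[of b]], intro AE_I2 impI)
    fix x assume "x \<noteq> a" "x \<noteq> b"
    then have "x \<in> unit_ball z r \<longleftrightarrow> x \<in> {a..b}"
      using r z unfolding unit_ball_def a_def b_def by (auto simp: abs_less_iff)
    moreover have "x \<in> {a..b} \<Longrightarrow> x \<in> {0..1}" using ab by auto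
    ultimately show "ennreal (1 / (ln 2 * (1 + x))) * indicator (unit_ball z r) x * indicator {0..1} x =
      ennreal (1 / (ln 2 * (1 + x))) * indicator {a..b} x" by (auto simp: indicator_def)
  qed
  also have "\<dots> = ennreal (ln (1 + b) / ln 2 - ln (1 + a) / ln 2)"
    by (rule nn_integral_FTC_Icc[where F="\<lambda>x. ln (1 + x) / ln 2"])
       (use ab in \<open>auto intro!: derivative_eq_intros simp: divide_simps\<close>)
  finally have "ball_mass z r = enn2real (ennreal (ln (1 + b) / ln 2 - ln (1 + a) / ln 2))"
    by (simp add: measure_def)
  moreover have "ln (1 + a) / ln 2 \<le> ln (1 + b) / ln 2"
    using ab by (intro divide_right_mono) auto
  ultimately show ?thesis by (simp add: a_def b_def diff_divide_distrib)
qed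

lemma ball_mass_le:
  assumes z: "z \<in> {0..1}" and r: "0 \<le> r"
  shows "ball_mass z r \<le> 4 * r"
proof -
  have "ln (1 + min 1 (z + r)) - ln (1 + max 0 (z - r)) \<le> min 1 (z + r) - max 0 (z - r)"
    using z r by (intro ln_diff_bounds) auto
  also have "\<dots> \<le> 2 * r" by auto
  also have "\<dots> \<le> 4 * r * ln 2" using r ln2_ge_two_thirds mult_left_mono[of "1/2" "ln 2" "4 * r"] by simp
  finally show ?thesis unfolding ball_mass_eq[OF z r] by (simp add: divide_le_eq)
qed

lemma ball_mass_ge:
  assumes z: "z \<in> {0..1}" and r: "0 \<le> r" "r \<le> 1"
  shows "r / 2 \<le> ball_mass z r"
proof -
  have "r / 2 * ln 2 \<le> r / 2 * 1" using r ln_2_less_1 by (intro mult_left_mono) auto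
  also have "\<dots> \<le> (min 1 (z + r) - max 0 (z - r)) / 2" using z r by auto
  also have "\<dots> \<le> ln (1 + min 1 (z + r)) - ln (1 + max 0 (z - r))"
    using ln_diff_bounds(2)[of "max 0 (z - r)" "min 1 (z + r)"] z r by auto
  finally show ?thesis unfolding ball_mass_eq[OF z r(1)] by (simp add: le_divide_eq)
qed

lemma ball_mass_mono: "r \<le> s \<Longrightarrow> ball_mass z r \<le> ball_mass z s"
  by (rule gauss.finite_measure_mono[OF _ unit_ball_sets_gauss]) (auto simp: unit_ball_def)

text \<open>The mass is continuous in the radius, so the intermediate value theorem gives a radius;
  the comparison of masses then decides the comparison of radii.\<close>

lemma ball_with_mass:
  assumes z: "z \<in> {0..1}" and \<tau>: "0 < \<tau>" "\<tau> < 1" and r: "0 < r"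
  obtains s where "0 < s" "s \<le> 1" "ball_mass z s = \<tau>" "\<tau> \<le> ball_mass z r \<Longrightarrow> s \<le> r"
    "ball_mass z r \<le> \<tau> \<Longrightarrow> r \<le> s"
proof -
  define F where "F r = (ln (1 + min 1 (z + r)) - ln (1 + max 0 (z - r))) / ln 2" for r
  have F: "ball_mass z r = F r" if "0 \<le> r" for r using ball_mass_eq[OF z that] by (simp add: F_def)
  have "continuous_on {0..1} F"
    unfolding F_def using z by (intro continuous_intros) auto
  moreover have "F 0 = 0" "F 1 = 1" using z by (auto simp: F_def)
  ultimately obtain t where t: "0 \<le> t" "t \<le> 1" "F t = \<tau>"
    using IVT'[of F 0 \<tau> 1] \<tau> by auto
  have t0: "0 < t" using t \<tau> \<open>F 0 = 0\<close> by (cases "t = 0") auto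
  show ?thesis
  \<comment> \<open>For equal masses both comparisons are demanded at once, which forces
    \<open>s = r\<close>; and \<open>r \<le> 1\<close> because larger balls have full mass.\<close>
  proof (cases "ball_mass z r = \<tau>")
    case True
    show ?thesis
    proof (cases "r \<le> 1")
      case True then show ?thesis using that[of r] r \<open>ball_mass z r = \<tau>\<close> by auto
    next
      case False
      then have "ball_mass z 1 \<le> ball_mass z r" by (intro ball_mass_mono) auto
      then show ?thesis using F[of 1] \<open>F 1 = 1\<close> \<tau> True by auto
    qed
  next
    case False
    have bt: "ball_mass z t = \<tau>" using F t by auto
    show ?thesis
    proof (rule that[OF t0 t(2) bt])
      show "t \<le> r" if "\<tau> \<le> ball_mass z r"
        using that False bt ball_mass_mono[of r t z] by linarith
      show "r \<le> t" if "ball_mass z r \<le> \<tau>"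
        using that False bt ball_mass_mono[of t r z] by linarith
    qed
  qed
qed

section \<open>Rarity of short returns\<close>

definition near :: "nat \<Rightarrow> (real \<Rightarrow> real) \<Rightarrow> real \<Rightarrow> real set" where
  "near t \<phi> d = {x \<in> {0..1}. \<bar>(gauss_map ^^ t) x - \<phi> x\<bar> < d}"

lemma measurable_gauss_borel:
  "f \<in> measurable N \<M> \<Longrightarrow> f \<in> borel_measurable N"
  by (rule measurable_compose[where g="\<lambda>x. x" and N=\<M> and L=borel, simplified])
     (auto intro: borel_imp_gauss_measurable)

lemma near_sets [measurable]:
  assumes [measurable]: "\<phi> \<in> measurable \<M> \<M>"
  shows "near t \<phi> d \<in> sets \<M>"
proof -
  note [measurable] = measurable_gauss_borel[OF assms] measurable_gauss_borel[OF funpow_measurable_gauss]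
  have "{x \<in> space \<M>. \<bar>(gauss_map ^^ t) x - \<phi> x\<bar> < d} \<in> sets \<M>"
    by measurable
  then show ?thesis by (simp add: near_def)
qed

lemma gauss_AE_neq: "AE x in \<M>. x \<noteq> c"
proof -
  have [measurable]: "{c} \<inter> {0..1} \<in> sets \<M>" by (auto simp: sets_gauss_iff)
  have "emeasure \<M> ({c} \<inter> {0..1}) = (\<integral>\<^sup>+x. indicator ({c} \<inter> {0..1}) x \<partial>\<M>)" by simp
  also have "\<dots> = (\<integral>\<^sup>+x. ennreal (1 / (ln 2 * (1 + x))) * indicator ({c} \<inter> {0..1}) x * indicator {0..1} x \<partial>lborel)"
    by (subst nn_integral_gauss) auto
  also have "\<dots> = (\<integral>\<^sup>+x. 0 \<partial>(lborel :: real measure))"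
    by (rule nn_integral_cong_AE, rule AE_mp[OF AE_lborel_singleton[of c]]) (auto simp: indicator_def)
  finally show ?thesis by (intro AE_I[of _ _ "{c} \<inter> {0..1}"]) auto
qed

text \<open>Since \<open>gauss_map\<close> inverts \<open>branch i\<close>, pulling back along that
  branch trades one iterate of the map for the composition of \<open>\<phi>\<close> with the branch;
  this is why \<open>near\<close> allows an arbitrary target \<open>\<phi>\<close>, not only the
  identity. The weights are dominated by \<open>2 * weight i 0\<close>, which sum to 2.\<close>

lemma near_step:
  assumes [measurable]: "\<phi> \<in> measurable \<M> \<M>"
    and c: "\<And>i. emeasure \<M> (near t (\<phi> \<circ> branch i) d) \<le> ennreal c" "0 \<le> c"
  shows "emeasure \<M> (near (Suc t) \<phi> d) \<le> ennreal (2 * c)"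
proof -
  have [measurable]: "(\<phi> \<circ> branch i) \<in> measurable \<M> \<M>" for i
    unfolding comp_def by measurable
  let ?N = "near (Suc t) \<phi> d"
  have "emeasure \<M> ?N = (\<integral>\<^sup>+x. indicator ?N x * 1 \<partial>\<M>)" by simp
  also have "\<dots> = (\<integral>\<^sup>+y. (\<Sum>i. ennreal (weight i y) * indicator ?N (branch i y)) * 1 \<partial>\<M>)"
    by (rule transfer_duality_nn[of "indicator ?N" "\<lambda>_. 1"]) auto
  also have "\<dots> \<le> (\<integral>\<^sup>+y. (\<Sum>i. ennreal (2 * weight i 0) * indicator (near t (\<phi> \<circ> branch i) d) y) \<partial>\<M>)"
  proof (rule nn_integral_mono_AE, rule AE_mp[OF gauss_AE_neq[of 1]], intro AE_I2 impI)
    fix y assume "y \<in> space \<M>" "y \<noteq> 1"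
    then have y: "y \<in> {0..1}" "y \<in> {0..<1}" by auto
    have "weight i y \<le> 2 * weight i 0" for i
      using y unfolding weight_def mult_2 by (simp add: frac_le divide_simps add_mono) (auto intro!: mult_mono)
    moreover have "indicator ?N (branch i y) = (indicator (near t (\<phi> \<circ> branch i) d) y :: ennreal)" for i
      using y branch_in[OF y(1), of i] gauss_map_branch[OF y(2), of i]
      by (auto simp: near_def indicator_def funpow_swap1)
    ultimately show "(\<Sum>i. ennreal (weight i y) * indicator ?N (branch i y)) * 1 \<le>
      (\<Sum>i. ennreal (2 * weight i 0) * indicator (near t (\<phi> \<circ> branch i) d) y)"
      by (auto intro!: suminf_le mult_right_mono ennreal_leI)
  qed
  also have "\<dots> = (\<Sum>i. ennreal (2 * weight i 0) * emeasure \<M> (near t (\<phi> \<circ> branch i) d))"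
    by (subst nn_integral_suminf) (auto simp: nn_integral_cmult)
  also have "\<dots> \<le> (\<Sum>i. ennreal (2 * weight i 0) * ennreal c)"
    by (intro suminf_le mult_left_mono c) auto
  also have "\<dots> = (\<Sum>i. ennreal (2 * weight i 0 * c))"
    using c by (intro suminf_cong) (auto simp: ennreal_mult weight_nonneg)
  also have "\<dots> = ennreal (2 * c)"
  proof (rule suminf_ennreal_eq)
    show "0 \<le> 2 * weight i 0 * c" for i using c weight_nonneg[of 0 i] by simp
    show "(\<lambda>i. 2 * weight i 0 * c) sums (2 * c)"
      using sums_mult2[OF sums_mult[OF weight_sums[of 0], of 2], of c] by simp
  qed
  finally show ?thesis .
qed

text \<open>Inverse branches contract by \<open>1/2\<close> in the metric \<open>\<bar>ln (1 + x) - ln (1 + y)\<bar>\<close>, uniformly in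
  the branch; in the Euclidean metric the first branch does not contract uniformly near \<open>0\<close>.\<close>

definition log_contraction :: "(real \<Rightarrow> real) \<Rightarrow> bool" where
  "log_contraction \<phi> \<longleftrightarrow> (\<forall>x\<in>{0..1}. \<phi> x \<in> {0..1}) \<and>
     (\<forall>x\<in>{0..1}. \<forall>y\<in>{0..1}. \<bar>ln (1 + \<phi> x) - ln (1 + \<phi> y)\<bar> \<le> \<bar>ln (1 + x) - ln (1 + y)\<bar> / 2)"

text \<open>Adding \<open>ln (1 + x) / 2\<close> to the decreasing function
  \<open>ln (1 + branch i x)\<close> makes it nondecreasing: with \<open>s = u + 1 + i\<close> the
  derivative is \<open>1 / (2 * (1 + u)) - 1 / (s * (s + 1))\<close>, where
  \<open>s \<ge> 1 + u\<close> and \<open>s + 1 \<ge> 2\<close>.\<close>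

lemma log_contraction_branch: "log_contraction (branch i)"
proof -
  have *: "\<bar>ln (1 + branch i x) - ln (1 + branch i y)\<bar> \<le> \<bar>ln (1 + x) - ln (1 + y)\<bar> / 2"
    if xy: "0 \<le> x" "x \<le> y" for x y
  proof -
    define F where "F x = ln (1 + branch i x) + ln (1 + x) / 2" for x
    have "F x \<le> F y"
    proof (rule DERIV_nonneg_imp_nondecreasing[OF xy(2)])
      fix u assume u: "x \<le> u" "u \<le> y"
      define s where "s = u + 1 + real i"
      have s: "s \<ge> 1 + u" "s > 0" "1 + u > 0" using u xy by (auto simp: s_def)
      have "(F has_real_derivative (1 / (1 + 1 / s) * (- (1 / s\<^sup>2)) + 1 / (1 + u) / 2)) (at u)"
      proof -
        have d1: "((\<lambda>x. 1 + 1 / (x + 1 + real i)) has_real_derivative - (1 / s\<^sup>2)) (at u)"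
          using s by (auto intro!: derivative_eq_intros simp: s_def power2_eq_square)
        have d2: "(ln has_real_derivative 1 / (1 + 1 / (u + 1 + real i))) (at (1 + 1 / (u + 1 + real i)))"
          using s by (intro DERIV_ln_divide) (simp add: s_def add_pos_pos)
        have d3: "((\<lambda>x. ln (1 + x) / 2) has_real_derivative 1 / (1 + u) / 2) (at u)"
          using s by (auto intro!: derivative_eq_intros simp: divide_simps)
        show ?thesis
          unfolding F_def branch_def s_def
          by (rule DERIV_add[OF DERIV_chain2[OF d2 d1[unfolded s_def]] d3])
      qed
      moreover have "1 / (1 + 1 / s) * (- (1 / s\<^sup>2)) + 1 / (1 + u) / 2 \<ge> 0"
      proof -
        have "2 * (1 + u) \<le> s * (s + 1)"
          using mult_mono[of "1 + u" s 2 "s + 1"] s u xy by (simp add: ac_simps)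
        then have 1: "1 / (s * (s + 1)) \<le> 1 / (2 * (1 + u))" using s by (intro divide_left_mono) auto
        have 2: "1 / (1 + 1 / s) * (1 / s\<^sup>2) = 1 / (s * (s + 1))"
          using s by (simp add: divide_simps power2_eq_square)
        have 3: "1 / (1 + u) / 2 = 1 / (2 * (1 + u))" by simp
        show ?thesis unfolding mult_minus_right 2 3 using 1 by (simp only: le_minus_iff add.commute[of "- _"] diff_conv_add_uminus[symmetric] diff_ge_0_iff_ge)
      qed
      ultimately show "\<exists>D. (F has_real_derivative D) (at u) \<and> 0 \<le> D" by blast
    qed
    moreover have "branch i y \<le> branch i x" "0 \<le> branch i y"
      using xy by (auto simp: branch_def frac_le)
    then have "ln (1 + branch i y) \<le> ln (1 + branch i x)" by simp
    moreover have "ln (1 + x) \<le> ln (1 + y)" using xy by simp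
    ultimately show ?thesis by (simp add: F_def)
  qed
  show ?thesis unfolding log_contraction_def
  proof (intro conjI ballI)
    fix x y :: real assume "x \<in> {0..1}" "y \<in> {0..1}"
    then show "\<bar>ln (1 + branch i x) - ln (1 + branch i y)\<bar> \<le> \<bar>ln (1 + x) - ln (1 + y)\<bar> / 2"
      using *[of x y] *[of y x] by (cases "x \<le> y") (auto simp: abs_minus_commute)
  qed (use branch_in in blast)
qed

lemma log_contraction_comp:
  assumes "log_contraction \<phi>" shows "log_contraction (\<phi> \<circ> branch i)"
  unfolding log_contraction_def
proof (intro conjI ballI)
  fix x y :: real assume xy: "x \<in> {0..1}" "y \<in> {0..1}"
  have "\<bar>ln (1 + \<phi> (branch i x)) - ln (1 + \<phi> (branch i y))\<bar> \<le> \<bar>ln (1 + branch i x) - ln (1 + branch i y)\<bar> / 2"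
    using assms xy branch_in unfolding log_contraction_def by blast
  moreover have "\<bar>ln (1 + branch i x) - ln (1 + branch i y)\<bar> \<le> \<bar>ln (1 + x) - ln (1 + y)\<bar> / 2"
    using log_contraction_branch xy unfolding log_contraction_def by blast
  moreover have "A \<le> B / 2 \<Longrightarrow> B \<le> C / 2 \<Longrightarrow> 0 \<le> B \<Longrightarrow> A \<le> C / 2" for A B C :: real by linarith
  ultimately show "\<bar>ln (1 + (\<phi> \<circ> branch i) x) - ln (1 + (\<phi> \<circ> branch i) y)\<bar> \<le> \<bar>ln (1 + x) - ln (1 + y)\<bar> / 2"
    unfolding comp_apply using abs_ge_zero by blast
qed (use assms branch_in in \<open>auto simp: log_contraction_def\<close>)

text \<open>Approximate fixed points of a contraction are close together. For \<open>t = 0\<close>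
  two of them have logarithmic distance D with \<open>D \<le> 2 * d + D / 2\<close>, hence Euclidean
  distance at most \<open>8 * d\<close>; a ball of radius \<open>9 * d\<close> has mass at most
  \<open>36 * d\<close>. Each further iterate costs a factor 2.\<close>

lemma near_log_contraction:
  assumes "log_contraction \<phi>" "\<phi> \<in> measurable \<M> \<M>" "0 < d"
  shows "emeasure \<M> (near t \<phi> d) \<le> ennreal (36 * 2 ^ t * d)"
  using assms(1,2)
proof (induction t arbitrary: \<phi>)
  case 0
  show ?case
  proof (cases "near 0 \<phi> d = {}")
    case False
    then obtain x where x: "x \<in> near 0 \<phi> d" by blast
    have lip: "\<bar>ln (1 + u) - ln (1 + v)\<bar> \<le> \<bar>u - v\<bar>" "\<bar>u - v\<bar> \<le> 2 * \<bar>ln (1 + u) - ln (1 + v)\<bar>"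
      if "u \<in> {0..1}" "v \<in> {0..1}" for u v :: real
      using ln_diff_bounds[of u v] ln_diff_bounds[of v u] that by (cases "u \<le> v"; auto simp: abs_if)+
    have "near 0 \<phi> d \<subseteq> unit_ball x (9 * d)"
    proof
      fix y assume y: "y \<in> near 0 \<phi> d"
      have m: "x \<in> {0..1}" "y \<in> {0..1}" "\<phi> x \<in> {0..1}" "\<phi> y \<in> {0..1}"
        using x y 0 by (auto simp: near_def log_contraction_def)
      define X Y X' Y' where "X = ln (1 + x)" "Y = ln (1 + y)" "X' = ln (1 + \<phi> x)" "Y' = ln (1 + \<phi> y)"
      note D = this
      have "\<bar>X - X'\<bar> \<le> d" "\<bar>Y - Y'\<bar> \<le> d"
        using lip(1)[OF m(1,3)] lip(1)[OF m(2,4)] x y by (auto simp: near_def D)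
      moreover have "\<bar>X' - Y'\<bar> \<le> \<bar>X - Y\<bar> / 2" using 0(1) m by (auto simp: log_contraction_def D)
      moreover have "\<bar>x - y\<bar> \<le> 2 * \<bar>X - Y\<bar>" using lip(2)[OF m(1,2)] by (simp add: D)
      moreover have "\<bar>X - Y\<bar> \<le> \<bar>X - X'\<bar> + \<bar>X' - Y'\<bar> + \<bar>Y - Y'\<bar>" by linarith
      moreover have "A \<le> d \<Longrightarrow> B \<le> d \<Longrightarrow> C \<le> D / 2 \<Longrightarrow> E \<le> 2 * D \<Longrightarrow> D \<le> A + C + B \<Longrightarrow> E \<le> 8 * d"
        for A B C D E by linarith
      ultimately have "\<bar>x - y\<bar> \<le> 8 * d" by blast
      then show "y \<in> unit_ball x (9 * d)" using m \<open>0 < d\<close> by (auto simp: unit_ball_def)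
    qed
    then have "emeasure \<M> (near 0 \<phi> d) \<le> emeasure \<M> (unit_ball x (9 * d))"
      by (rule emeasure_mono) measurable
    also have "\<dots> \<le> ennreal (4 * (9 * d))"
      unfolding gauss.emeasure_eq_measure using x \<open>0 < d\<close>
      by (intro ennreal_leI ball_mass_le) (auto simp: near_def)
    finally show ?thesis by simp
  qed simp
next
  case (Suc t)
  have "emeasure \<M> (near (Suc t) \<phi> d) \<le> ennreal (2 * (36 * 2 ^ t * d))"
  proof (rule near_step)
    show "emeasure \<M> (near t (\<phi> \<circ> branch i) d) \<le> ennreal (36 * 2 ^ t * d)" for i
      using Suc.prems by (intro Suc.IH log_contraction_comp measurable_comp[OF branch_measurable_gauss]) auto
  qed (use Suc.prems \<open>0 < d\<close> in auto)
  then show ?case by (simp add: ac_simps)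
qed

text \<open>The identity is not a contraction, but one application of \<open>near_step\<close>
  replaces it by the inverse branches, which are; hence \<open>1 \<le> t\<close>.\<close>

lemma near_identity:
  assumes "0 < d" "1 \<le> t"
  shows "emeasure \<M> (near t (\<lambda>x. x) d) \<le> ennreal (36 * 2 ^ t * d)"
proof -
  obtain u where t: "t = Suc u" using assms by (cases t) auto
  have "emeasure \<M> (near (Suc u) (\<lambda>x. x) d) \<le> ennreal (2 * (36 * 2 ^ u * d))"
    using assms by (intro near_step near_log_contraction[of "(\<lambda>x. x) \<circ> branch i" for i])
      (auto simp: comp_def log_contraction_branch)
  then show ?thesis by (simp add: t ac_simps)
qed

interpretation gauss2: pair_sigma_finite \<M> \<M> ..

text \<open>Exchange the integrations over the centre and the point. A point contributes only if it
  returns within \<open>2 * s\<close> of itself, and then only for centres within \<open>s\<close>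
  of it, so the bound is \<open>4 * s\<close> times the bound from
  \<open>near_identity\<close>.\<close>

lemma return_mass_kernel:
  assumes s: "0 < s" and t: "1 \<le> t"
  shows "(\<lambda>z. return_mass z s t) \<in> borel_measurable \<M>"
    and "(\<integral>\<^sup>+z. ennreal (return_mass z s t) \<partial>\<M>) \<le> ennreal (288 * 2 ^ t * s\<^sup>2)"
proof -
  define S where "S = {p \<in> space (\<M> \<Otimes>\<^sub>M \<M>). \<bar>fst p - snd p\<bar> < s \<and> \<bar>fst p - (gauss_map ^^ t) (snd p)\<bar> < s}"
  have [measurable]: "fst \<in> borel_measurable (\<M> \<Otimes>\<^sub>M \<M>)"
    "snd \<in> borel_measurable (\<M> \<Otimes>\<^sub>M \<M>)"
    "(\<lambda>p. (gauss_map ^^ t) (snd p)) \<in> borel_measurable (\<M> \<Otimes>\<^sub>M \<M>)"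
    by (rule measurable_gauss_borel[OF measurable_fst] measurable_gauss_borel[OF measurable_snd]
        measurable_gauss_borel[OF measurable_compose[OF measurable_snd funpow_measurable_gauss]])+
  have S [measurable]: "S \<in> sets (\<M> \<Otimes>\<^sub>M \<M>)"
    unfolding S_def by measurable
  have ret: "ennreal (return_mass z s t) = (\<integral>\<^sup>+x. indicator S (z, x) \<partial>\<M>)" if "z \<in> {0..1}" for z
  proof -
    let ?A = "{x \<in> unit_ball z s. (gauss_map ^^ t) x \<in> unit_ball z s}"
    have "(\<integral>\<^sup>+x. indicator S (z, x) \<partial>\<M>) = (\<integral>\<^sup>+x. indicator ?A x \<partial>\<M>)"
      using that gauss_funpow_in by (intro nn_integral_cong) (auto simp: S_def unit_ball_def indicator_def space_pair_measure)
    also have "\<dots> = emeasure \<M> ?A" by (rule nn_integral_indicator[OF return_set_sets])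
    finally show ?thesis by (simp add: return_mass_def gauss.emeasure_eq_measure)
  qed
  have "(\<lambda>z. enn2real (\<integral>\<^sup>+x. indicator S (z, x) \<partial>\<M>)) \<in> borel_measurable \<M>"
    by measurable
  moreover have "return_mass z s t = enn2real (\<integral>\<^sup>+x. indicator S (z, x) \<partial>\<M>)" if "z \<in> {0..1}" for z
    using ret[OF that, symmetric] by (simp add: return_mass_def)
  ultimately show "(\<lambda>z. return_mass z s t) \<in> borel_measurable \<M>"
    by (subst measurable_cong) auto
  have id [measurable]: "(\<lambda>x. x) \<in> measurable \<M> \<M>" by (rule measurable_ident[unfolded id_def])
  have "(\<integral>\<^sup>+z. ennreal (return_mass z s t) \<partial>\<M>) = (\<integral>\<^sup>+z. (\<integral>\<^sup>+x. indicator S (z, x) \<partial>\<M>) \<partial>\<M>)"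
    by (intro nn_integral_cong ret) simp
  also have "\<dots> = (\<integral>\<^sup>+x. (\<integral>\<^sup>+z. indicator S (z, x) \<partial>\<M>) \<partial>\<M>)"
    by (rule gauss2.Fubini'[symmetric]) measurable
  also have "\<dots> \<le> (\<integral>\<^sup>+x. ennreal (4 * s) * indicator (near t (\<lambda>x. x) (2 * s)) x \<partial>\<M>)"
  proof (rule nn_integral_mono)
    fix x assume "x \<in> space \<M>"
    then have x: "x \<in> {0..1}" by simp
    have "(\<integral>\<^sup>+z. indicator S (z, x) \<partial>\<M>) \<le> (\<integral>\<^sup>+z. indicator (unit_ball x s) z * indicator (near t (\<lambda>x. x) (2 * s)) x \<partial>\<M>)"
      using x by (intro nn_integral_mono) (auto simp: indicator_def S_def unit_ball_def near_def space_pair_measure)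
    also have "\<dots> = ennreal (ball_mass x s) * indicator (near t (\<lambda>x. x) (2 * s)) x"
      by (simp add: nn_integral_multc gauss.emeasure_eq_measure)
    also have "\<dots> \<le> ennreal (4 * s) * indicator (near t (\<lambda>x. x) (2 * s)) x"
      using ball_mass_le[OF x] s by (intro mult_right_mono ennreal_leI) auto
    finally show "(\<integral>\<^sup>+z. indicator S (z, x) \<partial>\<M>) \<le> ennreal (4 * s) * indicator (near t (\<lambda>x. x) (2 * s)) x" .
  qed
  also have "\<dots> = ennreal (4 * s) * emeasure \<M> (near t (\<lambda>x. x) (2 * s))"
    by (simp add: nn_integral_cmult)
  also have "\<dots> \<le> ennreal (4 * s) * ennreal (36 * 2 ^ t * (2 * s))"
    using s t by (intro mult_left_mono near_identity) auto
  also have "\<dots> = ennreal (288 * 2 ^ t * s\<^sup>2)"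
    using s by (simp flip: ennreal_mult) (simp add: power2_eq_square ac_simps)
  finally show "(\<integral>\<^sup>+z. ennreal (return_mass z s t) \<partial>\<M>) \<le> ennreal (288 * 2 ^ t * s\<^sup>2)" .
qed

section \<open>Ergodicity and a zero-one law\<close>

lemma AE_funpow:
  assumes "AE x in \<M>. P x"
  shows "AE x in \<M>. P ((gauss_map ^^ n) x)"
proof -
  from assms obtain N where N: "N \<in> null_sets \<M>" "{x \<in> space \<M>. \<not> P x} \<subseteq> N"
    by (auto elim!: AE_E simp: null_sets_def)
  have [measurable]: "N \<in> sets \<M>" using N by auto
  let ?A = "{x \<in> space \<M>. (gauss_map ^^ n) x \<in> N}"
  have "gauss.prob ?A = gauss.prob N"
    using gauss_invariant_set[of N n] by simp
  then have "emeasure \<M> ?A = 0"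
    using N by (simp add: gauss.emeasure_eq_measure null_sets_def)
  moreover have "{x \<in> space \<M>. \<not> P ((gauss_map ^^ n) x)} \<subseteq> ?A"
    using N(2) gauss_funpow_in[of _ n] by fastforce
  moreover have "?A \<in> sets \<M>" by measurable
  ultimately show ?thesis by (intro AE_I[of _ _ ?A])
qed

text \<open>For an invariant \<open>E\<close> the intersection may be read as \<open>I\<close> now
  and \<open>E\<close> after \<open>n\<close> steps. By duality the indicator of \<open>I\<close>,
  of variation 1, becomes its \<open>n\<close>-th iterate, which tends uniformly to the measure of
  \<open>I\<close>.\<close>

lemma mixing_interval:
  assumes E [measurable]: "E \<in> sets \<M>" and inv: "AE x in \<M>. x \<in> E \<longleftrightarrow> gauss_map x \<in> E"
  shows "gauss.prob ({..c} \<inter> E) = gauss.prob ({..c} \<inter> {0..1}) * gauss.prob E"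
proof -
  define I where "I = {..c} \<inter> {0..1::real}"
  have I [measurable]: "I \<in> sets \<M>" by (auto simp: I_def sets_gauss_iff)
  have b: "bvar (indicator I) 1" unfolding bvar_def
    by (rule exI[of _ "\<lambda>_. 0"], rule exI[of _ "\<lambda>x. - indicator I x"])
       (auto simp: I_def indicator_def mono_on_def)
  have eq: "AE x in \<M>. x \<in> E \<longleftrightarrow> (gauss_map ^^ n) x \<in> E" for n
  proof (induction n)
    case (Suc n) then show ?case using AE_funpow[OF inv, of n] by eventually_elim auto
  qed auto
  have EI: "E \<subseteq> {0..1}" using sets.sets_into_space[OF E] by simp
  have IE: "I \<inter> E = {..c} \<inter> E" using EI by (auto simp: I_def)
  have "\<bar>gauss.prob (I \<inter> E) - gauss.prob I * gauss.prob E\<bar> \<le> 1 / 2 ^ n" for n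
  proof -
    let ?f = "(transfer ^^ n) (indicator I)"
    have bf: "bvar ?f (1 / 2 ^ n)" using transfer_pow[OF b, of n] by auto
    note [measurable] = bvar_measurable[OF bf]
    have cl: "\<bar>?f x - gauss.prob I\<bar> \<le> 1 / 2 ^ n" if "x \<in> {0..1}" for x
      using transfer_pow_close[OF b _ that, of n] by (simp add: expectation_indicator[OF I] del: Bochner_Integration.integral_indicator)
    have "gauss.prob (I \<inter> E) = (LINT x|\<M>. indicator (I \<inter> E) x)"
      by (rule expectation_indicator[symmetric]) measurable
    also have "\<dots> = (LINT x|\<M>. indicator I x * indicator E ((gauss_map ^^ n) x))"
    proof (rule integral_cong_AE)
      show "AE x in \<M>. indicator (I \<inter> E) x = (indicator I x * indicator E ((gauss_map ^^ n) x) :: real)"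
        using eq[of n] by eventually_elim (auto simp: indicator_def)
    qed auto
    also have "\<dots> = (LINT x|\<M>. ?f x * indicator E x)"
      by (rule transfer_pow_duality[OF b]) auto
    finally have 1: "gauss.prob (I \<inter> E) = (LINT x|\<M>. ?f x * indicator E x)" .
    have i1: "integrable \<M> (\<lambda>x. ?f x * indicator E x)"
      by (rule bounded_integrable[where C="\<bar>?f 0\<bar> + 1 / 2 ^ n"])
         (use bvar_bounded[OF bf] in \<open>auto simp: indicator_def\<close>)
    have i2: "integrable \<M> (\<lambda>x. gauss.prob I * indicator E x)"
      by (rule bounded_integrable[where C=1]) (auto simp: indicator_def)
    have "gauss.prob (I \<inter> E) - gauss.prob I * gauss.prob E =
      (LINT x|\<M>. ?f x * indicator E x - gauss.prob I * indicator E x)"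
      using i1 i2 by (subst Bochner_Integration.integral_diff)
        (auto simp: 1 expectation_indicator[OF E] simp del: Bochner_Integration.integral_indicator)
    also have "\<bar>\<dots>\<bar> \<le> (LINT x|\<M>. 1 / 2 ^ n)"
    proof (rule integral_abs_bound[THEN order_trans], rule integral_mono)
      fix x assume "x \<in> space \<M>"
      then show "\<bar>?f x * indicator E x - gauss.prob I * indicator E x\<bar> \<le> 1 / 2 ^ n"
        using cl[of x] by (auto simp: indicator_def)
    qed (use i1 i2 in auto)
    also have "\<dots> = 1 / 2 ^ n" using gauss.prob_space by simp
    finally show ?thesis .
  qed
  moreover have "(\<lambda>n. 1 / 2 ^ n :: real) \<longlonglongrightarrow> 0" by real_asymp
  ultimately have "\<bar>gauss.prob (I \<inter> E) - gauss.prob I * gauss.prob E\<bar> \<le> 0"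
    by (intro LIMSEQ_le_const[of "\<lambda>n. 1 / 2 ^ n :: real"]) auto
  then show ?thesis by (simp add: IE) (simp add: I_def)
qed

text \<open>Half-lines are stable under intersection and generate the Borel sets, so independence of
  \<open>E\<close> from half-lines extends to independence from itself.\<close>

lemma gauss_zero_one:
  assumes E [measurable]: "E \<in> sets \<M>" and inv: "AE x in \<M>. x \<in> E \<longleftrightarrow> gauss_map x \<in> E"
  shows "gauss.prob E = 0 \<or> gauss.prob E = 1"
proof -
  have s: "A \<inter> {0..1} \<in> sets \<M>" "A \<inter> E \<in> sets \<M>" if "A \<in> sets borel" for A :: "real set"
    using that E by (auto simp: sets_gauss_iff)
  have sb: "sigma_sets UNIV (range (\<lambda>c::real. {..c})) = sets borel"
    by (subst borel_eq_atMost) (simp add: sets_measure_of)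
  have st: "Int_stable (range (\<lambda>c::real. {..c}))" "range (\<lambda>c::real. {..c}) \<subseteq> Pow UNIV"
    by (auto simp: Int_stable_def)
  have prod: "gauss.prob (A \<inter> E) = gauss.prob (A \<inter> {0..1}) * gauss.prob E"
    if "A \<in> sigma_sets UNIV (range (\<lambda>c::real. {..c}))" for A
    using st that
  proof (induction rule: sigma_sets_induct_disjoint)
    case (basic A) then show ?case using mixing_interval[OF E inv] by auto
  next
    case empty then show ?case by simp
  next
    case (compl A)
    then have A: "A \<in> sets borel" by (simp add: sb)
    have EI: "E \<subseteq> {0..1}" using sets.sets_into_space[OF E] by simp
    have "gauss.prob ((UNIV - A) \<inter> E) = gauss.prob (E - A \<inter> E)"
      by (rule arg_cong[where f="gauss.prob"]) auto
    also have "\<dots> = gauss.prob E - gauss.prob (A \<inter> E)"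
      by (rule gauss.finite_measure_Diff) (use s[OF A] in auto)
    also have "\<dots> = (1 - gauss.prob (A \<inter> {0..1})) * gauss.prob E"
      using compl by (simp add: algebra_simps)
    also have "1 - gauss.prob (A \<inter> {0..1}) = gauss.prob (space \<M> - A \<inter> {0..1})"
      by (rule gauss.prob_compl[symmetric]) (use s[OF A] in auto)
    also have "space \<M> - A \<inter> {0..1} = (UNIV - A) \<inter> {0..1}" by auto
    finally show ?case .
  next
    case (union A)
    then have A: "A i \<in> sets borel" for i by (auto simp: sb)
    have "(\<lambda>i. gauss.prob (A i \<inter> E)) sums gauss.prob (\<Union>i. A i \<inter> E)"
      by (rule gauss.finite_measure_UNION) (use union(1) s[OF A] in \<open>auto simp: disjoint_family_on_def\<close>)
    moreover have "(\<lambda>i. gauss.prob (A i \<inter> {0..1})) sums gauss.prob (\<Union>i. A i \<inter> {0..1})"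
      by (rule gauss.finite_measure_UNION) (use union(1) s[OF A] in \<open>auto simp: disjoint_family_on_def\<close>)
    then have "(\<lambda>i. gauss.prob (A i \<inter> E)) sums (gauss.prob (\<Union>i. A i \<inter> {0..1}) * gauss.prob E)"
      unfolding union(3) by (rule sums_mult2)
    ultimately have "gauss.prob (\<Union>i. A i \<inter> E) = gauss.prob (\<Union>i. A i \<inter> {0..1}) * gauss.prob E"
      by (rule sums_unique2)
    then show ?case by (simp only: UN_simps)
  qed
  have "E \<in> sigma_sets UNIV (range (\<lambda>c::real. {..c}))" using E by (simp add: sb sets_gauss_iff)
  moreover have "E \<inter> {0..1} = E" using sets.sets_into_space[OF E] by auto
  ultimately have "gauss.prob E = gauss.prob E * gauss.prob E"
    using prod[of E] by simp
  then show ?thesis by auto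
qed

text \<open>The preimage of \<open>E\<close> contains \<open>E\<close> up to a null set and has the
  same measure, so \<open>E\<close> is almost invariant.\<close>

lemma gauss_zero_one_sub:
  assumes E [measurable]: "E \<in> sets \<M>" and sub: "AE x in \<M>. x \<in> E \<longrightarrow> gauss_map x \<in> E"
  shows "gauss.prob E = 0 \<or> gauss.prob E = 1"
proof (rule gauss_zero_one[OF E])
  let ?P = "{x \<in> space \<M>. gauss_map x \<in> E}"
  have P [measurable]: "?P \<in> sets \<M>" by measurable
  have EI: "E \<subseteq> {0..1}" using sets.sets_into_space[OF E] by simp
  have "gauss.prob ?P = gauss.prob E"
    using gauss_invariant_set[OF E, of 1] by simp
  moreover have "gauss.prob (?P \<inter> E) = gauss.prob E"
  proof (rule gauss.finite_measure_eq_AE)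
    show "?P \<inter> E \<in> sets \<M>" by measurable
    show "AE x in \<M>. (x \<in> ?P \<inter> E) = (x \<in> E)"
      using sub EI by (auto elim!: eventually_mono)
  qed (rule E)
  moreover have "gauss.prob (?P - ?P \<inter> E) = gauss.prob ?P - gauss.prob (?P \<inter> E)"
    by (rule gauss.finite_measure_Diff[OF P sets.Int[OF P E]]) blast
  ultimately have "emeasure \<M> (?P - ?P \<inter> E) = 0"
    by (simp add: gauss.emeasure_eq_measure)
  then have "AE x in \<M>. x \<notin> ?P - ?P \<inter> E"
    by (intro AE_not_in null_setsI sets.Diff sets.Int P E)
  from this sub show "AE x in \<M>. x \<in> E \<longleftrightarrow> gauss_map x \<in> E"
    using AE_space by eventually_elim auto
qed

text \<open>\<open>2 ^ lvl k\<close> is the number of pieces of block \<open>k\<close>: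
  \<open>ln k\<close> rounded down to a power of two, so that it divides the length of the block.
  The memory window is \<open>g = lvl k + 1\<close>, the additional step ensuring
  \<open>2 ^ g \<ge> ln k\<close>.\<close>

definition lvl :: "nat \<Rightarrow> nat" where
  "lvl k = nat \<lfloor>log 2 (ln (real k))\<rfloor>"

lemma ln_ge_1: "k \<ge> 3 \<Longrightarrow> 1 \<le> ln (real k)"
  using exp_le by (subst ln_ge_iff) auto

lemma lvl_bounds:
  assumes "k \<ge> 3"
  shows "2 ^ lvl k \<le> ln (real k)" "ln (real k) < 2 * 2 ^ lvl k"
proof -
  have l: "ln (real k) \<ge> 1" using ln_ge_1[OF assms] .
  then have "log 2 (ln (real k)) \<ge> 0" by simp
  then have f: "real (lvl k) \<le> log 2 (ln (real k))" "log 2 (ln (real k)) < real (lvl k) + 1"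
    unfolding lvl_def by linarith+
  have "2 powr real (lvl k) \<le> 2 powr log 2 (ln (real k))" "2 powr log 2 (ln (real k)) < 2 powr (real (lvl k) + 1)"
    using f by (intro powr_mono powr_less_mono; simp)+
  then show "2 ^ lvl k \<le> ln (real k)" "ln (real k) < 2 * 2 ^ lvl k"
    using l by (auto simp: powr_realpow powr_add)
qed

text \<open>The radius is the largest one a ball of mass at most \<open>2 * ln k / 2 ^ k\<close> can have, since a ball of
  radius \<open>s \<le> 1\<close> has mass at least \<open>s / 2\<close>.\<close>

definition typical :: "real \<Rightarrow> bool" where
  "typical z \<longleftrightarrow> (\<forall>\<^sub>F k in sequentially.
     (\<Sum>t=1..lvl k + 1. return_mass z (4 * ln (real k) / 2 ^ k) t) \<le> 1 / 2 ^ k)"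

text \<open>A first moment bound. Integrated over the centre, the return masses are at most
  \<open>288 * 2 ^ t * s\<^sup>2\<close>; since \<open>2 ^ lvl k \<le> ln k\<close>, their sum
  multiplied by \<open>2 ^ k\<close> is at most \<open>288 * 16 * 4 = 18432\<close> times
  \<open>ln k ^ 3 / 2 ^ k\<close>, which is summable in \<open>k\<close>.\<close>

lemma AE_typical: "AE z in \<M>. typical z"
proof -
  define s where "s k = 4 * ln (real k) / 2 ^ k" for k :: nat
  define T where "T k z = 2 ^ k * (\<Sum>t=1..lvl k + 1. return_mass z (s k) t)" for k z
  have s0: "s k > 0" if "k \<ge> 3" for k using ln_ge_1[OF that] by (simp add: s_def)
  have T0: "0 \<le> T k z" for k z unfolding T_def return_mass_def by (intro mult_nonneg_nonneg sum_nonneg) auto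
  have Tm [measurable]: "T (k + 3) \<in> borel_measurable \<M>" for k
    unfolding T_def using s0 by (intro borel_measurable_times borel_measurable_sum return_mass_kernel) auto
  have int: "(\<integral>\<^sup>+z. ennreal (T k z) \<partial>\<M>) \<le> ennreal (18432 * ln (real k) ^ 3 / 2 ^ k)" if k: "k \<ge> 3" for k
  proof -
    note [measurable] = return_mass_kernel(1)[OF s0[OF k]]
    have "(\<integral>\<^sup>+z. ennreal (T k z) \<partial>\<M>) =
      (\<integral>\<^sup>+z. ennreal (2 ^ k) * (\<Sum>t=1..lvl k + 1. ennreal (return_mass z (s k) t)) \<partial>\<M>)"
      unfolding T_def by (intro nn_integral_cong, subst sum_ennreal) (auto simp: return_mass_def ennreal_mult sum_nonneg)
    also have "\<dots> = ennreal (2 ^ k) * (\<integral>\<^sup>+z. (\<Sum>t=1..lvl k + 1. ennreal (return_mass z (s k) t)) \<partial>\<M>)"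
      by (intro nn_integral_cmult borel_measurable_sum measurable_compose[OF return_mass_kernel(1)[OF s0[OF k]]]) auto
    also have "\<dots> = ennreal (2 ^ k) * (\<Sum>t=1..lvl k + 1. \<integral>\<^sup>+z. ennreal (return_mass z (s k) t) \<partial>\<M>)"
      by (subst nn_integral_sum) (auto intro!: measurable_compose[OF return_mass_kernel(1)[OF s0[OF k]]])
    also have "\<dots> \<le> ennreal (2 ^ k) * (\<Sum>t=1..lvl k + 1. ennreal (288 * 2 ^ t * (s k)\<^sup>2))"
      using s0[OF k] by (intro mult_left_mono sum_mono return_mass_kernel) auto
    also have "\<dots> = ennreal (2 ^ k * (\<Sum>t=1..lvl k + 1. 288 * 2 ^ t * (s k)\<^sup>2))"
      by (subst sum_ennreal) (auto simp: ennreal_mult sum_nonneg)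
    also have "\<dots> \<le> ennreal (18432 * ln (real k) ^ 3 / 2 ^ k)"
    proof (rule ennreal_leI)
      have "(\<Sum>t=1..n. 2 ^ t) \<le> (2 * 2 ^ n :: real)" for n by (induction n) auto
      from this[of "lvl k + 1"] have g: "(\<Sum>t=1..lvl k + 1. 2 ^ t) \<le> 4 * ln (real k)"
        using lvl_bounds(1)[OF k] by simp
      have "2 ^ k * (\<Sum>t=1..lvl k + 1. 288 * 2 ^ t * (s k)\<^sup>2) = 2 ^ k * (288 * (s k)\<^sup>2) * (\<Sum>t=1..lvl k + 1. 2 ^ t)"
        by (simp only: sum_distrib_left ac_simps)
      also have "\<dots> \<le> 2 ^ k * (288 * (s k)\<^sup>2) * (4 * ln (real k))"
        by (intro mult_left_mono g) auto
      also have "\<dots> = 18432 * ln (real k) ^ 3 / 2 ^ k"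
        by (simp add: s_def power2_eq_square power3_eq_cube divide_simps)
      finally show "2 ^ k * (\<Sum>t=1..lvl k + 1. 288 * 2 ^ t * (s k)\<^sup>2) \<le> 18432 * ln (real k) ^ 3 / 2 ^ k" .
    qed
    finally show ?thesis .
  qed
  have sm: "summable (\<lambda>k. 18432 * ln (real (k + 3)) ^ 3 / 2 ^ (k + 3))"
  proof (rule summable_comparison_test_bigo)
    show "summable (\<lambda>n. norm (1 / real n ^ 2))"
      using inverse_power_summable[of 2, where ?'a=real] by (simp add: field_simps)
    show "(\<lambda>k. 18432 * ln (real (k + 3)) ^ 3 / 2 ^ (k + 3)) \<in> O(\<lambda>n. 1 / real n ^ 2)"
      by real_asymp
  qed
  have "(\<integral>\<^sup>+z. (\<Sum>k. ennreal (T (k + 3) z)) \<partial>\<M>) = (\<Sum>k. \<integral>\<^sup>+z. ennreal (T (k + 3) z) \<partial>\<M>)"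
    by (rule nn_integral_suminf) measurable
  also have "\<dots> \<le> (\<Sum>k. ennreal (18432 * ln (real (k + 3)) ^ 3 / 2 ^ (k + 3)))"
    by (intro suminf_le int) auto
  also have "\<dots> = ennreal (\<Sum>k. 18432 * ln (real (k + 3)) ^ 3 / 2 ^ (k + 3))"
    using sm by (intro suminf_ennreal2) auto
  finally have "(\<integral>\<^sup>+z. (\<Sum>k. ennreal (T (k + 3) z)) \<partial>\<M>) \<noteq> \<infinity>"
    by (auto simp: top_unique)
  then have "AE z in \<M>. (\<Sum>k. ennreal (T (k + 3) z)) \<noteq> \<infinity>"
    by (intro nn_integral_PInf_AE) auto
  then show ?thesis
  proof eventually_elim
    case (elim z)
    then have "summable (\<lambda>k. T (k + 3) z)" by (intro summable_suminf_not_top T0) auto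
    then have "(\<lambda>k. T k z) \<longlonglongrightarrow> 0" by (rule LIMSEQ_offset[where k=3, OF summable_LIMSEQ_zero])
    then have "\<forall>\<^sub>F k in sequentially. T k z < 1" by (rule order_tendstoD) simp
    then show "typical z" unfolding typical_def
    proof eventually_elim
      case (elim k)
      have "2 ^ k * (\<Sum>t=1..lvl k + 1. return_mass z (s k) t) \<le> 1" using elim unfolding T_def by linarith
      then show ?case unfolding s_def[symmetric] by (simp only: pos_le_divide_eq zero_less_power zero_less_numeral mult.commute)
    qed
  qed
qed

section \<open>Blocks of times\<close>

text \<open>The balls of mass \<open>w / n\<close> with \<open>w\<close> between \<open>ln k\<close>
  and \<open>2 * ln k\<close> and \<open>n\<close> in the closed block from \<open>2 ^ k\<close> to
  \<open>2 ^ (k + 1)\<close> fall in this range.\<close>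

definition block_ball :: "real \<Rightarrow> nat \<Rightarrow> real \<Rightarrow> bool" where
  "block_ball z k r \<longleftrightarrow> 0 < r \<and> ln (real k) / 2 ^ (k + 1) \<le> ball_mass z r \<and> ball_mass z r \<le> 2 * ln (real k) / 2 ^ k"

text \<open>Survival is exponential up to constants while the expected number of visits is at most
  \<open>4 * ln k\<close>. The upper bound allows an arbitrary past before time \<open>m\<close>, as
  correlations of two times require; the lower bound starts at time 0.\<close>

definition controlled :: "real \<Rightarrow> nat \<Rightarrow> bool" where
  "controlled z k \<longleftrightarrow> 3 \<le> k \<and> (\<forall>r. block_ball z k r \<longrightarrow> ball_mass z r \<le> 1 / 100 \<and>
     (\<forall>\<rho> m n. (\<forall>t. ball_mass z (\<rho> t) \<le> 1 / 100) \<longrightarrow> m \<le> n \<longrightarrow> (\<forall>t. m \<le> t \<longrightarrow> t < n \<longrightarrow> \<rho> t = r) \<longrightarrow>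
        real (n - m) * ball_mass z r \<le> 4 * ln (real k) \<longrightarrow>
        surv z \<rho> n \<le> exp 61 * surv z \<rho> m * exp (- (real (n - m) * ball_mass z r))) \<and>
     (\<forall>n. real n * ball_mass z r \<le> 4 * ln (real k) \<longrightarrow>
        exp (- (real n * ball_mass z r)) \<le> 2 * exp 60 * surv z (\<lambda>_. r) n))"

lemma return_mass_mono: "r \<le> s \<Longrightarrow> return_mass z r t \<le> return_mass z s t"
  unfolding return_mass_def
  by (intro gauss.finite_measure_mono return_set_sets) (auto simp: unit_ball_def)

text \<open>With \<open>l = ln k\<close>, the term \<open>8 / 2 ^ g\<close> is at most
  \<open>8 / l\<close> and typical returns contribute at most \<open>6.6 / l\<close>, so the
  relative error is at most \<open>15 / l\<close>. Over at most \<open>4 * l\<close> expected visits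
  this changes the exponent by at most 60; the upper bound also pays
  \<open>g * \<mu> \<le> 1\<close>.\<close>

lemma typical_controlled:
  assumes z: "z \<in> {0..1}" and ty: "typical z"
  shows "\<forall>\<^sub>F k in sequentially. controlled z k"
proof -
  have e1: "\<forall>\<^sub>F k :: nat in sequentially. 348 * (2 * ln (real k)) * (2 * ln (real k) / 2 ^ k) \<le> 1 / ln (real k)"
    by real_asymp
  have e2: "\<forall>\<^sub>F k :: nat in sequentially. 2 * ln (real k) * (2 * ln (real k) / 2 ^ k) \<le> 1 / 100"
    by real_asymp
  show ?thesis
    using ty[unfolded typical_def] e1 e2 eventually_ge_at_top[of 3]
  proof eventually_elim
    case (elim k)
    define l where "l = ln (real k)"
    have l1: "1 \<le> l" using ln_ge_1 elim by (simp add: l_def)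
    define g where "g = lvl k + 1"
    have "real (lvl k) < 2 ^ lvl k" using of_nat_less_two_power[where 'a=real] by simp
    then have g2: "real g \<le> 2 * l" using lvl_bounds[OF elim(4)] l1 unfolding g_def l_def by linarith
    have pg: "l \<le> 2 ^ g" using lvl_bounds[OF elim(4)] by (simp add: g_def l_def)
    have e8: "8 / 2 ^ g \<le> 8 / l" using pg l1 by (intro divide_left_mono) auto
    show "controlled z k" unfolding controlled_def
    proof (intro conjI allI impI elim(4))
      fix r assume "block_ball z k r"
      define \<mu> where "\<mu> = ball_mass z r"
      have r: "0 < r" and \<mu>: "l / 2 ^ (k + 1) \<le> \<mu>" "\<mu> \<le> 2 * l / 2 ^ k"
        using \<open>block_ball z k r\<close> by (auto simp: block_ball_def \<mu>_def l_def)
      have \<mu>0: "0 < \<mu>" using \<mu>(1) l1 by (smt (verit) divide_pos_pos zero_less_power)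
      have g\<mu>: "real g * \<mu> \<le> 2 * l * (2 * l / 2 ^ k)" using g2 \<mu> \<mu>0 l1 by (intro mult_mono) auto
      then have g\<mu>1: "real g * \<mu> \<le> 1 / 100" using elim(3) unfolding l_def by linarith
      have "1 * \<mu> \<le> real g * \<mu>" using \<mu>0 by (intro mult_right_mono) (auto simp: g_def)
      then have small: "\<mu> \<le> 1 / 100" using g\<mu>1 by simp
      then show "ball_mass z r \<le> 1 / 100" by (simp add: \<mu>_def)
      have r1: "r \<le> 1"
      proof (rule ccontr)
        assume "\<not> r \<le> 1"
        then have "ball_mass z 1 \<le> \<mu>" unfolding \<mu>_def by (intro ball_mass_mono) auto
        then show False using ball_mass_ge[OF z, of 1] small by simp
      qed
      have "r \<le> 4 * l / 2 ^ k" using ball_mass_ge[OF z _ r1] r \<mu>(2) by (simp add: \<mu>_def)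
      then have "(\<Sum>t=1..g. return_mass z r t) \<le> (\<Sum>t=1..g. return_mass z (4 * l / 2 ^ k) t)"
        by (intro sum_mono return_mass_mono)
      also have "\<dots> \<le> 1 / 2 ^ k" using elim(1) by (simp add: l_def g_def)
      finally have R: "(\<Sum>t=1..g. return_mass z r t) \<le> 1 / 2 ^ k" .
      have "33 / 10 * (\<Sum>t=1..g. return_mass z r t) / \<mu> \<le> 33 / 10 * (1 / 2 ^ k) / (l / 2 ^ (k + 1))"
        using R \<mu> \<mu>0 l1 by (intro frac_le mult_left_mono) auto
      also have "\<dots> \<le> 7 / l" using l1 by (simp add: field_simps)
      also have "7 / l = 15 / l - 8 / l" by (simp add: diff_divide_distrib[symmetric])
      finally have \<eta>: "8 / 2 ^ g + 33 / 10 * (\<Sum>t=1..g. return_mass z r t) / \<mu> \<le> 15 / l"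
        using e8 by linarith
      have d4: "a * (15 / l) \<le> 60" if "a \<le> 4 * l" for a
        using that l1 by (simp add: field_simps)
      { fix \<rho> m n
        assume A: "\<forall>t. ball_mass z (\<rho> t) \<le> 1 / 100" "m \<le> n" "\<forall>t. m \<le> t \<longrightarrow> t < n \<longrightarrow> \<rho> t = r"
          "real (n - m) * ball_mass z r \<le> 4 * ln (real k)"
        let ?\<eta> = "8 / 2 ^ g + 33 / 10 * (\<Sum>t=1..g. return_mass z r t) / \<mu>"
        have "surv z \<rho> n \<le> surv z \<rho> m * exp (real g * \<mu> + real (n - m) * \<mu> * ?\<eta> - real (n - m) * \<mu>)"
          unfolding \<mu>_def by (rule surv_upper) (use A \<mu>0 \<mu>_def in auto)
        also have "\<dots> \<le> surv z \<rho> m * exp (61 - real (n - m) * \<mu>)"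
        proof (intro mult_left_mono surv_nonneg, subst exp_le_cancel_iff)
          have "real (n - m) * \<mu> * ?\<eta> \<le> real (n - m) * \<mu> * (15 / l)"
            using \<eta> \<mu>0 by (intro mult_left_mono) auto
          also have "\<dots> \<le> 60" by (rule d4) (use A in \<open>simp add: \<mu>_def l_def\<close>)
          finally show "real g * \<mu> + real (n - m) * \<mu> * ?\<eta> - real (n - m) * \<mu> \<le> 61 - real (n - m) * \<mu>"
            using g\<mu>1 by linarith
        qed
        finally show "surv z \<rho> n \<le> exp 61 * surv z \<rho> m * exp (- (real (n - m) * ball_mass z r))"
          by (simp add: \<mu>_def exp_diff exp_minus field_simps)
      }
      fix n assume A: "real n * ball_mass z r \<le> 4 * ln (real k)"
      have "exp (- (real n * \<mu> * (1 + 348 * (real g * \<mu>) + 8 / 2 ^ g))) / 2 \<le> surv z (\<lambda>_. r) n"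
        unfolding \<mu>_def by (rule surv_lower) (use g\<mu>1 in \<open>auto simp: g_def \<mu>_def\<close>)
      moreover have "exp (- (real n * \<mu>) - 60) \<le> exp (- (real n * \<mu> * (1 + 348 * (real g * \<mu>) + 8 / 2 ^ g)))"
      proof (subst exp_le_cancel_iff)
        have "348 * (real g * \<mu>) \<le> 1 / l" using g\<mu> elim(2) by (simp add: l_def)
        moreover have "1 / l + 8 / l \<le> 15 / l" using l1 by (simp add: add_divide_distrib[symmetric] divide_right_mono)
        ultimately have "348 * (real g * \<mu>) + 8 / 2 ^ g \<le> 15 / l" using e8 by linarith
        then have "real n * \<mu> * (348 * (real g * \<mu>) + 8 / 2 ^ g) \<le> real n * \<mu> * (15 / l)"
          using \<mu>0 by (intro mult_left_mono) auto
        also have "\<dots> \<le> 60" by (rule d4) (use A in \<open>simp add: \<mu>_def l_def\<close>)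
        finally show "- (real n * \<mu>) - 60 \<le> - (real n * \<mu> * (1 + 348 * (real g * \<mu>) + 8 / 2 ^ g))"
          by (simp add: algebra_simps)
      qed
      ultimately have "exp (- (real n * \<mu>) - 60) \<le> 2 * surv z (\<lambda>_. r) n" by linarith
      then have "exp (- (real n * \<mu>) - 60) * exp 60 \<le> 2 * surv z (\<lambda>_. r) n * exp 60"
        by (intro mult_right_mono) auto
      then show "exp (- (real n * ball_mass z r)) \<le> 2 * exp 60 * surv z (\<lambda>_. r) n"
        by (simp add: \<mu>_def ac_simps flip: exp_add)
    qed
  qed
qed

text \<open>The equally spaced points dividing block \<open>k\<close> into \<open>2 ^ lvl k\<close>
  pieces. The truncated subtraction is harmless for \<open>k \<ge> 3\<close> by
  \<open>lvl_le\<close>.\<close>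

definition pt :: "nat \<Rightarrow> nat \<Rightarrow> nat" where
  "pt k i = 2 ^ (k - lvl k) * (2 ^ lvl k + i)"

lemma lvl_le: assumes "k \<ge> 3" shows "lvl k \<le> k"
proof -
  have "(2::real) ^ lvl k \<le> ln (real k)" using lvl_bounds[OF assms] by simp
  also have "\<dots> \<le> real k" using assms ln_le_minus_one[of "real k"] by simp
  also have "\<dots> \<le> 2 ^ k" using of_nat_less_two_power[of k, where 'a=real] by simp
  finally show ?thesis by simp
qed

lemma pt_0: "k \<ge> 3 \<Longrightarrow> pt k 0 = 2 ^ k"
  using lvl_le by (simp add: pt_def flip: power_add)

lemma pt_top: "k \<ge> 3 \<Longrightarrow> pt k (2 ^ lvl k) = 2 ^ (k + 1)"
  using lvl_le by (simp add: pt_def flip: power_add mult_2)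

lemma pt_mono: "i \<le> j \<Longrightarrow> pt k i \<le> pt k j"
  by (simp add: pt_def)

lemma pt_strict_mono: "i < j \<Longrightarrow> pt k i < pt k j"
  by (simp add: pt_def)

lemma pt_bounds: "k \<ge> 3 \<Longrightarrow> i \<le> 2 ^ lvl k \<Longrightarrow> 2 ^ k \<le> pt k i \<and> pt k i \<le> 2 ^ (k + 1)"
  using pt_mono[of 0 i k] pt_mono[of i "2 ^ lvl k" k] by (simp add: pt_0 pt_top)

lemma pt_pos: "0 < pt k i"
  by (simp add: pt_def)

lemma pt_diff: "real (pt k j) - real (pt k i) = 2 ^ (k - lvl k) * (real j - real i)"
  by (simp add: pt_def algebra_simps)

lemma pt_gap: "k \<ge> 3 \<Longrightarrow> 2 ^ lvl k * (real (pt k (Suc i)) - real (pt k i)) = 2 ^ k"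
  using lvl_le[of k] by (simp add: pt_diff flip: power_add)

lemma real_pt_bounds:
  assumes "k \<ge> 3" "i \<le> 2 ^ lvl k" shows "2 ^ k \<le> real (pt k i) \<and> real (pt k i) \<le> 2 ^ (k + 1)"
proof -
  have "real (2 ^ k) \<le> real (pt k i)" "real (pt k i) \<le> real (2 ^ (k + 1))"
    using pt_bounds[OF assms] by (intro of_nat_mono; simp)+
  then show ?thesis by simp
qed

lemma pt_cover:
  assumes k: "k \<ge> 3" "2 ^ k \<le> m" "m < 2 ^ (k + 1)"
  obtains i where "i < 2 ^ lvl k" "pt k i \<le> m" "m < pt k (Suc i)"
proof -
  define h where "h = (2::nat) ^ (k - lvl k)"
  have h: "h > 0" "h * 2 ^ lvl k = 2 ^ k" using lvl_le[OF k(1)] by (auto simp: h_def simp flip: power_add)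
  define i where "i = m div h - 2 ^ lvl k"
  have "2 ^ lvl k \<le> m div h"
    using div_le_mono[OF k(2), of h] h by (metis nonzero_mult_div_cancel_left less_irrefl)
  then have d: "m div h = 2 ^ lvl k + i" by (simp add: i_def)
  have "m div h < 2 * 2 ^ lvl k"
    using k(3) h by (subst div_less_iff_less_mult) (auto simp: ac_simps)
  then have "i < 2 ^ lvl k" using d by simp
  moreover have "pt k i \<le> m" unfolding pt_def h_def[symmetric] d[symmetric] by simp
  moreover have "m < pt k (Suc i)"
    unfolding pt_def h_def[symmetric] add_Suc_right d[symmetric] using h(1)
    by (metis dividend_less_times_div mult_Suc_right)
  ultimately show ?thesis using that by blast
qed

lemma sum_blocks:
  fixes f :: "nat \<Rightarrow> real"
  assumes "k \<ge> 3"
  shows "(\<Sum>i<2 ^ lvl k. \<Sum>n\<in>{pt k i<..pt k (Suc i)}. f n) = (\<Sum>n\<in>{2 ^ k<..2 ^ (k + 1)}. f n)"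
    and "(\<Sum>i<2 ^ lvl k. \<Sum>n\<in>{pt k i..<pt k (Suc i)}. f n) = (\<Sum>n\<in>{2 ^ k..<2 ^ (k + 1)}. f n)"
proof -
  have "(\<Sum>i<N. \<Sum>n\<in>{pt k i<..pt k (Suc i)}. f n) = (\<Sum>n\<in>{pt k 0<..pt k N}. f n)" for N
  proof (induction N)
    case (Suc N)
    have "{pt k 0<..pt k (Suc N)} = {pt k 0<..pt k N} \<union> {pt k N<..pt k (Suc N)}"
      using pt_mono[of 0 N k] pt_mono[of N "Suc N" k] by auto
    then show ?case using Suc by (simp add: sum.union_disjoint)
  qed simp
  from this[of "2 ^ lvl k"] show "(\<Sum>i<2 ^ lvl k. \<Sum>n\<in>{pt k i<..pt k (Suc i)}. f n) = (\<Sum>n\<in>{2 ^ k<..2 ^ (k + 1)}. f n)"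
    using assms by (simp add: pt_0 pt_top)
  have "(\<Sum>i<N. \<Sum>n\<in>{pt k i..<pt k (Suc i)}. f n) = (\<Sum>n\<in>{pt k 0..<pt k N}. f n)" for N
  proof (induction N)
    case (Suc N)
    have "{pt k 0..<pt k (Suc N)} = {pt k 0..<pt k N} \<union> {pt k N..<pt k (Suc N)}"
      using pt_mono[of 0 N k] pt_mono[of N "Suc N" k] by auto
    then show ?case using Suc by (simp add: sum.union_disjoint)
  qed simp
  from this[of "2 ^ lvl k"] show "(\<Sum>i<2 ^ lvl k. \<Sum>n\<in>{pt k i..<pt k (Suc i)}. f n) = (\<Sum>n\<in>{2 ^ k..<2 ^ (k + 1)}. f n)"
    using assms by (simp add: pt_0 pt_top)
qed

lemma dyadic_sums:
  fixes f :: "nat \<Rightarrow> real"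
  assumes "K \<le> M"
  shows "(\<Sum>k=K..<M. \<Sum>n\<in>{2 ^ k<..2 ^ (k + 1)}. f n) = (\<Sum>n\<in>{2 ^ K<..2 ^ M}. f n)"
    and "(\<Sum>k=K..<M. \<Sum>n\<in>{2 ^ k..<2 ^ (k + 1)}. f n) = (\<Sum>n\<in>{2 ^ K..<2 ^ M}. f n)"
  using assms
proof (induction M rule: dec_induct)
  case (step M)
  have p: "(2::nat) ^ K \<le> 2 ^ M" "(2::nat) ^ M \<le> 2 ^ Suc M" using step by (auto intro: power_increasing)
  { case 1
    have "a \<le> b \<Longrightarrow> b \<le> c \<Longrightarrow> {a<..c} = {a<..b} \<union> {b<..c}" for a b c :: nat by auto
    from this[OF p] have "{2 ^ K<..2 ^ Suc M} = {2 ^ K<..2 ^ M} \<union> {2 ^ M<..2 ^ Suc M :: nat}" .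
    then show ?case using step by (simp add: sum.union_disjoint) }
  { case 2
    have "a \<le> b \<Longrightarrow> b \<le> c \<Longrightarrow> {a..<c} = {a..<b} \<union> {b..<c}" for a b c :: nat by auto
    from this[OF p] have "{2 ^ K..<2 ^ Suc M} = {2 ^ K..<2 ^ M} \<union> {2 ^ M..<2 ^ Suc M :: nat}" .
    then show ?case using step by (simp add: sum.union_disjoint) }
qed auto

lemma dyadic_harmonic:
  assumes "K \<le> M" shows "real (M - K) / 2 \<le> (\<Sum>n\<in>{2 ^ K<..2 ^ M}. 1 / real n)"
proof -
  have "(1 / 2 :: real) \<le> (\<Sum>n\<in>{2 ^ k<..2 ^ (k + 1)}. 1 / real n)" for k
  proof -
    have "(\<Sum>n\<in>{2 ^ k<..2 ^ (k + 1) :: nat}. 1 / 2 ^ (k + 1) :: real) \<le> (\<Sum>n\<in>{2 ^ k<..2 ^ (k + 1)}. 1 / real n)"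
    proof (intro sum_mono divide_left_mono)
      fix n :: nat assume n: "n \<in> {2 ^ k<..2 ^ (k + 1)}"
      then have "real n \<le> real (2 ^ (k + 1))" by (intro of_nat_mono) auto
      then show "real n \<le> 2 ^ (k + 1)" by simp
      show "0 < 2 ^ (k + 1) * real n" using n by (intro mult_pos_pos) (auto intro: Nat.gr0I)
    qed auto
    then show ?thesis by simp
  qed
  then have "(\<Sum>k=K..<M. 1 / 2 :: real) \<le> (\<Sum>k=K..<M. \<Sum>n\<in>{2 ^ k<..2 ^ (k + 1)}. 1 / real n)"
    by (intro sum_mono)
  then show ?thesis using dyadic_sums(1)[OF assms, of "\<lambda>n. 1 / real n"] by simp
qed

lemma x_exp_antimono:
  fixes x y :: real
  assumes "1 \<le> x" "x \<le> y" shows "y * exp (- y) \<le> x * exp (- x)"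
proof (rule DERIV_nonpos_imp_nonincreasing[OF assms(2), of "\<lambda>x. x * exp (- x)"])
  fix u assume "x \<le> u" "u \<le> y"
  then have "(1 - u) * exp (- u) \<le> 0" using assms by (intro mult_nonpos_nonneg) auto
  moreover have "((\<lambda>x. x * exp (- x)) has_real_derivative (1 - u) * exp (- u)) (at u)"
    by (auto intro!: derivative_eq_intros simp: algebra_simps)
  ultimately show "\<exists>D. ((\<lambda>x. x * exp (- x)) has_real_derivative D) (at u) \<and> D \<le> 0" by blast
qed

section \<open>Convergence of the series\<close>

lemma two_ln_less: assumes "k \<ge> 3" shows "2 * ln (real k) < 2 ^ k"
proof -
  have "2 * k \<le> 2 ^ k" using assms by (induction k rule: dec_induct) auto
  then have "real (2 * k) \<le> real (2 ^ k)" by (rule of_nat_mono)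
  then show ?thesis using ln_le_minus_one[of "real k"] assms by simp
qed

lemma exp_minus_two_ln: "k > 0 \<Longrightarrow> exp (- (2 * ln (real k))) = 1 / real k ^ 2"
  by (simp add: exp_minus exp_double inverse_eq_divide)

lemma summable_ln_over_square: "summable (\<lambda>k. C * ln (real k) / real k ^ 2)"
proof (rule summable_comparison_test_bigo)
  show "summable (\<lambda>n. norm (real n powr (- 3 / 2)))"
    by (simp add: summable_real_powr_iff)
  show "(\<lambda>k. C * ln (real k) / real k ^ 2) \<in> O(\<lambda>n. real n powr (- 3 / 2))"
    by real_asymp
qed

lemma sum_power_le_geometric:
  fixes q :: real and f :: "nat \<Rightarrow> nat"
  assumes "0 < q" "q < 1" "finite X" "inj_on f X"
  shows "(\<Sum>x\<in>X. q ^ f x) \<le> 1 / (1 - q)"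
proof -
  have "(\<Sum>x\<in>X. q ^ f x) = (\<Sum>n\<in>f ` X. q ^ n)" using assms(4) by (simp add: sum.reindex)
  also have "\<dots> \<le> (\<Sum>n. q ^ n)" using assms by (intro sum_le_suminf summable_geometric) auto
  also have "\<dots> = 1 / (1 - q)" using assms by (intro suminf_geometric) auto
  finally show ?thesis .
qed

locale shrinking_target =
  fixes r :: "nat \<Rightarrow> real" and z :: real
  assumes z: "z \<in> {0..1}" and typical: "typical z"
    and r_pos: "\<And>n. 1 \<le> n \<Longrightarrow> 0 < r n"
    and r_noninc: "\<And>m n. 1 \<le> m \<Longrightarrow> m \<le> n \<Longrightarrow> r n \<le> r m"
    and r_lim: "r \<longlonglongrightarrow> 0"
    and load_mono': "\<And>m n. 1 \<le> m \<Longrightarrow> m \<le> n \<Longrightarrow>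
      real m * ball_mass z (r m) \<le> real n * ball_mass z (r n)"
begin

definition load :: "nat \<Rightarrow> real" where
  "load n = real n * ball_mass z (r n)"

text \<open>The summand of the Robbins-Siegmund criterion for independent trials.\<close>

definition rs_term :: "nat \<Rightarrow> real" where
  "rs_term n = ball_mass z (r n) * exp (- load n)"

definition hit :: "nat \<Rightarrow> real \<Rightarrow> bool" where
  "hit n x \<longleftrightarrow> (\<exists>k<n. (gauss_map ^^ k) x \<in> unit_ball z (r n))"

lemma load_mono: "1 \<le> m \<Longrightarrow> m \<le> n \<Longrightarrow> load m \<le> load n"
  unfolding load_def by (rule load_mono')

lemma rs_term_nonneg: "0 \<le> rs_term n"
  by (simp add: rs_term_def)

lemma rs_term_eq: "n \<ge> 1 \<Longrightarrow> rs_term n = load n * exp (- load n) / real n"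
  by (simp add: rs_term_def load_def)

lemma mem_ev_always_hit: "x \<in> ev_always_hit r z \<longleftrightarrow> x \<in> {0..1} \<and> (\<forall>\<^sub>F m in sequentially. hit m x)"
proof
  assume "x \<in> ev_always_hit r z"
  then obtain n where n: "\<forall>m\<in>{n..}. x \<in> (\<Union>k\<in>{..<m}. {x \<in> {0..1}. (gauss_map ^^ k) x \<in> unit_ball z (r m)})"
    unfolding ev_always_hit_def by blast
  then have "\<forall>m\<ge>n. x \<in> {0..1} \<and> hit m x" by (auto simp: hit_def)
  then show "x \<in> {0..1} \<and> (\<forall>\<^sub>F m in sequentially. hit m x)"
    unfolding eventually_sequentially by blast
next
  assume a: "x \<in> {0..1} \<and> (\<forall>\<^sub>F m in sequentially. hit m x)"
  then obtain N where "\<And>m. m \<ge> N \<Longrightarrow> hit m x" by (auto simp: eventually_sequentially)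
  then show "x \<in> ev_always_hit r z"
    unfolding ev_always_hit_def hit_def using a
    by (intro UN_I[of "max 1 N"]) (auto, blast)
qed

text \<open>The event is forward invariant away from the centre: once \<open>r m\<close> is smaller
  than the distance of \<open>x\<close> to \<open>z\<close>, a hit cannot happen at time 0, so it is
  a hit of \<open>gauss_map x\<close> one step earlier.\<close>

lemma ev_always_hit_zero_one:
  "gauss.prob (ev_always_hit r z) = 0 \<or> gauss.prob (ev_always_hit r z) = 1"
proof (rule gauss_zero_one_sub[OF sets_ev_always_hit])
  show "AE x in \<M>. x \<in> ev_always_hit r z \<longrightarrow> gauss_map x \<in> ev_always_hit r z"
    using gauss_AE_neq[of z]
  proof eventually_elim
    case (elim x)
    show ?case
    proof
      assume x: "x \<in> ev_always_hit r z"
      have "\<forall>\<^sub>F m in sequentially. r m < \<bar>z - x\<bar>"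
        using r_lim elim by (intro order_tendstoD) auto
      moreover have "\<forall>\<^sub>F m in sequentially. hit m x" using x by (simp add: mem_ev_always_hit)
      ultimately have "\<forall>\<^sub>F m in sequentially. hit m (gauss_map x)"
      proof eventually_elim
        case (elim m)
        then obtain k where k: "k < m" "(gauss_map ^^ k) x \<in> unit_ball z (r m)" by (auto simp: hit_def)
        then have "k \<noteq> 0" using elim by (cases "k = 0") (auto simp: unit_ball_def)
        then obtain j where "k = Suc j" by (cases k) auto
        then show ?case using k unfolding hit_def by (intro exI[of _ j]) (auto simp: funpow_swap1)
      qed
      then show "gauss_map x \<in> ev_always_hit r z"
        using gauss_map_in by (simp only: mem_ev_always_hit)
    qed
  qed
qed

text \<open>A monotone load that does not tend to infinity is bounded, and then
  \<open>rs_term\<close> is comparable to the mass of the ball.\<close>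

lemma load_at_top:
  assumes "summable rs_term" "\<not> summable (\<lambda>n. ball_mass z (r n))"
  shows "\<forall>\<^sub>F n in sequentially. C \<le> load n"
proof (rule ccontr)
  assume "\<not> (\<forall>\<^sub>F n in sequentially. C \<le> load n)"
  then have f: "\<forall>N. \<exists>n\<ge>N. load n < C" by (auto simp: eventually_sequentially not_le)
  have C: "load n \<le> C" if "n \<ge> 1" for n
    using f[rule_format, of n] load_mono[OF that] by (meson less_imp_le order_trans)
  have "summable (\<lambda>n. exp C * rs_term n)" using assms(1) by (rule summable_mult)
  then have "summable (\<lambda>n. ball_mass z (r n))"
  proof (rule summable_comparison_test'[where N=1])
    fix n :: nat assume "n \<ge> 1"
    then have "1 \<le> exp C * exp (- load n)" using C by (simp flip: exp_add)
    then have "1 * ball_mass z (r n) \<le> exp C * exp (- load n) * ball_mass z (r n)"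
      by (intro mult_right_mono) auto
    then show "norm (ball_mass z (r n)) \<le> exp C * rs_term n" by (simp add: rs_term_def ac_simps)
  qed
  then show False using assms(2) by simp
qed

text \<open>On the range where \<open>load\<close> is at least 1,
  \<open>load n * exp (- load n)\<close> is smallest at the right end, where \<open>load\<close> is
  \<open>v\<close>. So \<open>rs_term\<close> sums to at least \<open>v * exp (- v)\<close> times a
  harmonic sum of order \<open>K\<close>, and boundedness by \<open>T\<close> forces
  \<open>exp v \<ge> K\<close>.\<close>

lemma load_ge_ln:
  assumes "summable rs_term" "\<not> summable (\<lambda>n. ball_mass z (r n))"
  shows "\<forall>\<^sub>F K in sequentially. ln (real K) \<le> load (2 ^ K)"
proof -
  define T where "T = suminf rs_term"
  \<comment> \<open>The bound 1 puts the loads where \<open>x * exp (- x)\<close> decreases;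
    \<open>4 * T\<close> lets \<open>T\<close> be replaced by \<open>v / 4\<close>, after which
    \<open>v\<close> cancels.\<close>
  obtain N where N: "\<And>n. n \<ge> N \<Longrightarrow> max 1 (4 * T) \<le> load n"
    using load_at_top[OF assms, of "max 1 (4 * T)"] by (auto simp: eventually_sequentially)
  define K' where "K' = max 1 N"
  have K'N: "2 ^ K' \<ge> N" 
  proof -
    have "N \<le> K'" by (simp add: K'_def)
    then show ?thesis using less_exp[of K'] by linarith
  qed
  show ?thesis unfolding eventually_sequentially
  proof (intro exI[of _ "2 * K'"] allI impI)
    fix K assume K: "2 * K' \<le> K"
    define v where "v = load (2 ^ K)"
    have v: "1 \<le> v" "4 * T \<le> v" 
    proof -
      have "(2::nat) ^ K' \<le> 2 ^ K" using K by (intro power_increasing) auto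
      then have "N \<le> 2 ^ K" using K'N by linarith
      from N[OF this] show "1 \<le> v" "4 * T \<le> v" by (auto simp: v_def)
    qed
    have "real K / 4 * (v * exp (- v)) \<le> real (K - K') / 2 * (v * exp (- v))"
      using K v by (intro mult_right_mono) auto
    also have "\<dots> \<le> (\<Sum>n\<in>{2 ^ K'<..2 ^ K}. 1 / real n) * (v * exp (- v))"
      using K v by (intro mult_right_mono dyadic_harmonic) auto
    also have "\<dots> \<le> (\<Sum>n\<in>{2 ^ K'<..2 ^ K}. rs_term n)"
      unfolding sum_distrib_right
    proof (rule sum_mono)
      fix n :: nat assume n: "n \<in> {2 ^ K'<..2 ^ K}"
      then have n1: "n \<ge> 1" "1 \<le> load n" "load n \<le> v"
        using N[of n] K'N load_mono[of n "2 ^ K"] by (auto simp: v_def)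
      have "v * exp (- v) / real n \<le> load n * exp (- load n) / real n"
        using x_exp_antimono[OF n1(2,3)] by (intro divide_right_mono) auto
      then show "1 / real n * (v * exp (- v)) \<le> rs_term n" using rs_term_eq[OF n1(1)] by simp
    qed
    also have "\<dots> \<le> T" unfolding T_def
      by (rule sum_le_suminf[OF assms(1)]) (use rs_term_nonneg in auto)
    finally have "real K * (v * exp (- v)) \<le> v" using v by linarith
    then have "real K * exp (- v) * v \<le> 1 * v" by (simp only: ac_simps mult_1)
    then have "real K * exp (- v) \<le> 1" by (rule mult_right_le_imp_le) (use v in simp)
    then have "real K \<le> exp v" by (simp add: exp_minus field_simps)
    moreover have "real K > 0" using K by (simp add: K'_def)
    ultimately have "ln (real K) \<le> ln (exp v)" by (subst ln_le_cancel_iff) auto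
    then show "ln (real K) \<le> load (2 ^ K)" by (simp add: v_def)
  qed
qed

text \<open>Replaces the ball at time \<open>n\<close> by one of prescribed load \<open>w\<close>,
  in the range that \<open>controlled\<close> covers: a smaller ball when large loads are truncated,
  a larger one when small loads are raised.\<close>

lemma block_ball_with_mass:
  assumes k: "k \<ge> 3" and n: "2 ^ k \<le> real n" "real n \<le> 2 ^ (k + 1)"
    and w: "ln (real k) \<le> w" "w \<le> 2 * ln (real k)"
  obtains s where "ball_mass z s = w / real n" "block_ball z k s" "w \<le> load n \<Longrightarrow> s \<le> r n" "load n \<le> w \<Longrightarrow> r n \<le> s"
proof -
  have n0: "0 < real n" using n(1) by (smt (verit) zero_less_power)
  have l1: "1 \<le> ln (real k)" using ln_ge_1[OF k] .
  have \<tau>1: "ln (real k) / 2 ^ (k + 1) \<le> w / real n" using w l1 n n0 by (intro frac_le) auto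
  have \<tau>2: "w / real n \<le> 2 * ln (real k) / 2 ^ k" using w l1 n n0 by (intro frac_le) auto
  have "2 * ln (real k) / 2 ^ k < 1" using two_ln_less[OF k] by simp
  moreover have "0 < w / real n" using w l1 n0 by simp
  ultimately have \<tau>: "0 < w / real n" "w / real n < 1" using \<tau>2 by linarith+
  have "0 < r n" using n0 by (intro r_pos) simp
  then obtain s where s: "0 < s" "ball_mass z s = w / real n" "w / real n \<le> ball_mass z (r n) \<Longrightarrow> s \<le> r n"
    "ball_mass z (r n) \<le> w / real n \<Longrightarrow> r n \<le> s"
    using ball_with_mass[OF z \<tau>] by metis
  show ?thesis
  proof (rule that[OF s(2)])
    show "block_ball z k s" unfolding block_ball_def using s \<tau>1 \<tau>2 by simp
    show "s \<le> r n" if "w \<le> load n"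
      by (rule s(3)) (use that n0 in \<open>simp add: load_def divide_le_eq ac_simps\<close>)
    show "r n \<le> s" if "load n \<le> w"
      by (rule s(4)) (use that n0 in \<open>simp add: load_def le_divide_eq ac_simps\<close>)
  qed
qed

text \<open>The time is taken at the left end of the piece and the radius at its right end, so that
  this one event contains every failure within the piece. The constant is \<open>exp 61\<close> from
  \<open>controlled\<close> times \<open>exp 4\<close> for the length of the piece.\<close>

lemma miss_bound:
  assumes c: "controlled z k" and ld: "ln (real k) \<le> load (2 ^ k)" and i: "i < 2 ^ lvl k"
  shows "gauss.prob {x \<in> {0..1}. \<forall>t<pt k i. (gauss_map ^^ t) x \<notin> unit_ball z (r (pt k (Suc i)))}
     \<le> exp 65 * (2 * (\<Sum>n\<in>{pt k i<..pt k (Suc i)}. rs_term n) + 1 / real k ^ 2)"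
proof -
  have k3: "k \<ge> 3" using c by (simp add: controlled_def)
  define l where "l = ln (real k)"
  define L where "L = (2::real) ^ lvl k"
  have l1: "1 \<le> l" using ln_ge_1[OF k3] by (simp add: l_def)
  have L: "L \<le> l" "l < 2 * L" "L \<ge> 1" using lvl_bounds[OF k3] by (auto simp: l_def L_def)
  define A b where "A = pt k i" and "b = pt k (Suc i)"
  have Ab: "A \<le> b" "2 ^ k \<le> A" "2 ^ k \<le> b" "b \<le> 2 ^ (k + 1)"
    using i pt_bounds[OF k3, of i] pt_bounds[OF k3, of "Suc i"] pt_mono[of i "Suc i" k] by (auto simp: A_def b_def)
  have b: "2 ^ k \<le> real b" "real b \<le> 2 ^ (k + 1)" and A: "2 ^ k \<le> real A"
    using real_pt_bounds[OF k3, of "Suc i"] real_pt_bounds[OF k3, of i] i by (auto simp: A_def b_def)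
  have b0: "0 < real b" using pt_pos[of k "Suc i"] by (simp add: b_def)
  have pk: "(1::nat) \<le> 2 ^ k" by simp
  have lb: "l \<le> load n" if "2 ^ k \<le> n" for n using load_mono[OF pk that] ld by (simp add: l_def)
  \<comment> \<open>Missing the ball implies missing a smaller one; truncating at
    \<open>2 * l\<close> keeps the smaller ball within the reach of \<open>controlled\<close> and
    costs only \<open>1 / k\<^sup>2\<close>.\<close>
  define w where "w = min (load b) (2 * l)"
  have w: "l \<le> w" "w \<le> 2 * l" using lb[OF Ab(3)] l1 by (auto simp: w_def)
  define \<tau> where "\<tau> = w / real b"
  obtain s where s: "ball_mass z s = \<tau>" "block_ball z k s" "s \<le> r b"
    using block_ball_with_mass[OF k3 b, of w] w by (auto simp: \<tau>_def l_def w_def)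
  have \<tau>0: "0 \<le> \<tau>" using w l1 b0 by (simp add: \<tau>_def)
  have "L * (real b - real A) = 2 ^ k" using pt_gap[OF k3, of i] by (simp add: L_def A_def b_def)
  then have gap: "(real b - real A) / real b \<le> 1 / L" and gap': "1 / (2 * L) \<le> (real b - real A) / real b"
    using b b0 L(3) by (simp_all add: field_simps)
  have At: "w - 4 \<le> real A * \<tau>"
  proof -
    have "w * ((real b - real A) / real b) \<le> (2 * l) * (1 / L)"
      using w gap l1 L b0 Ab(1) by (intro mult_mono) auto
    also have "\<dots> \<le> 4" using L by (simp add: field_simps)
    finally have "w * ((real b - real A) / real b) \<le> 4" .
    moreover have "real A * \<tau> = w - w * ((real b - real A) / real b)"
      using b0 by (simp add: \<tau>_def field_simps)
    ultimately show ?thesis by simp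
  qed
  have "real A * \<tau> \<le> real b * \<tau>" using Ab(1) \<tau>0 by (intro mult_right_mono) auto
  also have "\<dots> = w" using b0 by (simp add: \<tau>_def)
  finally have At4: "real A * \<tau> \<le> 4 * l" using w l1 by simp
  have small: "ball_mass z s \<le> 1 / 100" using c s(2) by (simp add: controlled_def)
  have "gauss.prob {x \<in> {0..1}. \<forall>t<A. (gauss_map ^^ t) x \<notin> unit_ball z (r b)} \<le> surv z (\<lambda>_. s) A"
    unfolding surv_eq_measure using s(3)
    by (intro gauss.finite_measure_mono survival_set_sets) (auto simp: unit_ball_def)
  also have "\<dots> \<le> exp 61 * surv z (\<lambda>_. s) 0 * exp (- (real (A - 0) * ball_mass z s))"
    using c s(2) small At4 s(1) unfolding controlled_def l_def[symmetric] by (metis diff_zero le0)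
  also have "\<dots> \<le> exp 61 * exp (4 - w)"
    using At s(1) by (simp add: surv_0)
  also have "\<dots> = exp 65 * exp (- w)" by (simp flip: exp_add)
  also have "\<dots> \<le> exp 65 * (2 * (\<Sum>n\<in>{A<..b}. rs_term n) + 1 / real k ^ 2)"
  proof (intro mult_left_mono)
    define v where "v = load b"
    have v: "l \<le> v" using lb[OF Ab(3)] by (simp add: v_def)
    have "exp (- w) \<le> exp (- v) + exp (- (2 * l))" unfolding w_def v_def by (auto simp: min_def add_increasing add_increasing2)
    moreover have "exp (- (2 * l)) = 1 / real k ^ 2" using exp_minus_two_ln[of k] k3 by (simp add: l_def)
    \<comment> \<open>The piece has relative length at least \<open>1 / (2 * L)\<close> and
      \<open>v \<ge> L\<close>, so summing \<open>v * exp (- v) / b\<close> over it recovers at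
      least half of \<open>exp (- v)\<close>.\<close>
    moreover have "exp (- v) \<le> 2 * (\<Sum>n\<in>{A<..b}. rs_term n)"
    proof -
      have "exp (- v) * L \<le> exp (- v) * v" using v L by (intro mult_left_mono) auto
      then have "exp (- v) \<le> 2 * ((1 / (2 * L)) * (v * exp (- v)))" using L by (simp add: field_simps)
      also have "\<dots> \<le> 2 * (((real b - real A) / real b) * (v * exp (- v)))"
        using gap' v l1 by (intro mult_left_mono mult_right_mono) auto
      also have "((real b - real A) / real b) * (v * exp (- v)) = (\<Sum>n\<in>{A<..b}. v * exp (- v) / real b)"
        using Ab(1) by (simp add: of_nat_diff)
      also have "\<dots> \<le> (\<Sum>n\<in>{A<..b}. rs_term n)"
      proof (rule sum_mono)
        fix n assume n: "n \<in> {A<..b}"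
        then have n1: "1 \<le> n" "1 \<le> load n" "load n \<le> v"
          using lb[of n] Ab l1 load_mono[of n b] by (auto simp: v_def)
        have "v * exp (- v) / real b \<le> load n * exp (- load n) / real n"
          using x_exp_antimono[OF n1(2,3)] n n1 by (intro frac_le) auto
        then show "v * exp (- v) / real b \<le> rs_term n" using rs_term_eq[OF n1(1)] by simp
      qed
      finally show ?thesis by simp
    qed
    ultimately show "exp (- w) \<le> 2 * (\<Sum>n\<in>{A<..b}. rs_term n) + 1 / real k ^ 2" by simp
  qed auto
  finally show ?thesis by (simp only: A_def b_def)
qed

text \<open>Borel-Cantelli over the blocks: the pieces of block \<open>k\<close> contribute its part
  of the series and at most \<open>ln k\<close> errors \<open>1 / k\<^sup>2\<close>.\<close>

theorem eventually_always_hit: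
  assumes "summable rs_term" "\<not> summable (\<lambda>n. ball_mass z (r n))"
  shows "gauss.prob (ev_always_hit r z) = 1"
proof -
  have "\<forall>\<^sub>F k in sequentially. controlled z k \<and> ln (real k) \<le> load (2 ^ k)"
    using typical_controlled[OF z typical] load_ge_ln[OF assms] by eventually_elim simp
  then obtain K where K: "\<And>k. k \<ge> K \<Longrightarrow> controlled z k \<and> ln (real k) \<le> load (2 ^ k)"
    by (auto simp: eventually_sequentially)
  have k3: "k \<ge> 3" if "k \<ge> K" for k using K[OF that] by (simp add: controlled_def)
  define Miss where "Miss k i = {x \<in> {0..1}. \<forall>t<pt k i. (gauss_map ^^ t) x \<notin> unit_ball z (r (pt k (Suc i)))}" for k i
  have Mm: "Miss k i \<in> sets \<M>" for k i unfolding Miss_def by (rule survival_set_sets)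
  define Bad where "Bad k = (\<Union>i<2 ^ lvl (k + K). Miss (k + K) i)" for k
  have Bm: "Bad k \<in> sets \<M>" for k unfolding Bad_def using Mm by auto
  define c where "c k = (\<Sum>n\<in>{2 ^ k<..2 ^ (k + 1)}. rs_term n)" for k :: nat
  have cs: "summable c"
  proof (rule summableI_nonneg_bounded[where x="suminf rs_term"])
    show "0 \<le> c n" for n unfolding c_def by (intro sum_nonneg rs_term_nonneg)
    show "sum c {..<n} \<le> suminf rs_term" for n
    proof -
      have "sum c {..<n} = (\<Sum>n\<in>{2 ^ 0<..2 ^ n}. rs_term n)"
        unfolding lessThan_atLeast0 c_def by (rule dyadic_sums) simp
      also have "\<dots> \<le> suminf rs_term"
        by (rule sum_le_suminf[OF assms(1)]) (use rs_term_nonneg in auto)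
      finally show ?thesis .
    qed
  qed
  have bad: "gauss.prob (Bad k) \<le> exp 65 * (2 * c (k + K) + 1 * ln (real (k + K)) / real (k + K) ^ 2)" for k
  proof -
    let ?k = "k + K"
    have kk: "controlled z ?k" "ln (real ?k) \<le> load (2 ^ ?k)" "?k \<ge> 3" using K[of ?k] k3[of ?k] by auto
    have "gauss.prob (Bad k) \<le> (\<Sum>i<2 ^ lvl ?k. gauss.prob (Miss ?k i))"
      unfolding Bad_def using Mm by (intro gauss.finite_measure_subadditive_finite) auto
    also have "\<dots> \<le> (\<Sum>i<2 ^ lvl ?k. exp 65 * (2 * (\<Sum>n\<in>{pt ?k i<..pt ?k (Suc i)}. rs_term n) + 1 / real ?k ^ 2))"
      unfolding Miss_def by (intro sum_mono miss_bound kk) auto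
    also have "\<dots> = exp 65 * (2 * (\<Sum>i<2 ^ lvl ?k. \<Sum>n\<in>{pt ?k i<..pt ?k (Suc i)}. rs_term n) + 2 ^ lvl ?k * (1 / real ?k ^ 2))"
      by (simp add: sum.distrib flip: sum_distrib_left)
    also have "\<dots> = exp 65 * (2 * c ?k + 2 ^ lvl ?k * (1 / real ?k ^ 2))"
      unfolding sum_blocks(1)[OF kk(3)] c_def ..
    also have "\<dots> \<le> exp 65 * (2 * c ?k + 1 * ln (real ?k) / real ?k ^ 2)"
      using mult_right_mono[OF lvl_bounds(1)[OF kk(3)], of "1 / real ?k ^ 2"] by simp
    finally show ?thesis .
  qed
  have "summable (\<lambda>k. exp 65 * (2 * c (k + K) + 1 * ln (real (k + K)) / real (k + K) ^ 2))"
    using summable_ignore_initial_segment[OF cs, of K] summable_ignore_initial_segment[OF summable_ln_over_square[of 1], of K]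
    by (intro summable_mult summable_add) auto
  then have "summable (\<lambda>k. gauss.prob (Bad k))"
    by (rule summable_comparison_test'[where N=0]) (use bad in auto)
  then have "AE x in \<M>. \<forall>\<^sub>F k in sequentially. x \<in> space \<M> - Bad k"
    by (intro borel_cantelli_AE1 Bm) (auto simp: gauss.emeasure_eq_measure)
  then have "AE x in \<M>. x \<in> ev_always_hit r z"
  proof eventually_elim
    case (elim x)
    then obtain N where N: "\<And>k. k \<ge> N \<Longrightarrow> x \<in> {0..1} - Bad k" by (auto simp: eventually_sequentially)
    have "hit m x" if m: "m \<ge> 2 ^ (N + K)" for m
    proof -
      have m0: "m > 0" using m by (metis gr0I not_le zero_less_numeral zero_less_power)
      obtain k where k: "2 ^ k \<le> m" "m < 2 ^ (k + 1)" using ex_power_ivl1[of 2 m] m0 by auto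
      have "2 ^ (N + K) < (2::nat) ^ (k + 1)" using m k by linarith
      then have kN: "k \<ge> N + K" by (subst (asm) power_strict_increasing_iff) auto
      obtain i where i: "i < 2 ^ lvl k" "pt k i \<le> m" "m < pt k (Suc i)"
        using pt_cover[OF k3 k] kN by auto
      have "x \<notin> Miss k i" "x \<in> {0..1}" using N[of "k - K"] kN i(1) by (auto simp: Bad_def)
      then obtain t where t: "t < pt k i" "(gauss_map ^^ t) x \<in> unit_ball z (r (pt k (Suc i)))"
        by (auto simp: Miss_def)
      \<comment> \<open>A hit before the left end, at the radius of the right end, is a hit for
        every time in the piece because radii do not increase.\<close>
      have "r (pt k (Suc i)) \<le> r m" using m0 i by (intro r_noninc) auto
      then show ?thesis unfolding hit_def using t i(2) by (intro exI[of _ t]) (auto simp: unit_ball_def)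
    qed
    then show ?case using N[of N] by (auto simp: mem_ev_always_hit eventually_sequentially)
  qed
  then show ?thesis
    using gauss.prob_eq_1[OF sets_ev_always_hit] by simp
qed

section \<open>Divergence of the series\<close>

text \<open>Times with \<open>load (pt k i) > 2 * ln k\<close> are dropped: they contribute a convergent series. At the
  others the ball is enlarged to have \<open>load\<close> at least \<open>ln k\<close>, which makes the events rarer but
  leaves the series divergent and makes correlations within a block summable.\<close>

definition heavy :: "nat \<Rightarrow> nat set" where
  "heavy k = {i. i < 2 ^ lvl k \<and> load (pt k i) \<le> 2 * ln (real k)}"

definition wt :: "nat \<Rightarrow> nat \<Rightarrow> real" where
  "wt k i = max (load (pt k i)) (ln (real k))"

text \<open>For \<open>k \<ge> 3\<close> and \<open>i \<in> heavy k\<close> such a radius exists;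
  elsewhere the choice is arbitrary.\<close>

definition sel :: "nat \<Rightarrow> nat \<Rightarrow> real" where
  "sel k i = (SOME s. block_ball z k s \<and> ball_mass z s = wt k i / real (pt k i) \<and> r (pt k i) \<le> s)"

definition missed :: "nat \<Rightarrow> nat \<Rightarrow> real set" where
  "missed k i = {x \<in> {0..1}. \<forall>t<pt k i. (gauss_map ^^ t) x \<notin> unit_ball z (sel k i)}"

definition block_weight :: "nat \<Rightarrow> real" where
  "block_weight k = (\<Sum>i\<in>heavy k. exp (- wt k i))"

text \<open>Up to a constant, the bound for missing the ball of the second index throughout the time
  between the two points: \<open>wt k' i' / pt k' i'\<close> is the mass of that ball.\<close>

definition gap_factor :: "nat \<Rightarrow> nat \<Rightarrow> nat \<Rightarrow> nat \<Rightarrow> real" where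
  "gap_factor k i k' i' =
     exp (- ((real (pt k' i') - real (pt k i)) / real (pt k' i') * wt k' i'))"

lemma finite_heavy: "finite (heavy k)"
  by (rule finite_subset[of _ "{..<2 ^ lvl k}"]) (auto simp: heavy_def)

lemma wt_bounds: "i \<in> heavy k \<Longrightarrow> k \<ge> 3 \<Longrightarrow> ln (real k) \<le> wt k i \<and> wt k i \<le> 2 * ln (real k)"
  using ln_ge_1[of k] by (auto simp: wt_def heavy_def)

lemma sel:
  assumes k: "k \<ge> 3" and i: "i \<in> heavy k"
  shows "ball_mass z (sel k i) = wt k i / real (pt k i)" "r (pt k i) \<le> sel k i" "block_ball z k (sel k i)"
proof -
  have A: "2 ^ k \<le> real (pt k i)" "real (pt k i) \<le> 2 ^ (k + 1)"
    using real_pt_bounds[OF k, of i] i by (auto simp: heavy_def)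
  have "load (pt k i) \<le> wt k i" by (simp add: wt_def)
  then have "\<exists>s. block_ball z k s \<and> ball_mass z s = wt k i / real (pt k i) \<and> r (pt k i) \<le> s"
    using block_ball_with_mass[OF k A, of "wt k i"] wt_bounds[OF i k] by metis
  from someI_ex[OF this] show "ball_mass z (sel k i) = wt k i / real (pt k i)" "r (pt k i) \<le> sel k i"
    "block_ball z k (sel k i)"
    unfolding sel_def by auto
qed

lemma missed_sets [measurable]: "missed k i \<in> sets \<M>"
  unfolding missed_def by (rule survival_set_sets)

lemma measure_missed: "gauss.prob (missed k i) = surv z (\<lambda>_. sel k i) (pt k i)"
  by (simp add: missed_def surv_eq_measure)

lemma missed_not_hit: "k \<ge> 3 \<Longrightarrow> i \<in> heavy k \<Longrightarrow> x \<in> missed k i \<Longrightarrow> \<not> hit (pt k i) x"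
  using sel(2)[of k i] by (fastforce simp: missed_def hit_def unit_ball_def)

lemma missed_lower:
  assumes c: "controlled z k" and i: "i \<in> heavy k"
  shows "exp (- wt k i) \<le> 2 * exp 60 * gauss.prob (missed k i)"
proof -
  have k3: "k \<ge> 3" using c by (simp add: controlled_def)
  note s = sel[OF k3 i]
  have e: "real (pt k i) * ball_mass z (sel k i) = wt k i" using pt_pos[of k i] by (simp add: s)
  have "real (pt k i) * ball_mass z (sel k i) \<le> 4 * ln (real k)"
    using wt_bounds[OF i k3] ln_ge_1[OF k3] unfolding e by simp
  then have "exp (- (real (pt k i) * ball_mass z (sel k i))) \<le> 2 * exp 60 * surv z (\<lambda>_. sel k i) (pt k i)"
    using c s(3) unfolding controlled_def by blast
  then show ?thesis unfolding e measure_missed .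
qed

text \<open>Relax the second event to avoidance after the first time only. The result is survival
  with the first radius up to \<open>pt k i\<close> and the second from there on, and
  \<open>controlled\<close> bounds the second stretch relative to the first.\<close>

lemma missed_pair:
  assumes c: "controlled z k" "controlled z k'" and i: "i \<in> heavy k" "i' \<in> heavy k'" and le: "pt k i \<le> pt k' i'"
  shows "gauss.prob (missed k i \<inter> missed k' i')
    \<le> exp 61 * gauss.prob (missed k i) * gap_factor k i k' i'"
proof -
  have k3: "k \<ge> 3" "k' \<ge> 3" using c by (auto simp: controlled_def)
  note s = sel[OF k3(1) i(1)] and s' = sel[OF k3(2) i(2)]
  define A A' where "A = pt k i" and "A' = pt k' i'"
  define \<rho> where "\<rho> t = (if t < A then sel k i else sel k' i')" for t
  have A0: "0 < real A'" using pt_pos[of k' i'] by (simp add: A'_def)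
  have small: "\<forall>t. ball_mass z (\<rho> t) \<le> 1 / 100"
    using c s(3) s'(3) unfolding controlled_def by (auto simp: \<rho>_def)
  have e: "real (A' - A) * ball_mass z (sel k' i') = (real A' - real A) / real A' * wt k' i'"
    using le by (simp add: s' A_def A'_def of_nat_diff)
  have "(real A' - real A) / real A' * wt k' i' \<le> 1 * wt k' i'"
    using A0 wt_bounds[OF i(2) k3(2)] ln_ge_1[OF k3(2)] by (intro mult_right_mono) auto
  also have "\<dots> \<le> 4 * ln (real k')" using wt_bounds[OF i(2) k3(2)] ln_ge_1[OF k3(2)] by simp
  finally have b: "real (A' - A) * ball_mass z (sel k' i') \<le> 4 * ln (real k')" unfolding e .
  have "gauss.prob (missed k i \<inter> missed k' i') \<le> surv z \<rho> A'"
    unfolding surv_eq_measure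
    by (intro gauss.finite_measure_mono survival_set_sets) (auto simp: missed_def \<rho>_def A_def A'_def)
  also have "\<dots> \<le> exp 61 * surv z \<rho> A * exp (- (real (A' - A) * ball_mass z (sel k' i')))"
  proof -
    have "\<forall>t. A \<le> t \<longrightarrow> t < A' \<longrightarrow> \<rho> t = sel k' i'" by (auto simp: \<rho>_def)
    then show ?thesis using c(2) s'(3) small le b unfolding controlled_def A_def[symmetric] A'_def[symmetric] by blast
  qed
  also have "surv z \<rho> A = gauss.prob (missed k i)"
    unfolding surv_eq_measure missed_def by (rule arg_cong[where f="gauss.prob"]) (auto simp: \<rho>_def A_def)
  finally show ?thesis unfolding e by (simp add: gap_factor_def A_def A'_def)
qed

lemma block_weight_nonneg: "0 \<le> block_weight k"
  unfolding block_weight_def by (intro sum_nonneg) auto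

text \<open>If the load at \<open>2 ^ K\<close> were below \<open>ln K\<close>, every piece of the
  blocks \<open>k\<close> from about \<open>K / 2\<close> to \<open>K\<close> would be heavy,
  because \<open>K \<le> k\<^sup>2\<close>, with weight at least \<open>1 / K\<close>. A block has
  at least \<open>ln (K / 2) / 2\<close> pieces, so these blocks together would exceed the sum of
  the series.\<close>

lemma load_ge_ln_of_block_weight:
  assumes "summable block_weight"
  shows "\<forall>\<^sub>F K in sequentially. ln (real K) \<le> load (2 ^ K)"
proof -
  define T where "T = suminf block_weight"
  have "\<forall>\<^sub>F K :: nat in sequentially. 8 * T < (real K - 1) / real K * ln (real K / 2)" by real_asymp
  then show ?thesis using eventually_ge_at_top[of 8]
  proof eventually_elim
    case (elim K)
    show ?case
    proof (rule ccontr)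
      assume "\<not> ln (real K) \<le> load (2 ^ K)"
      then have low: "load (2 ^ K) < ln (real K)" by simp
      define I where "I = {K - K div 2..<K}"
      have D: "ln (real K / 2) / (2 * real K) \<le> block_weight k" if k: "k \<in> I" for k
      proof -
        have kk: "k \<ge> 3" "K \<le> 2 * k" "k < K" using k elim(2) by (auto simp: I_def)
        have "2 * k \<le> k * k" using kk by (intro mult_right_mono) auto
        then have "real K \<le> real (k * k)" using kk by (intro of_nat_mono) linarith
        then have "ln (real K) \<le> ln (real k * real k)" using kk by (subst ln_le_cancel_iff) auto
        then have lK: "ln (real K) \<le> 2 * ln (real k)" using kk by (simp add: ln_mult)
        have ld: "load (pt k i) \<le> ln (real K)" if "i < 2 ^ lvl k" for i
        proof -
          have "pt k i \<le> 2 ^ (k + 1)" using pt_bounds[OF kk(1), of i] that by simp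
          also have "\<dots> \<le> (2::nat) ^ K" using kk by (intro power_increasing) auto
          finally show ?thesis using load_mono[of "pt k i" "2 ^ K"] pt_pos[of k i] low by simp
        qed
        then have h: "heavy k = {..<2 ^ lvl k}" unfolding heavy_def using lK by fastforce
        have "ln (real K / 2) \<le> ln (real k)" using kk by (subst ln_le_cancel_iff) auto
        then have "ln (real K / 2) / (2 * real K) \<le> (2 * 2 ^ lvl k) / (2 * real K)"
          using lvl_bounds(2)[OF kk(1)] by (intro divide_right_mono) auto
        also have "\<dots> = (\<Sum>i<(2::nat) ^ lvl k. 1 / real K)" by simp
        also have "\<dots> \<le> block_weight k" unfolding block_weight_def h
        proof (rule sum_mono)
          fix i :: nat assume "i \<in> {..<2 ^ lvl k}"
          moreover have "ln (real k) \<le> ln (real K)" using kk by (subst ln_le_cancel_iff) auto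
          ultimately have "wt k i \<le> ln (real K)" using ld by (auto simp: wt_def)
          then have "exp (- ln (real K)) \<le> exp (- wt k i)" by simp
          then show "1 / real K \<le> exp (- wt k i)" using kk by (simp add: exp_minus inverse_eq_divide)
        qed
        finally show ?thesis .
      qed
      have "real (card I) * (ln (real K / 2) / (2 * real K)) \<le> (\<Sum>k\<in>I. block_weight k)"
        using sum_bounded_below[of I "ln (real K / 2) / (2 * real K)" block_weight] D by simp
      also have "\<dots> \<le> T" unfolding T_def
        by (rule sum_le_suminf[OF assms]) (use block_weight_nonneg in \<open>auto simp: I_def\<close>)
      finally have 1: "real (card I) * (ln (real K / 2) / (2 * real K)) \<le> T" .
      have "(real K - 1) / 2 \<le> real (card I)"
      proof -
        have "K \<le> 2 * (K div 2) + 1" by linarith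
        then have "real K \<le> real (2 * (K div 2) + 1)" by (rule of_nat_mono)
        moreover have "card I = K div 2" by (simp add: I_def)
        ultimately show ?thesis by simp
      qed
      moreover have "0 \<le> ln (real K / 2) / (2 * real K)" using elim(2) by (intro divide_nonneg_nonneg) auto
      ultimately have "(real K - 1) / 2 * (ln (real K / 2) / (2 * real K)) \<le> T"
        using 1 by (meson mult_right_mono order_trans)
      moreover define Q where "Q = (real K - 1) / real K * ln (real K / 2)"
      have "(real K - 1) / 2 * (ln (real K / 2) / (2 * real K)) = Q / 4" by (simp add: Q_def)
      moreover have "T \<ge> 0" unfolding T_def using assms block_weight_nonneg by (intro suminf_nonneg)
      moreover have "8 * T < Q" using elim(1) by (simp only: Q_def)
      ultimately show False by linarith
    qed
  qed
qed

text \<open>If \<open>block_weight\<close> were summable, loads would eventually be at least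
  \<open>ln k\<close>, and the part of the series on one piece would be at most
  \<open>v * exp (- v) / L\<close> with \<open>v\<close> the load at its left end. Heavy pieces give
  at most \<open>4 * exp (- v)\<close>, the others \<open>4 / k\<^sup>2\<close>, and the original
  series would converge.\<close>

lemma block_weight_not_summable:
  assumes "\<not> summable rs_term"
  shows "\<not> summable block_weight"
proof
  assume D: "summable block_weight"
  obtain K0 where K0: "\<And>k. k \<ge> K0 \<Longrightarrow> ln (real k) \<le> load (2 ^ k)"
    using load_ge_ln_of_block_weight[OF D] by (auto simp: eventually_sequentially)
  define K where "K = max 3 K0"
  define c where "c k = (\<Sum>n\<in>{2 ^ k..<2 ^ (k + 1)}. rs_term n)" for k :: nat
  have c: "c k \<le> 4 * block_weight k + 4 * ln (real k) / real k ^ 2" if k: "k \<ge> K" for k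
  proof -
    have k3: "k \<ge> 3" using k by (simp add: K_def)
    define l where "l = ln (real k)"
    define L where "L = (2::real) ^ lvl k"
    have l1: "1 \<le> l" using ln_ge_1[OF k3] by (simp add: l_def)
    have L: "L \<le> l" "l < 2 * L" "L \<ge> 1" using lvl_bounds[OF k3] by (auto simp: l_def L_def)
    have pk: "(1::nat) \<le> 2 ^ k" by simp
    have lb: "l \<le> load n" if "2 ^ k \<le> n" for n
      using load_mono[OF pk that] K0[of k] k by (simp add: l_def K_def)
    have step: "(\<Sum>n\<in>{pt k i..<pt k (Suc i)}. rs_term n) \<le> (if i \<in> heavy k then 4 * exp (- wt k i) else 0) + 4 / real k ^ 2"
      if i: "i < 2 ^ lvl k" for i
    proof -
      define A b where "A = pt k i" and "b = pt k (Suc i)"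
      define v where "v = load A"
      have Ab: "2 ^ k \<le> A" "A \<le> b" "1 \<le> A" using i pt_bounds[OF k3, of i] pt_pos[of k i] pt_mono[of i "Suc i" k] by (auto simp: A_def b_def)
      have v: "l \<le> v" using lb[OF Ab(1)] by (simp add: v_def)
      have A0: "0 < real A" using Ab by simp
      have gap: "(real b - real A) / real A \<le> 1 / L"
      proof -
        have "L * (real b - real A) \<le> real A"
          using pt_gap[OF k3, of i] real_pt_bounds[OF k3, of i] i by (simp add: L_def A_def b_def)
        then show ?thesis using A0 L(3) by (simp add: field_simps)
      qed
      have "(\<Sum>n\<in>{A..<b}. rs_term n) \<le> (\<Sum>n\<in>{A..<b}. v * exp (- v) / real A)"
      proof (rule sum_mono)
        fix n assume n: "n \<in> {A..<b}"
        then have n1: "1 \<le> n" "v \<le> load n" using Ab load_mono[of A n] by (auto simp: v_def)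
        have "load n * exp (- load n) / real n \<le> v * exp (- v) / real A"
          using x_exp_antimono[of v "load n"] n1 n v l1 A0 by (intro frac_le) auto
        then show "rs_term n \<le> v * exp (- v) / real A" using rs_term_eq[OF n1(1)] by simp
      qed
      also have "\<dots> = (real b - real A) / real A * (v * exp (- v))" using Ab by (simp add: of_nat_diff)
      also have "\<dots> \<le> 1 / L * (v * exp (- v))" using gap v l1 by (intro mult_right_mono) auto
      also have "\<dots> \<le> (if i \<in> heavy k then 4 * exp (- wt k i) else 0) + 4 / real k ^ 2"
      proof (cases "i \<in> heavy k")
        case True
        then have "v \<le> 2 * l" by (simp add: heavy_def v_def A_def l_def)
        moreover have "wt k i = v" using v by (simp add: wt_def v_def A_def l_def)
        ultimately have "1 / L * (v * exp (- v)) \<le> 1 / L * (4 * L * exp (- v))"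
          using L by (intro mult_left_mono mult_right_mono) auto
        then show ?thesis using True L \<open>wt k i = v\<close> by (simp add: add_increasing2)
      next
        case False
        then have "2 * l \<le> v" using i by (simp add: heavy_def v_def A_def l_def)
        then have "v * exp (- v) \<le> 2 * l * exp (- (2 * l))" using l1 by (intro x_exp_antimono) auto
        also have "\<dots> \<le> 4 * L * exp (- (2 * l))" using L by (intro mult_right_mono) auto
        finally have "1 / L * (v * exp (- v)) \<le> 1 / L * (4 * L * exp (- (2 * l)))"
          using L by (intro mult_left_mono) auto
        then show ?thesis using False L exp_minus_two_ln[of k] k3 by (simp add: l_def)
      qed
      finally show ?thesis by (simp add: A_def b_def)
    qed
    have "c k = (\<Sum>i<2 ^ lvl k. \<Sum>n\<in>{pt k i..<pt k (Suc i)}. rs_term n)"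
      unfolding c_def by (rule sum_blocks(2)[OF k3, symmetric])
    also have "\<dots> \<le> (\<Sum>i<2 ^ lvl k. (if i \<in> heavy k then 4 * exp (- wt k i) else 0) + 4 / real k ^ 2)"
      by (intro sum_mono step) auto
    also have "\<dots> = (\<Sum>i<2 ^ lvl k. if i \<in> heavy k then 4 * exp (- wt k i) else 0) + L * (4 / real k ^ 2)"
      by (simp add: sum.distrib L_def)
    also have "(\<Sum>i<2 ^ lvl k. if i \<in> heavy k then 4 * exp (- wt k i) else 0) = (\<Sum>i\<in>heavy k. 4 * exp (- wt k i))"
      by (rule sum.mono_neutral_cong_right) (auto simp: heavy_def)
    also have "\<dots> = 4 * block_weight k" by (simp add: block_weight_def sum_distrib_left)
    also have "L * (4 / real k ^ 2) \<le> 4 * ln (real k) / real k ^ 2"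
      using mult_right_mono[OF L(1), of "4 / real k ^ 2"] by (simp add: l_def ac_simps)
    finally show ?thesis by simp
  qed
  have c0: "0 \<le> c k" for k unfolding c_def by (intro sum_nonneg rs_term_nonneg)
  have "summable (\<lambda>k. 4 * block_weight k + 4 * ln (real k) / real k ^ 2)"
    by (intro summable_add summable_mult D summable_ln_over_square)
  then have cs: "summable c"
    by (rule summable_comparison_test'[where N=K]) (use c c0 in auto)
  have "summable rs_term"
  proof (rule summableI_nonneg_bounded[where x="rs_term 0 + suminf c"])
    fix n
    \<comment> \<open>The dyadic blocks start at 1, so the term with index 0 is kept apart.\<close>
    have "{..<n} \<subseteq> insert 0 {2 ^ 0..<2 ^ n}" using less_trans[OF _ less_exp[of n]] by auto
    then have "sum rs_term {..<n} \<le> sum rs_term (insert 0 {2 ^ 0..<2 ^ n})"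
      by (intro sum_mono2) (auto simp: rs_term_nonneg)
    also have "\<dots> = rs_term 0 + sum rs_term {2 ^ 0..<2 ^ n}" by simp
    also have "sum rs_term {2 ^ 0..<2 ^ n} = sum c {0..<n}" unfolding c_def by (rule dyadic_sums(2)[symmetric]) simp
    also have "\<dots> \<le> suminf c" by (rule sum_le_suminf[OF cs]) (use c0 in auto)
    finally show "sum rs_term {..<n} \<le> rs_term 0 + suminf c" by simp
  qed (rule rs_term_nonneg)
  then show False using assms by simp
qed

section \<open>Correlations of missed times\<close>

definition geo :: real where "geo = 1 / (1 - exp (- (1 / 2)))"

lemma geo_nonneg: "0 \<le> geo"
  by (simp add: geo_def)

text \<open>A separation of \<open>f i'\<close> pieces of length \<open>h\<close> is at least
  \<open>f i' / (2 * L)\<close> of the later time. Multiplied by a load of at least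
  \<open>ln k' \<ge> L\<close>, it makes the exponent at least \<open>f i' / 2\<close>: here raising
  the load to \<open>ln k'\<close> yields a geometric series.\<close>

lemma near_block_sum:
  assumes k': "k' \<ge> 3" and inj: "inj_on f X" and X: "X \<subseteq> heavy k'"
    and gap: "\<And>i'. i' \<in> X \<Longrightarrow> 2 ^ (k' - lvl k') * real (f i') \<le> real (pt k' i') - real (pt k i)"
  shows "(\<Sum>i'\<in>X. gap_factor k i k' i') \<le> geo"
proof -
  define h L where "h = (2::real) ^ (k' - lvl k')" and "L = (2::real) ^ lvl k'"
  have hL: "h * L = 2 ^ k'" "h > 0" "L > 0" using lvl_le[OF k'] by (auto simp: h_def L_def simp flip: power_add)
  have "(\<Sum>i'\<in>X. gap_factor k i k' i') \<le> (\<Sum>i'\<in>X. exp (- (1 / 2)) ^ f i')"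
  proof (rule sum_mono)
    fix i' assume i': "i' \<in> X"
    then have ih: "i' \<in> heavy k'" using X by blast
    define A' where "A' = real (pt k' i')"
    have A': "0 < A'" "A' \<le> 2 * (h * L)"
      using pt_pos[of k' i'] real_pt_bounds[OF k', of i'] ih by (auto simp: A'_def hL heavy_def)
    have "real (f i') / 2 = h * real (f i') / (2 * (h * L)) * L" using hL(2,3) by simp
    also have "\<dots> \<le> (A' - real (pt k i)) / A' * wt k' i'"
    proof (intro mult_mono frac_le)
      show "h * real (f i') \<le> A' - real (pt k i)" using gap[OF i'] by (simp add: h_def A'_def)
      then show "0 \<le> A' - real (pt k i)" using hL by (smt (verit) mult_nonneg_nonneg of_nat_0_le_iff)
      then show "0 \<le> (A' - real (pt k i)) / A'" using A' by simp
      show "L \<le> wt k' i'" using wt_bounds[OF ih k'] lvl_bounds[OF k'] by (simp add: L_def)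
    qed (use A' hL in auto)
    finally have "gap_factor k i k' i' \<le> exp (- (real (f i') / 2))"
      unfolding gap_factor_def A'_def by simp
    also have "\<dots> = exp (- (1 / 2)) ^ f i'" by (simp flip: exp_of_nat_mult)
    finally show "gap_factor k i k' i' \<le> exp (- (1 / 2)) ^ f i'" .
  qed
  also have "\<dots> \<le> geo" unfolding geo_def
    using X finite_heavy by (intro sum_power_le_geometric inj) (auto intro: finite_subset)
  finally show ?thesis .
qed

text \<open>All but a proportion \<open>2 ^ (- d)\<close> of the later time lies after the earlier
  one. If \<open>ln k' \<le> 2 ^ d\<close>, the overlap costs at most 2 in the exponent and the
  events are nearly independent. Otherwise half of the exponent still gives
  \<open>1 / sqrt k'\<close> for each of at most \<open>ln k'\<close> terms, and \<open>big\<close>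
  bounds their sum by \<open>1 / ln k' \<le> 2 ^ (- d)\<close>.\<close>

lemma far_block_sum:
  assumes k: "k \<ge> 3" "i < 2 ^ lvl k" and k': "k + 2 \<le> k'" and big: "ln (real k') ^ 2 \<le> sqrt (real k')"
  shows "(\<Sum>i'\<in>heavy k'. gap_factor k i k' i') \<le> exp 2 * block_weight k' + 2 * (1 / 2) ^ (k' - k)"
proof -
  define d where "d = k' - k - 1"
  have k'3: "k' \<ge> 3" using k k' by simp
  define l where "l = ln (real k')"
  have l1: "1 \<le> l" using ln_ge_1[OF k'3] by (simp add: l_def)
  have gf: "gap_factor k i k' i' \<le> exp (- ((1 - (1 / 2) ^ d) * wt k' i'))" if i': "i' \<in> heavy k'" for i'
  proof -
    have A: "real (pt k i) \<le> 2 ^ (k + 1)" using real_pt_bounds[OF k(1), of i] k(2) by simp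
    have A': "2 ^ k' \<le> real (pt k' i')" using real_pt_bounds[OF k'3, of i'] i' by (simp add: heavy_def)
    have A'0: "0 < real (pt k' i')" using pt_pos[of k' i'] by simp
    have "real (pt k i) / real (pt k' i') \<le> 2 ^ (k + 1) / 2 ^ k'" using A A' by (intro frac_le) auto
    also have "(2::real) ^ k' = 2 ^ (k + 1) * 2 ^ d"
    proof -
      have "k' = k + 1 + d" using k' by (simp add: d_def)
      then show ?thesis by (simp only: power_add)
    qed
    finally have "real (pt k i) / real (pt k' i') \<le> (1 / 2) ^ d" by (simp add: power_one_over)
    then have "1 - (1 / 2) ^ d \<le> (real (pt k' i') - real (pt k i)) / real (pt k' i')"
      using A'0 by (simp add: diff_divide_distrib)
    then show ?thesis unfolding gap_factor_def exp_le_cancel_iff neg_le_iff_le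
      by (rule mult_right_mono) (use wt_bounds[OF i' k'3] l1 in \<open>simp add: l_def\<close>)
  qed
  have dk: "2 * (1 / 2 :: real) ^ (k' - k) = (1 / 2) ^ d"
  proof -
    have "k' - k = Suc d" using k' by (simp add: d_def)
    then show ?thesis by simp
  qed
  show ?thesis
  proof (cases "l \<le> 2 ^ d")
    case True
    have "(\<Sum>i'\<in>heavy k'. gap_factor k i k' i') \<le> (\<Sum>i'\<in>heavy k'. exp 2 * exp (- wt k' i'))"
    proof (rule sum_mono)
      fix i' assume i': "i' \<in> heavy k'"
      have "(1 / 2) ^ d * wt k' i' \<le> (1 / 2) ^ d * (2 * 2 ^ d)"
        using wt_bounds[OF i' k'3] True by (intro mult_left_mono) (auto simp: l_def)
      also have "\<dots> = 2" by (simp add: power_one_over)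
      finally have "exp (- ((1 - (1 / 2) ^ d) * wt k' i')) \<le> exp (2 - wt k' i')" by (simp add: algebra_simps)
      then show "gap_factor k i k' i' \<le> exp 2 * exp (- wt k' i')"
        using gf[OF i'] by (simp only: exp_add[symmetric] diff_conv_add_uminus order_trans)
    qed
    also have "\<dots> = exp 2 * block_weight k'" by (simp add: block_weight_def sum_distrib_left)
    finally show ?thesis by (simp add: add_increasing2)
  next
    case False
    have "(1 / 2 :: real) ^ d \<le> (1 / 2) ^ 1" using k' by (intro power_decreasing) (auto simp: d_def)
    then have half: "1 / 2 \<le> 1 - (1 / 2 :: real) ^ d" by simp
    have sq: "0 < sqrt (real k')" using k'3 by simp
    have "(\<Sum>i'\<in>heavy k'. gap_factor k i k' i') \<le> (\<Sum>i'\<in>heavy k'. 1 / sqrt (real k'))"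
    proof (rule sum_mono)
      fix i' assume i': "i' \<in> heavy k'"
      have "1 / 2 * l \<le> (1 - (1 / 2) ^ d) * wt k' i'"
        using half wt_bounds[OF i' k'3] l1 by (intro mult_mono) (auto simp: l_def)
      then have "gap_factor k i k' i' \<le> exp (- (l / 2))" using gf[OF i'] by (elim order_trans) simp
      also have "l / 2 = ln (sqrt (real k'))" using k'3 by (simp add: l_def ln_sqrt)
      also have "exp (- ln (sqrt (real k'))) = 1 / sqrt (real k')" using sq by (simp add: exp_minus inverse_eq_divide)
      finally show "gap_factor k i k' i' \<le> 1 / sqrt (real k')" .
    qed
    also have "\<dots> = real (card (heavy k')) * (1 / sqrt (real k'))" by simp
    also have "\<dots> \<le> l * (1 / sqrt (real k'))"
    proof (rule mult_right_mono)
      have "card (heavy k') \<le> card {..<(2::nat) ^ lvl k'}" by (rule card_mono) (auto simp: heavy_def)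
      then have "real (card (heavy k')) \<le> real (2 ^ lvl k')" by (intro of_nat_mono) simp
      also have "\<dots> = 2 ^ lvl k'" by simp
      also have "\<dots> \<le> l" using lvl_bounds[OF k'3] by (simp add: l_def)
      finally show "real (card (heavy k')) \<le> l" .
    qed simp
    also have "\<dots> \<le> 1 / l"
      using big sq l1 by (simp add: l_def[symmetric] power2_eq_square field_simps)
    also have "\<dots> \<le> 1 / 2 ^ d" using False l1 by (intro divide_left_mono) auto
    also have "\<dots> = (1 / 2) ^ d" by (simp add: power_one_over)
    finally show ?thesis using dk block_weight_nonneg[of k'] by (simp add: add_increasing)
  qed
qed

text \<open>The same block and the next one contribute \<open>geo\<close> each, with separations
  counted from \<open>i\<close> and from the start of the next block; the geometric errors of the
  farther blocks sum to at most 4.\<close>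

lemma later_sum:
  assumes k: "k \<ge> 3" "i < 2 ^ lvl k" and big: "\<And>k'. k \<le> k' \<Longrightarrow> ln (real k') ^ 2 \<le> sqrt (real k')"
  shows "(\<Sum>k'=k..M. \<Sum>i'\<in>{i' \<in> heavy k'. pt k i < pt k' i'}. gap_factor k i k' i')
    \<le> 2 * geo + 4 + exp 2 * (\<Sum>k'=k..M. block_weight k')"
proof -
  have blk: "(\<Sum>i'\<in>{i' \<in> heavy k'. pt k i < pt k' i'}. gap_factor k i k' i') \<le>
      geo * of_bool (k' = k) + geo * of_bool (k' = Suc k) + exp 2 * block_weight k' + 2 * (1 / 2) ^ (k' - k)"
    if k': "k \<le> k'" for k'
  proof -
    have k'3: "k' \<ge> 3" using k k' by simp
    have nn: "0 \<le> exp 2 * block_weight k'" "0 \<le> 2 * (1 / 2 :: real) ^ (k' - k)"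
      using block_weight_nonneg[of k'] by auto
    consider "k' = k" | "k' = Suc k" | "k + 2 \<le> k'" using k' by linarith
    then show ?thesis
    proof cases
      case 1
      have lt: "i < i'" if "pt k i < pt k i'" for i' using that pt_mono[of i' i k] by (meson not_le)
      have "(\<Sum>i'\<in>{i' \<in> heavy k'. pt k i < pt k' i'}. gap_factor k i k' i') \<le> geo"
      proof (rule near_block_sum[where f="\<lambda>i'. i' - i", OF k'3])
        show "inj_on (\<lambda>i'. i' - i) {i' \<in> heavy k'. pt k i < pt k' i'}"
          using lt 1 by (auto intro!: inj_onI) (metis eq_diff_iff less_imp_le)
      qed (use 1 lt in \<open>auto simp: pt_diff of_nat_diff less_imp_le\<close>)
      then show ?thesis using 1 nn by simp
    next
      case 2
      have hL: "2 ^ (k' - lvl k') * 2 ^ lvl k' = (2::real) ^ (k + 1)" using lvl_le[OF k'3] 2 by (simp flip: power_add)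
      have "(\<Sum>i'\<in>{i' \<in> heavy k'. pt k i < pt k' i'}. gap_factor k i k' i') \<le> geo"
      proof (rule near_block_sum[where f="\<lambda>i'. i'", OF k'3])
        fix i'
        have "real (pt k' i') = 2 ^ (k + 1) + 2 ^ (k' - lvl k') * real i'"
          unfolding hL[symmetric] by (simp add: pt_def algebra_simps)
        then show "2 ^ (k' - lvl k') * real i' \<le> real (pt k' i') - real (pt k i)"
          using real_pt_bounds[OF k(1), of i] k(2) by simp
      qed auto
      then show ?thesis using 2 nn by simp
    next
      case 3
      have "(\<Sum>i'\<in>{i' \<in> heavy k'. pt k i < pt k' i'}. gap_factor k i k' i') \<le> (\<Sum>i'\<in>heavy k'. gap_factor k i k' i')"
        by (intro sum_mono2 finite_heavy) (auto simp: gap_factor_def)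
      also note far_block_sum[OF k 3 big[OF k']]
      finally show ?thesis using 3 by simp
    qed
  qed
  have "(\<Sum>k'=k..M. \<Sum>i'\<in>{i' \<in> heavy k'. pt k i < pt k' i'}. gap_factor k i k' i') \<le>
    (\<Sum>k'=k..M. geo * of_bool (k' = k) + geo * of_bool (k' = Suc k) + exp 2 * block_weight k' + 2 * (1 / 2) ^ (k' - k))"
    by (intro sum_mono blk) auto
  also have "\<dots> = geo * (\<Sum>k'=k..M. of_bool (k' = k)) + geo * (\<Sum>k'=k..M. of_bool (k' = Suc k)) +
      exp 2 * (\<Sum>k'=k..M. block_weight k') + 2 * (\<Sum>k'=k..M. (1 / 2) ^ (k' - k))"
    by (simp add: sum.distrib sum_distrib_left)
  finally have le: "(\<Sum>k'=k..M. \<Sum>i'\<in>{i' \<in> heavy k'. pt k i < pt k' i'}. gap_factor k i k' i') \<le>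
      geo * (\<Sum>k'=k..M. of_bool (k' = k)) + geo * (\<Sum>k'=k..M. of_bool (k' = Suc k)) +
      exp 2 * (\<Sum>k'=k..M. block_weight k') + 2 * (\<Sum>k'=k..M. (1 / 2) ^ (k' - k))" .
  have ob: "(\<Sum>k'=k..M. of_bool (k' = c)) \<le> (1::real)" for c
  proof -
    have "card ({k..M} \<inter> {c}) \<le> card {c}" by (intro card_mono) auto
    then show ?thesis by (simp add: Collect_conv_if Int_commute)
  qed
  have "geo * (\<Sum>k'=k..M. of_bool (k' = k)) + geo * (\<Sum>k'=k..M. of_bool (k' = Suc k)) +
      exp 2 * (\<Sum>k'=k..M. block_weight k') + 2 * (\<Sum>k'=k..M. (1 / 2) ^ (k' - k))
      \<le> geo * 1 + geo * 1 + exp 2 * (\<Sum>k'=k..M. block_weight k') + 2 * 2"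
  proof (intro add_mono mult_left_mono geo_nonneg order_refl ob)
    show "(\<Sum>k'=k..M. (1 / 2 :: real) ^ (k' - k)) \<le> 2"
      using sum_power_le_geometric[of "1 / 2" "{k..M}" "\<lambda>k'. k' - k"] by (simp add: inj_on_def) (metis (no_types, lifting) eq_diff_iff inj_onI atLeastAtMost_iff)
  qed auto
  with le show ?thesis by simp
qed

text \<open>The factor \<open>2 * exp 61\<close> covers the two orders of a pair, and
  \<open>2 * exp 62\<close> is \<open>exp 2\<close> from distant blocks times
  \<open>2 * exp 60\<close> for turning block weights into probabilities.\<close>

definition moment_const :: real where
  "moment_const = 1 + 2 * exp 61 * (2 * geo + 4 + 2 * exp 62)"

lemma moment_const_ge: "1 \<le> moment_const"
  using geo_nonneg by (simp add: moment_const_def)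

lemma pt_less_block: "k \<ge> 3 \<Longrightarrow> k < k' \<Longrightarrow> i < 2 ^ lvl k \<Longrightarrow> pt k i < pt k' i'"
proof -
  assume a: "k \<ge> 3" "k < k'" "i < 2 ^ lvl k"
  have "pt k i < 2 ^ (k + 1)" using pt_strict_mono[OF a(3), of k] by (simp add: pt_top[OF a(1)])
  also have "\<dots> \<le> (2::nat) ^ k'" using a by (intro power_increasing) auto
  also have "\<dots> \<le> pt k' i'" using pt_mono[of 0 i' k'] pt_0[of k'] a by simp
  finally show ?thesis .
qed

lemma block_weight_le_missed:
  assumes "\<And>k. K0 \<le> k \<Longrightarrow> controlled z k"
  shows "(\<Sum>k=K0..M. block_weight k) \<le> 2 * exp 60 * (\<Sum>p\<in>Sigma {K0..M} heavy. gauss.prob (missed (fst p) (snd p)))"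
proof -
  have "(\<Sum>k=K0..M. block_weight k) = (\<Sum>p\<in>Sigma {K0..M} heavy. exp (- wt (fst p) (snd p)))"
    unfolding block_weight_def using finite_heavy by (subst sum.Sigma) (auto simp: case_prod_beta)
  also have "\<dots> \<le> (\<Sum>p\<in>Sigma {K0..M} heavy. 2 * exp 60 * gauss.prob (missed (fst p) (snd p)))"
    using assms by (intro sum_mono missed_lower) auto
  finally show ?thesis by (simp add: sum_distrib_left)
qed

text \<open>Distinct indices have distinct times, so every pair is diagonal or ordered in time. The
  diagonal gives the first moment, and \<open>later_sum\<close> bounds the later partners of each
  index.\<close>

lemma second_moment:
  fixes M :: nat
  assumes K0: "\<And>k. K0 \<le> k \<Longrightarrow> controlled z k \<and> ln (real k) ^ 2 \<le> sqrt (real k)"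
  defines "I \<equiv> Sigma {K0..M} heavy"
  defines "m \<equiv> \<lambda>p. gauss.prob (missed (fst p) (snd p))"
  shows "(\<Sum>p\<in>I. \<Sum>q\<in>I. gauss.prob (missed (fst p) (snd p) \<inter> missed (fst q) (snd q)))
     \<le> moment_const * (sum m I + (sum m I)\<^sup>2)"
proof -
  have fin: "finite I" unfolding I_def using finite_heavy by auto
  define \<pi> where "\<pi> p = pt (fst p) (snd p)" for p
  define X where "X p q = exp 61 * m p * gap_factor (fst p) (snd p) (fst q) (snd q)" for p q
  have k3: "k \<ge> 3" if "k \<ge> K0" for k using K0[OF that] by (simp add: controlled_def)
  have inI: "fst p \<ge> K0 \<and> snd p \<in> heavy (fst p) \<and> snd p < 2 ^ lvl (fst p)" if "p \<in> I" for p
    using that by (auto simp: I_def heavy_def)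
  have ord: "fst p \<le> fst q" if "p \<in> I" "q \<in> I" "\<pi> p < \<pi> q" for p q
    using pt_less_block[of "fst q" "fst p" "snd q" "snd p"] that inI[OF that(1)] inI[OF that(2)] k3
    unfolding \<pi>_def by (meson not_le not_less_iff_gr_or_eq)
  have inj: "p = q" if "p \<in> I" "q \<in> I" "\<pi> p = \<pi> q" for p q
  proof -
    have "fst p = fst q"
      using pt_less_block[of "fst q" "fst p" "snd q" "snd p"] pt_less_block[of "fst p" "fst q" "snd p" "snd q"]
        that inI[OF that(1)] inI[OF that(2)] k3 unfolding \<pi>_def
      by (metis less_irrefl linorder_neqE_nat)
    moreover from this have "snd p = snd q"
      using that(3) pt_strict_mono unfolding \<pi>_def by (metis less_irrefl linorder_neqE_nat)
    ultimately show ?thesis by (rule prod_eqI)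
  qed
  have m0: "0 \<le> m p" for p by (simp add: m_def)
  define s where "s = sum m I"
  have s0: "0 \<le> s" unfolding s_def by (intro sum_nonneg m0)
  have later: "(\<Sum>q\<in>{q \<in> I. \<pi> p < \<pi> q}. X p q) \<le> exp 61 * m p * (2 * geo + 4 + 2 * exp 62 * s)" if p: "p \<in> I" for p
  proof -
    obtain k i where pk: "p = (k, i)" by (cases p)
    have ki: "k \<ge> K0" "i \<in> heavy k" "i < 2 ^ lvl k" using inI[OF p] by (auto simp: pk)
    have set: "{q \<in> I. \<pi> p < \<pi> q} = Sigma {k..M} (\<lambda>k'. {i' \<in> heavy k'. pt k i < pt k' i'})"
    proof (intro equalityI subsetI)
      fix q assume q: "q \<in> {q \<in> I. \<pi> p < \<pi> q}"
      then show "q \<in> Sigma {k..M} (\<lambda>k'. {i' \<in> heavy k'. pt k i < pt k' i'})"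
        using ord[OF p, of q] by (auto simp: pk I_def \<pi>_def)
    next
      fix q assume "q \<in> Sigma {k..M} (\<lambda>k'. {i' \<in> heavy k'. pt k i < pt k' i'})"
      then show "q \<in> {q \<in> I. \<pi> p < \<pi> q}" using ki by (auto simp: pk I_def \<pi>_def)
    qed
    have "(\<Sum>k'=k..M. block_weight k') \<le> (\<Sum>k'=K0..M. block_weight k')"
      using ki block_weight_nonneg by (intro sum_mono2) auto
    also have "\<dots> \<le> 2 * exp 60 * s"
      unfolding s_def m_def I_def using K0 by (intro block_weight_le_missed) auto
    finally have bw: "(\<Sum>k'=k..M. block_weight k') \<le> 2 * exp 60 * s" .
    have "(\<Sum>q\<in>{q \<in> I. \<pi> p < \<pi> q}. X p q) = exp 61 * m p *
       (\<Sum>k'=k..M. \<Sum>i'\<in>{i' \<in> heavy k'. pt k i < pt k' i'}. gap_factor k i k' i')"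
      unfolding set X_def sum_distrib_left[symmetric] using finite_heavy
      by (subst sum.Sigma) (auto simp: case_prod_beta pk)
    also have "\<dots> \<le> exp 61 * m p * (2 * geo + 4 + exp 2 * (\<Sum>k'=k..M. block_weight k'))"
      using ki K0 k3 m0 by (intro mult_left_mono later_sum) auto
    also have "\<dots> \<le> exp 61 * m p * (2 * geo + 4 + exp 2 * (2 * exp 60 * s))"
      using m0 bw by (intro mult_left_mono add_left_mono) auto
    also have "exp 2 * (2 * exp 60 * s) = 2 * exp 62 * s" by (simp flip: exp_add)
    finally show ?thesis .
  qed
  have pair: "gauss.prob (missed (fst p) (snd p) \<inter> missed (fst q) (snd q)) \<le>
      (if p = q then m p else 0) + (if \<pi> p < \<pi> q then X p q else 0) + (if \<pi> q < \<pi> p then X q p else 0)"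
    if pq: "p \<in> I" "q \<in> I" for p q
  proof -
    have X0: "0 \<le> X p q" for p q using m0 by (simp add: X_def gap_factor_def)
    consider "p = q" | "\<pi> p < \<pi> q" | "\<pi> q < \<pi> p" using inj[OF pq] by (meson linorder_neqE_nat)
    then show ?thesis
    proof cases
      case 1 then show ?thesis by (simp add: m_def)
    next
      case 2
      have "gauss.prob (missed (fst p) (snd p) \<inter> missed (fst q) (snd q)) \<le> X p q"
        unfolding X_def m_def using pq inI K0 2 by (intro missed_pair) (auto simp: \<pi>_def)
      then show ?thesis using 2 m0[of p] by auto
    next
      case 3
      have "gauss.prob (missed (fst q) (snd q) \<inter> missed (fst p) (snd p)) \<le> X q p"
        unfolding X_def m_def using pq inI K0 3 by (intro missed_pair) (auto simp: \<pi>_def)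
      then show ?thesis using 3 m0[of p] by (auto simp: Int_commute)
    qed
  qed
  have "(\<Sum>p\<in>I. \<Sum>q\<in>I. gauss.prob (missed (fst p) (snd p) \<inter> missed (fst q) (snd q))) \<le>
    (\<Sum>p\<in>I. \<Sum>q\<in>I. (if p = q then m p else 0) + (if \<pi> p < \<pi> q then X p q else 0) + (if \<pi> q < \<pi> p then X q p else 0))"
    by (intro sum_mono pair)
  also have "\<dots> = (\<Sum>p\<in>I. \<Sum>q\<in>I. if p = q then m p else 0) + (\<Sum>p\<in>I. \<Sum>q\<in>I. if \<pi> p < \<pi> q then X p q else 0)
      + (\<Sum>p\<in>I. \<Sum>q\<in>I. if \<pi> q < \<pi> p then X q p else 0)"
    by (simp only: sum.distrib)
  also have "(\<Sum>p\<in>I. \<Sum>q\<in>I. if \<pi> q < \<pi> p then X q p else 0) = (\<Sum>p\<in>I. \<Sum>q\<in>I. if \<pi> p < \<pi> q then X p q else 0)"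
    by (rule sum.swap)
  also have "(\<Sum>p\<in>I. \<Sum>q\<in>I. if p = q then m p else 0) = s"
    using fin by (simp add: s_def)
  also have "(\<Sum>p\<in>I. \<Sum>q\<in>I. if \<pi> p < \<pi> q then X p q else 0) = (\<Sum>p\<in>I. \<Sum>q\<in>{q \<in> I. \<pi> p < \<pi> q}. X p q)"
    using fin by (simp add: sum.inter_filter)
  also have "s + (\<Sum>p\<in>I. \<Sum>q\<in>{q \<in> I. \<pi> p < \<pi> q}. X p q) + (\<Sum>p\<in>I. \<Sum>q\<in>{q \<in> I. \<pi> p < \<pi> q}. X p q)
      \<le> s + (\<Sum>p\<in>I. exp 61 * m p * (2 * geo + 4 + 2 * exp 62 * s)) + (\<Sum>p\<in>I. exp 61 * m p * (2 * geo + 4 + 2 * exp 62 * s))"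
    by (intro add_mono order_refl sum_mono later)
  also have "(\<Sum>p\<in>I. exp 61 * m p * (2 * geo + 4 + 2 * exp 62 * s)) = exp 61 * s * (2 * geo + 4 + 2 * exp 62 * s)"
    by (simp add: s_def sum_distrib_left sum_distrib_right)
  also have "s + exp 61 * s * (2 * geo + 4 + 2 * exp 62 * s) + exp 61 * s * (2 * geo + 4 + 2 * exp 62 * s)
      \<le> moment_const * (s + s\<^sup>2)"
  proof -
    define a b E where "a = 2 * geo + 4" and "b = 2 * exp (62::real)" and "E = 2 * exp (61::real)"
    have ab: "0 \<le> a" "0 \<le> b" "0 \<le> E" using geo_nonneg by (auto simp: a_def b_def E_def)
    have mc: "moment_const = 1 + E * (a + b)" by (simp add: moment_const_def a_def b_def E_def)
    have "0 \<le> s\<^sup>2 + E * a * s\<^sup>2 + E * b * s" using ab s0 by (intro add_nonneg_nonneg mult_nonneg_nonneg) auto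
    then have "s + E * s * (a + b * s) \<le> (1 + E * (a + b)) * (s + s\<^sup>2)"
      by (simp add: algebra_simps power2_eq_square)
    moreover have "s + exp 61 * s * (2 * geo + 4 + 2 * exp 62 * s) + exp 61 * s * (2 * geo + 4 + 2 * exp 62 * s)
       = s + E * s * (a + b * s)" by (simp add: a_def b_def E_def)
    ultimately show ?thesis by (simp only: mc)
  qed
  finally show ?thesis by (simp add: s_def)
qed

text \<open>By the zero-one law it suffices to exclude probability 1. The number \<open>S\<close> of
  misses among the selected times would then vanish off a set of probability below
  \<open>1 / (4 * C)\<close>, whereas its mean \<open>s\<close> and second moment at most
  \<open>2 * C * s\<^sup>2\<close> keep it positive on a larger set.\<close>

theorem not_eventually_always_hit:
  assumes div: "\<not> summable rs_term"
  shows "gauss.prob (ev_always_hit r z) = 0"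
proof (rule ccontr)
  assume "gauss.prob (ev_always_hit r z) \<noteq> 0"
  then have H1: "gauss.prob (ev_always_hit r z) = 1" using ev_always_hit_zero_one by blast
  define C where "C = moment_const"
  have C1: "1 \<le> C" using moment_const_ge by (simp add: C_def)
  define Hit where "Hit n = {x \<in> {0..1}. \<forall>m\<ge>n. hit m x}" for n
  have Hm [measurable]: "Hit n \<in> sets \<M>" for n
  proof -
    have "{x \<in> space \<M>. \<forall>m\<in>{n..}. \<exists>k\<in>{..<m}. (gauss_map ^^ k) x \<in> unit_ball z (r m)} \<in> sets \<M>"
      by measurable
    moreover have "{x \<in> space \<M>. \<forall>m\<in>{n..}. \<exists>k\<in>{..<m}. (gauss_map ^^ k) x \<in> unit_ball z (r m)} = Hit n"
      by (auto simp: Hit_def hit_def)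
    ultimately show ?thesis by simp
  qed
  have "(\<lambda>n. gauss.prob (Hit n)) \<longlonglongrightarrow> gauss.prob (\<Union>n. Hit n)"
    using Hm by (intro gauss.finite_Lim_measure_incseq) (auto simp: incseq_def Hit_def)
  also have "(\<Union>n. Hit n) = ev_always_hit r z"
    unfolding Hit_def set_eq_iff by (simp add: mem_ev_always_hit eventually_sequentially)
  finally have "(\<lambda>n. gauss.prob (Hit n)) \<longlonglongrightarrow> 1" by (simp only: H1)
  then have "\<forall>\<^sub>F n in sequentially. 1 - 1 / (4 * C) < gauss.prob (Hit n)"
    using C1 by (intro order_tendstoD) auto
  then obtain n where n: "1 - 1 / (4 * C) < gauss.prob (Hit n)"
    by (auto simp: eventually_sequentially)
  have "\<forall>\<^sub>F k :: nat in sequentially. ln (real k) ^ 2 \<le> sqrt (real k)" by real_asymp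
  then have "\<forall>\<^sub>F k in sequentially. controlled z k \<and> ln (real k) ^ 2 \<le> sqrt (real k)"
    using typical_controlled[OF z typical] by eventually_elim simp
  then obtain K1 where K1: "\<And>k. k \<ge> K1 \<Longrightarrow> controlled z k \<and> ln (real k) ^ 2 \<le> sqrt (real k)"
    by (auto simp: eventually_sequentially)
  define K0 where "K0 = max K1 n"
  have K0: "controlled z k \<and> ln (real k) ^ 2 \<le> sqrt (real k)" if "K0 \<le> k" for k
    using K1[of k] that by (simp add: K0_def)
  have k3: "k \<ge> 3" if "K0 \<le> k" for k using K0[OF that] by (simp add: controlled_def)
  have "\<not> summable (\<lambda>k. block_weight (k + K0))"
    using block_weight_not_summable[OF div] by (simp add: summable_iff_shift)
  then have "\<not> (\<forall>N. sum (\<lambda>k. block_weight (k + K0)) {..<N} \<le> 2 * exp 60)"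
    using block_weight_nonneg by (meson summableI_nonneg_bounded)
  \<comment> \<open>This threshold makes \<open>s \<ge> 1\<close>, so that the linear term of the
    second moment bound is absorbed by the quadratic one.\<close>
  then obtain N where N: "2 * exp 60 < (\<Sum>k<N. block_weight (k + K0))" by (auto simp: not_le)
  define M where "M = K0 + N"
  define I where "I = Sigma {K0..M} heavy"
  define m where "m p = gauss.prob (missed (fst p) (snd p))" for p
  define s where "s = sum m I"
  have fin: "finite I" unfolding I_def using finite_heavy by auto
  have inI: "fst p \<ge> K0 \<and> snd p \<in> heavy (fst p) \<and> snd p < 2 ^ lvl (fst p)" if "p \<in> I" for p
    using that by (auto simp: I_def heavy_def)
  have s1: "1 \<le> s"
  proof -
    have "(\<Sum>k<N. block_weight (k + K0)) = (\<Sum>k\<in>{K0..<K0 + N}. block_weight k)"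
      by (rule sum.reindex_bij_witness[of _ "\<lambda>k. k - K0" "\<lambda>k. k + K0"]) auto
    also have "\<dots> \<le> (\<Sum>k=K0..M. block_weight k)"
      using block_weight_nonneg by (intro sum_mono2) (auto simp: M_def)
    also have "\<dots> \<le> 2 * exp 60 * s"
      unfolding s_def m_def I_def using K0 by (intro block_weight_le_missed) auto
    finally have "2 * exp 60 * 1 \<le> 2 * exp 60 * s" using N by linarith
    then show ?thesis by (subst (asm) mult_le_cancel_left_pos) auto
  qed
  define S where "S x = (\<Sum>p\<in>I. indicator (missed (fst p) (snd p)) x :: real)" for x
  have Sm [measurable]: "S \<in> borel_measurable \<M>" unfolding S_def by measurable
  have int_ind: "integrable \<M> (indicator A :: real \<Rightarrow> real)" if "A \<in> sets \<M>" for A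
    by (rule bounded_integrable[where C=1]) (use that in \<open>auto simp: indicator_def\<close>)
  have S1: "(LINT x|\<M>. S x) = s" and iS: "integrable \<M> S"
    unfolding S_def s_def m_def
    by (auto simp: expectation_indicator int_ind simp del: Bochner_Integration.integral_indicator)
  have Ssq: "(S x)\<^sup>2 = (\<Sum>p\<in>I. \<Sum>q\<in>I. indicator (missed (fst p) (snd p) \<inter> missed (fst q) (snd q)) x)" for x
    unfolding S_def power2_eq_square sum_product by (simp add: indicator_inter_arith)
  have iS2: "integrable \<M> (\<lambda>x. (S x)\<^sup>2)"
    unfolding Ssq by (intro Bochner_Integration.integrable_sum int_ind) auto
  have "(LINT x|\<M>. (S x)\<^sup>2) = (\<Sum>p\<in>I. \<Sum>q\<in>I. gauss.prob (missed (fst p) (snd p) \<inter> missed (fst q) (snd q)))"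
    unfolding Ssq using int_ind
    by (auto simp: expectation_indicator simp del: Bochner_Integration.integral_indicator)
  also have "\<dots> \<le> C * (s + s\<^sup>2)"
    unfolding C_def s_def m_def I_def using K0 by (intro second_moment) auto
  also have "\<dots> \<le> C * (s * s + s\<^sup>2)" using s1 C1 by (intro mult_left_mono add_right_mono) auto
  finally have S2: "(LINT x|\<M>. (S x)\<^sup>2) \<le> 2 * C * s\<^sup>2" by (simp add: power2_eq_square)
  define t where "t = 2 * C * s"
  have t0: "0 < t" using C1 s1 by (simp add: t_def)
  define Q where "Q = space \<M> - Hit n"
  have Qm: "Q \<in> sets \<M>" unfolding Q_def by measurable
  \<comment> \<open>Cauchy-Schwarz in linear form:
    \<open>2 * S * t \<le> S\<^sup>2 + t\<^sup>2\<close>, used only where \<open>S\<close> may be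
    nonzero. With \<open>t = 2 * C * s\<close> the two terms integrate to at most
    \<open>s / 2\<close> and \<open>s / 4\<close>.\<close>
  have pw: "S x \<le> (S x)\<^sup>2 / (2 * t) + t / 2 * indicator Q x" if x: "x \<in> {0..1}" for x
  proof (cases "x \<in> Hit n")
    case True
    have "x \<notin> missed (fst p) (snd p)" if p: "p \<in> I" for p
    proof
      assume a: "x \<in> missed (fst p) (snd p)"
      have "\<not> hit (pt (fst p) (snd p)) x"
        using missed_not_hit[OF _ _ a] inI[OF p] k3 by blast
      moreover have "n \<le> pt (fst p) (snd p)"
      proof -
        have "n \<le> fst p" using inI[OF p] by (simp add: K0_def)
        also have "\<dots> \<le> 2 ^ fst p" using less_exp[of "fst p"] by simp
        also have "\<dots> \<le> pt (fst p) (snd p)"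
          using pt_bounds[of "fst p" "snd p"] inI[OF p] k3[of "fst p"] by simp
        finally show ?thesis .
      qed
      ultimately show False using True by (auto simp: Hit_def)
    qed
    then have "S x = 0" by (simp add: S_def)
    then show ?thesis using t0 by simp
  next
    case False
    have "0 \<le> (S x - t)\<^sup>2" by simp
    then have "2 * S x * t \<le> (S x)\<^sup>2 + t\<^sup>2" by (simp add: power2_diff)
    then have "S x * (2 * t) \<le> (S x)\<^sup>2 + t\<^sup>2" by (simp only: ac_simps)
    then have "S x \<le> ((S x)\<^sup>2 + t\<^sup>2) / (2 * t)" using t0 by (simp add: pos_le_divide_eq)
    also have "\<dots> = (S x)\<^sup>2 / (2 * t) + t / 2" using t0 by (simp add: add_divide_distrib power2_eq_square)
    finally show ?thesis using False x by (simp add: Q_def)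
  qed
  have "s \<le> (LINT x|\<M>. (S x)\<^sup>2 / (2 * t) + t / 2 * indicator Q x)"
    unfolding S1[symmetric] using pw iS iS2 int_ind[OF Qm]
    by (intro integral_mono) auto
  also have "\<dots> = (LINT x|\<M>. (S x)\<^sup>2) / (2 * t) + t / 2 * gauss.prob Q"
    using iS2 int_ind[OF Qm]
    by (subst Bochner_Integration.integral_add)
      (auto simp: expectation_indicator[OF Qm] simp del: Bochner_Integration.integral_indicator)
  also have "\<dots> \<le> 2 * C * s\<^sup>2 / (2 * t) + t / 2 * (1 / (4 * C))"
  proof (intro add_mono divide_right_mono mult_left_mono S2)
    show "gauss.prob Q \<le> 1 / (4 * C)"
      unfolding Q_def using n by (subst gauss.prob_compl) auto
  qed (use t0 in auto)
  also have "\<dots> = 3 / 4 * s" using C1 s1 by (simp add: t_def power2_eq_square field_simps)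
  finally show False using s1 by simp
qed

text \<open>Strict monotonicity turns the inequality for \<open>\<psi>\<close> into a visit to the
  closed ball. Closed and open balls differ at two points for each of countably many radii, and
  almost every orbit avoids all of these. The shift \<open>i - 1\<close> matches the process indexed
  from 1.\<close>

lemma max_event_AE:
  fixes \<psi> :: "real \<Rightarrow> ereal"
  assumes \<psi>: "strict_antimono_on {0..} \<psi>"
  shows "AE x in \<M>. x \<in> max_event \<psi> r z \<longleftrightarrow> x \<in> ev_always_hit r z"
proof -
  have "AE x in \<M>. (gauss_map ^^ k) x \<noteq> c" for k c
    by (rule AE_funpow[OF gauss_AE_neq])
  then have "AE x in \<M>. \<forall>n k. (gauss_map ^^ k) x \<noteq> z + r n \<and> (gauss_map ^^ k) x \<noteq> z - r n"
    unfolding AE_all_countable by (intro allI AE_conjI)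
  then show ?thesis using AE_space
  proof eventually_elim
    case (elim x)
    then have x: "x \<in> {0..1}" by simp
    have le: "\<psi> a \<le> \<psi> b \<longleftrightarrow> b \<le> a" if "0 \<le> a" "0 \<le> b" for a b
      using \<psi> that unfolding monotone_on_def by (metis atLeast_iff linorder_neqE_linordered_idom not_le order_less_le order_refl)
    have "\<psi> (r n) \<le> obs_max \<psi> z n x \<longleftrightarrow> hit n x" if n: "n \<ge> 1" for n
    proof -
      have "\<psi> (r n) \<le> obs_max \<psi> z n x \<longleftrightarrow> (\<exists>i\<in>{1..n}. \<psi> (r n) \<le> obs_process \<psi> z i x)"
        unfolding obs_max_def using n by (subst Max_ge_iff) auto
      also have "\<dots> \<longleftrightarrow> (\<exists>i\<in>{1..n}. \<bar>(gauss_map ^^ (i - 1)) x - z\<bar> \<le> r n)"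
        unfolding obs_process_def observable_def using r_pos[OF n] by (simp add: le)
      also have "\<dots> \<longleftrightarrow> (\<exists>k<n. \<bar>(gauss_map ^^ k) x - z\<bar> \<le> r n)"
      proof
        assume "\<exists>i\<in>{1..n}. \<bar>(gauss_map ^^ (i - 1)) x - z\<bar> \<le> r n"
        then obtain i where "i \<in> {1..n}" "\<bar>(gauss_map ^^ (i - 1)) x - z\<bar> \<le> r n" by blast
        then show "\<exists>k<n. \<bar>(gauss_map ^^ k) x - z\<bar> \<le> r n" by (intro exI[of _ "i - 1"]) auto
      next
        assume "\<exists>k<n. \<bar>(gauss_map ^^ k) x - z\<bar> \<le> r n"
        then obtain k where "k < n" "\<bar>(gauss_map ^^ k) x - z\<bar> \<le> r n" by blast
        then show "\<exists>i\<in>{1..n}. \<bar>(gauss_map ^^ (i - 1)) x - z\<bar> \<le> r n" by (intro bexI[of _ "Suc k"]) auto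
      qed
      also have "\<dots> \<longleftrightarrow> hit n x"
      proof -
        have "\<bar>(gauss_map ^^ k) x - z\<bar> \<le> r n \<longleftrightarrow> (gauss_map ^^ k) x \<in> unit_ball z (r n)" for k
        proof -
          have "(gauss_map ^^ k) x \<noteq> z + r n" "(gauss_map ^^ k) x \<noteq> z - r n" using elim(1) by auto
          then show ?thesis using gauss_funpow_in[OF x, of k] by (auto simp: unit_ball_def)
        qed
        then show ?thesis by (simp add: hit_def)
      qed
      finally show ?thesis .
    qed
    then have "(\<forall>\<^sub>F n in sequentially. \<psi> (r n) \<le> obs_max \<psi> z n x) \<longleftrightarrow> (\<forall>\<^sub>F n in sequentially. hit n x)"
      by (intro eventually_subst eventually_mono[OF eventually_ge_at_top[of 1]])
    then show "x \<in> max_event \<psi> r z \<longleftrightarrow> x \<in> ev_always_hit r z"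
      using x by (simp add: max_event_def mem_ev_always_hit)
  qed
qed

lemma measure_max_event:
  assumes "strict_antimono_on {0..} \<psi>" "continuous_on {0..} \<psi>"
  shows "gauss.prob (max_event \<psi> r z) = gauss.prob (ev_always_hit r z)"
  by (rule gauss.finite_measure_eq_AE[OF max_event_AE sets_max_event sets_ev_always_hit]) (use assms in auto)

end

theorem corollary2p5:
  fixes \<psi> :: "real \<Rightarrow> ereal" and r :: "nat \<Rightarrow> real"
  assumes psi_range: "\<forall>y\<ge>0. \<psi> y \<noteq> -\<infinity>"
    and psi_decreasing: "strict_antimono_on {0..} \<psi>"
    and psi_continuous: "continuous_on {0..} \<psi>"
    and psi_infinity: "(\<psi> \<longlongrightarrow> \<infinity>) (at_right 0)"
    and r_positive: "\<forall>n\<ge>1. 0 < r n"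
    and r_noninc: "antimono_on {1..} r"
    and r_bigo: "\<exists>\<sigma>>4/5. r \<in> O(\<lambda>n. real n powr (- \<sigma>))"
    and r_ratio: "\<forall>t::real. 0 < t \<longrightarrow>
      limsup (\<lambda>k. ereal (r (nat \<lfloor>real k powr t\<rfloor>) / r (nat \<lfloor>real (k + 1) powr t\<rfloor>))) < \<infinity>"
  shows "AE z in gauss_measure.
    mono_on {1..} (\<lambda>n::nat. real n * measure gauss_measure (unit_ball z (r n))) \<longrightarrow>
      (summable (\<lambda>n. measure gauss_measure (unit_ball z (r (Suc n))) *
           exp (- real (Suc n) * measure gauss_measure (unit_ball z (r (Suc n))))) \<and>
       \<not> summable (\<lambda>n. measure gauss_measure (unit_ball z (r (Suc n)))) \<longrightarrow>
         measure gauss_measure (ev_always_hit r z) = 1 \<and>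
         measure gauss_measure (max_event \<psi> r z) = 1) \<and>
      (\<not> summable (\<lambda>n. measure gauss_measure (unit_ball z (r (Suc n))) *
           exp (- real (Suc n) * measure gauss_measure (unit_ball z (r (Suc n))))) \<longrightarrow>
         measure gauss_measure (ev_always_hit r z) = 0 \<and>
         measure gauss_measure (max_event \<psi> r z) = 0)"
proof -
  obtain \<sigma> where \<sigma>: "\<sigma> > 4 / 5" "r \<in> O(\<lambda>n. real n powr (- \<sigma>))" using r_bigo by blast
  have "(\<lambda>n. real n powr (- \<sigma>)) \<longlonglongrightarrow> 0"
    using \<sigma>(1) by (intro tendsto_neg_powr filterlim_real_sequentially) auto
  moreover obtain c where "\<forall>\<^sub>F n in sequentially. norm (r n) \<le> c * norm (real n powr (- \<sigma>))"
    using \<sigma>(2) by (elim landau_o.bigE)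
  ultimately have r_lim: "r \<longlonglongrightarrow> 0"
    by (intro Lim_null_comparison[where f=r and g="\<lambda>n. c * norm (real n powr (- \<sigma>))"])
       (auto intro!: tendsto_mult_right_zero tendsto_norm_zero)
  show ?thesis using AE_typical AE_space
  proof eventually_elim
    case (elim z)
    show ?case
    proof (rule impI, goal_cases)
      case 1
      interpret shrinking_target r z
      proof
        show "r n \<le> r m" if "1 \<le> m" "m \<le> n" for m n
          using monotone_onD[OF r_noninc, of m n] that by auto
        show "real m * ball_mass z (r m) \<le> real n * ball_mass z (r n)" if "1 \<le> m" "m \<le> n" for m n
          using mono_onD[OF 1, of m n] that by auto
      qed (use elim r_positive r_lim in auto)
      \<comment> \<open>The series of the statement start at index 1, whereas \<open>rs_term\<close>
        has a term at 0; a single term does not affect summability.\<close>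
      have "summable (\<lambda>n. ball_mass z (r (Suc n)) * exp (- real (Suc n) * ball_mass z (r (Suc n)))) \<longleftrightarrow> summable rs_term"
        using summable_Suc_iff[of rs_term] by (simp only: rs_term_def load_def mult_minus_left)
      moreover have "summable (\<lambda>n. ball_mass z (r (Suc n))) \<longleftrightarrow> summable (\<lambda>n. ball_mass z (r n))"
        by (rule summable_Suc_iff)
      ultimately show ?case
        using eventually_always_hit not_eventually_always_hit measure_max_event[OF psi_decreasing psi_continuous]
        by presburger
    qed
  qed
qed

end
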